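(* Let $$X:\ 0\to B\xrightarrow{j}H_2\xrightarrow{\partial}H_1\xrightarrow{p}C\to1,\qquad X':\ 0\to B'\xrightarrow{j'}G_2\xrightarrow{\partial'}G_1\xrightarrow{p'}C'\to1$$ be two crossed extensions of groups and let $\underline\varphi=(\varphi_0,\varphi)\colon\Pi(X)\to\Pi(X')$ be a morphism of group modules. Then: (i) The set of isomorphism classes $[\widehat E]\colon X\to X'$ of butterflies with $P[\widehat E]=\underline\varphi$ is not empty if and only if $\underline\varphi^*X'$ is isomorphic to $\underline\varphi_*X$ in $[\mathsf{BExt}](\mathsf{Gp})$ by an isomorphism lying in the fibre of $P$ over $\Pi(\underline\varphi^*X')$. (ii) If this is the case, such a set is a simply transitive $\Gamma$-set, where $$\Gamma=[\mathsf{BExt}](\mathsf{Gp})_{\Pi(\underline\varphi^*X')}(\underline\varphi^*X',\underline\varphi^*X')$$ is the group of automorphisms of the object $\underline\varphi^*X'$ in the fibre of $P\colon[\mathsf{BExt}](\mathsf{Gp})\to\mathsf{Mod}(\mathsf{Gp})$ over $\Pi(\underline\varphi^*X')$.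
   Context: A crossed module is a group homomorphism $\partial\colon G_2\to G_1$ with an action $*$ of $G_1$ on $G_2$ such that $\partial(g_1*g_2)=g_1\partial(g_2)g_1^{-1}$ (this alone: pre-crossed module) and $\partial(g_2)*g_2'=g_2g_2'g_2^{-1}$. A crossed extension of groups is an exact sequence $0\to B\xrightarrow{j}G_2\xrightarrow{\partial}G_1\xrightarrow{p}C\to1$ with $\partial$ a crossed module. It induces a $C$-module structure on $B$ by $j(p(g_1)*b)=g_1*j(b)$, and $\Pi(X)=(C,B)$ denotes this module. A morphism of modules $(\varphi_0,\varphi)\colon(C,B)\to(C',B')$ is a pair of homomorphisms with $\varphi(c*b)=\varphi_0(c)*\varphi(b)$; they form the category $\mathsf{Mod}(\mathsf{Gp})$. A butterfly $\widehat E$ from $X$ (crossed module $\partial_H\colon H_2\to H_1$) to $X'$ (crossed module $\partial_G\colon G_2\to G_1$) consists of a group $E$ and homomorphisms $\kappa\colon H_2\to E$, $\iota\colon G_2\to E$, $\delta\colon E\to H_1$, $\gamma\colon E\to G_1$ with $\delta\kappa=\partial_H$, $\gamma\iota=\partial_G$, $\gamma\kappa=1$ trivial, $G_2\xrightarrow{\iota}E\xrightarrow{\delta}H_1$ short exact, $\kappa(\delta(e)*h)=e\kappa(h)e^{-1}$ and $\iota(\gamma(e)*g)=e\iota(g)e^{-1}$. A 2-cell $\widehat E\Rightarrow\widehat E'$ is a homomorphism $E\to E'$ commuting with the $\kappa$'s, $\iota$'s, $\delta$'s, $\gamma$'s; it is necessarily an isomorphism. The composite of $\widehat E\colon\partial_H\to\partial_G$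 and $\widehat E'\colon\partial_G\to\partial_K$ has as group the quotient of $E\times_{G_1}E'$ (pullback of $\gamma$ and $\delta'$) by the normal subgroup $\{(\iota(g),\kappa'(g)):g\in G_2\}$, with structure maps $\kappa''(h)=[\kappa(h),1]$, $\iota''(k)=[1,\iota'(k)]$, $\delta''[e,e']=\delta(e)$, $\gamma''[e,e']=\gamma'(e')$. The identity of $\partial_G$ is $G_2\rtimes G_1$ with $\kappa(g)=(g^{-1},\partial_G g)$, $\iota(g)=(g,1)$, $\delta(g,g_1)=g_1$, $\gamma(g,g_1)=\partial_G(g)g_1$. $[\mathsf{BExt}](\mathsf{Gp})$ is the category whose objects are crossed extensions of groups and whose arrows are isomorphism classes of butterflies. The functor $P\colon[\mathsf{BExt}](\mathsf{Gp})\to\mathsf{Mod}(\mathsf{Gp})$ is $\Pi$ on objects and sends $[\widehat E]\colon X\to X'$ to $(\varphi_0,\varphi)$ with $\varphi_0(p\delta(e))=p'\gamma(e)$ for $e\in E$ and $\varphi$ determined by $\kappa(j(b))\cdot\iota(j'(\varphi(b)))=1$. The fibre of $P$ over a module consists of the arrows sent by $P$ to the identity of that module. $\underline\varphi^*X'$ is the crossed extension $B'\to G_2\xrightarrow{\langle\partial',0\rangle}G_1\times_{C'}C\to C$ (pullback of $p'$ along $\varphi_0$, acting on $G_2$ via its projection to $G_1$). $\underline\varphi_*X$ is the crossed extension $B'\to B'\times^BH_2\to H_1\xrightarrow{p}C$, where $B'\times^BH_2=(B'\times H_2)/\{(\varphi(b),j(b)^{-1}):b\in B\}$, the boundary is $[b',h]\mapsto\partial(h)$,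 and $h_1*[b',h]=[\varphi_0(p(h_1))*b',\,h_1*h]$. Both have associated module $B'$ with the $C$-action pulled back along $\varphi_0$. A simply transitive $\Gamma$-set is a set on which the group $\Gamma$ acts so that for any two elements exactly one group element carries the first to the second; here $\Gamma$ acts by composition on the left (via the bijection, given by composition with the canonical arrows $X\to\underline\varphi_*X$ and $\underline\varphi^*X'\to X'$, with the set of arrows $\underline\varphi_*X\to\underline\varphi^*X'$ in the fibre). *)

theory Defs
  imports "HOL-Algebra.Group_Action"
begin

section \<open>Crossed modules, crossed extensions and modules\<close>

record ('g2, 'g1) crossed_mod =
  grp2 :: "'g2 monoid"
  grp1 :: "'g1 monoid"
  bdry :: "'g2 \<Rightarrow> 'g1"
  act  :: "'g1 \<Rightarrow> 'g2 \<Rightarrow> 'g2"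

text \<open>
  An action of one group on another is a homomorphism into \<open>AutoGroup\<close>. The elements of
  \<open>AutoGroup\<close> are extensional functions, which costs no generality.
\<close>

locale crossed_module =
  G2: group "grp2 X" + G1: group "grp1 X"
  for X :: "('g2, 'g1, 'z) crossed_mod_scheme" +
  assumes bdry_hom: "bdry X \<in> hom (grp2 X) (grp1 X)"
    and act_hom: "act X \<in> hom (grp1 X) (AutoGroup (grp2 X))"
    and equivariant: "\<lbrakk>x \<in> carrier (grp1 X); g \<in> carrier (grp2 X)\<rbrakk> \<Longrightarrow>
      bdry X (act X x g) = x \<otimes>\<^bsub>grp1 X\<^esub> bdry X g \<otimes>\<^bsub>grp1 X\<^esub> inv\<^bsub>grp1 X\<^esub> x"
    and peiffer: "\<lbrakk>g \<in> carrier (grp2 X); g' \<in> carrier (grp2 X)\<rbrakk> \<Longrightarrow>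
      act X (bdry X g) g' = g \<otimes>\<^bsub>grp2 X\<^esub> g' \<otimes>\<^bsub>grp2 X\<^esub> inv\<^bsub>grp2 X\<^esub> g"

record ('g2, 'g1, 'b, 'c) crossed_ext = "('g2, 'g1) crossed_mod" +
  ker_grp   :: "'b monoid"
  coker_grp :: "'c monoid"
  ker_map   :: "'b \<Rightarrow> 'g2"
  coker_map :: "'g1 \<Rightarrow> 'c"

locale crossed_extension =
  crossed_module X + B: group "ker_grp X" + C: group "coker_grp X"
  for X :: "('g2, 'g1, 'b, 'c) crossed_ext" +
  assumes ker_map_hom: "ker_map X \<in> hom (ker_grp X) (grp2 X)"
    and ker_map_inj: "inj_on (ker_map X) (carrier (ker_grp X))"
    and exact2: "ker_map X ` carrier (ker_grp X) = kernel (grp2 X) (grp1 X) (bdry X)"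
    and exact1: "bdry X ` carrier (grp2 X) = kernel (grp1 X) (coker_grp X) (coker_map X)"
    and coker_map_hom: "coker_map X \<in> hom (grp1 X) (coker_grp X)"
    and coker_map_surj: "coker_map X ` carrier (grp1 X) = carrier (coker_grp X)"

record ('c, 'b) gp_module =
  scal_grp :: "'c monoid"
  mod_grp  :: "'b monoid"
  smul     :: "'c \<Rightarrow> 'b \<Rightarrow> 'b"

locale group_module =
  C: group "scal_grp M" + B: comm_group "mod_grp M" for M :: "('c, 'b) gp_module" +
  assumes smul_hom: "smul M \<in> hom (scal_grp M) (AutoGroup (mod_grp M))"

text \<open>
  The components of a morphism of modules are required to be extensional, so that two
  morphisms are equal as HOL terms iff they agree on the carriers.
\<close>

definition mod_hom :: "('c, 'b) gp_module \<Rightarrow> ('d, 'e) gp_module \<Rightarrow> (('c \<Rightarrow> 'd) \<times> ('b \<Rightarrow> 'e)) set" where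
  "mod_hom M M' = {(f0, f).
     f0 \<in> hom (scal_grp M) (scal_grp M') \<inter> extensional (carrier (scal_grp M)) \<and>
     f \<in> hom (mod_grp M) (mod_grp M') \<inter> extensional (carrier (mod_grp M)) \<and>
     (\<forall>c\<in>carrier (scal_grp M). \<forall>b\<in>carrier (mod_grp M). f (smul M c b) = smul M' (f0 c) (f b))}"

definition mod_id :: "('c, 'b) gp_module \<Rightarrow> ('c \<Rightarrow> 'c) \<times> ('b \<Rightarrow> 'b)" where
  "mod_id M = (\<lambda>c\<in>carrier (scal_grp M). c, \<lambda>b\<in>carrier (mod_grp M). b)"

definition ext_module :: "('g2, 'g1, 'b, 'c) crossed_ext \<Rightarrow> ('c, 'b) gp_module" (\<open>\<Pi>\<^sub>m\<close>) where
  "\<Pi>\<^sub>m X = \<lparr>scal_grp = coker_grp X, mod_grp = ker_grp X,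
     smul = (\<lambda>c\<in>carrier (coker_grp X). \<lambda>b\<in>carrier (ker_grp X).
       THE b'. b' \<in> carrier (ker_grp X) \<and>
         (\<exists>x\<in>carrier (grp1 X). coker_map X x = c \<and> ker_map X b' = act X x (ker_map X b)))\<rparr>"


section \<open>Butterflies\<close>

record ('e, 'h2, 'h1, 'g2, 'g1) butterfly =
  wgrp  :: "'e monoid"
  kappa :: "'h2 \<Rightarrow> 'e"
  iota  :: "'g2 \<Rightarrow> 'e"
  delta :: "'e \<Rightarrow> 'h1"
  gamma :: "'e \<Rightarrow> 'g1"

locale is_butterfly =
  X: crossed_module X + X': crossed_module X' + W: group "wgrp E"
  for X :: "('h2, 'h1, 'y) crossed_mod_scheme"
    and X' :: "('g2, 'g1, 'z) crossed_mod_scheme"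
    and E :: "('e, 'h2, 'h1, 'g2, 'g1) butterfly" +
  assumes kappa_hom: "kappa E \<in> hom (grp2 X) (wgrp E)"
    and iota_hom: "iota E \<in> hom (grp2 X') (wgrp E)"
    and delta_hom: "delta E \<in> hom (wgrp E) (grp1 X)"
    and gamma_hom: "gamma E \<in> hom (wgrp E) (grp1 X')"
    and delta_kappa: "h \<in> carrier (grp2 X) \<Longrightarrow> delta E (kappa E h) = bdry X h"
    and gamma_iota: "g \<in> carrier (grp2 X') \<Longrightarrow> gamma E (iota E g) = bdry X' g"
    and gamma_kappa: "h \<in> carrier (grp2 X) \<Longrightarrow> gamma E (kappa E h) = \<one>\<^bsub>grp1 X'\<^esub>"
    and iota_inj: "inj_on (iota E) (carrier (grp2 X'))"
    and iota_delta_exact: "iota E ` carrier (grp2 X') = kernel (wgrp E) (grp1 X) (delta E)"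
    and delta_surj: "delta E ` carrier (wgrp E) = carrier (grp1 X)"
    and kappa_act: "\<lbrakk>e \<in> carrier (wgrp E); h \<in> carrier (grp2 X)\<rbrakk> \<Longrightarrow>
      kappa E (act X (delta E e) h) = e \<otimes>\<^bsub>wgrp E\<^esub> kappa E h \<otimes>\<^bsub>wgrp E\<^esub> inv\<^bsub>wgrp E\<^esub> e"
    and iota_act: "\<lbrakk>e \<in> carrier (wgrp E); g \<in> carrier (grp2 X')\<rbrakk> \<Longrightarrow>
      iota E (act X' (gamma E e) g) = e \<otimes>\<^bsub>wgrp E\<^esub> iota E g \<otimes>\<^bsub>wgrp E\<^esub> inv\<^bsub>wgrp E\<^esub> e"

definition two_cell ::
  "('h2, 'h1, 'y) crossed_mod_scheme \<Rightarrow> ('g2, 'g1, 'z) crossed_mod_scheme \<Rightarrow>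
   ('e, 'h2, 'h1, 'g2, 'g1) butterfly \<Rightarrow> ('f, 'h2, 'h1, 'g2, 'g1) butterfly \<Rightarrow> ('e \<Rightarrow> 'f) \<Rightarrow> bool" where
  "two_cell X X' E F f \<longleftrightarrow>
     f \<in> hom (wgrp E) (wgrp F) \<and>
     (\<forall>h\<in>carrier (grp2 X). f (kappa E h) = kappa F h) \<and>
     (\<forall>g\<in>carrier (grp2 X'). f (iota E g) = iota F g) \<and>
     (\<forall>e\<in>carrier (wgrp E). delta F (f e) = delta E e \<and> gamma F (f e) = gamma E e)"

definition bfly_iso ::
  "('h2, 'h1, 'y) crossed_mod_scheme \<Rightarrow> ('g2, 'g1, 'z) crossed_mod_scheme \<Rightarrow>
   ('e, 'h2, 'h1, 'g2, 'g1) butterfly \<Rightarrow> ('f, 'h2, 'h1, 'g2, 'g1) butterfly \<Rightarrow> bool" where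
  "bfly_iso X X' E F \<longleftrightarrow> (\<exists>f. two_cell X X' E F f \<and> f \<in> iso (wgrp E) (wgrp F))"

text \<open>
  The isomorphism class of a butterfly from \<open>X\<close> to \<open>X'\<close>, whatever the type of its elements, is
  represented by the set of those butterflies isomorphic to it whose group lives on the type
  \<open>'g2 \<times> 'h1\<close>. Exactness of \<open>iota\<close> and \<open>delta\<close> puts the underlying set of any butterfly in
  bijection with the product of the carriers of \<open>grp2 X'\<close> and \<open>grp1 X\<close>, so this set is never
  empty (\<open>bfly_class_nonempty\<close>) and determines the isomorphism class (\<open>bfly_class_eq_iff\<close>).
\<close>

type_synonym ('h2, 'h1, 'g2, 'g1) std_butterfly = "('g2 \<times> 'h1, 'h2, 'h1, 'g2, 'g1) butterfly"

definition bfly_class ::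
  "('h2, 'h1, 'y) crossed_mod_scheme \<Rightarrow> ('g2, 'g1, 'z) crossed_mod_scheme \<Rightarrow>
   ('e, 'h2, 'h1, 'g2, 'g1) butterfly \<Rightarrow> ('h2, 'h1, 'g2, 'g1) std_butterfly set" where
  "bfly_class X X' E = {F. is_butterfly X X' F \<and> bfly_iso X X' E F}"

lemma bfly_iso_sym:
  assumes "bfly_iso X X' E F" "is_butterfly X X' E"
  shows "bfly_iso X X' F E"
proof -
  interpret E: is_butterfly X X' E by fact
  obtain f where f: "two_cell X X' E F f" "f \<in> iso (wgrp E) (wgrp F)"
    using assms(1) by (auto simp: bfly_iso_def)
  let ?g = "inv_into (carrier (wgrp E)) f"
  have bij: "bij_betw f (carrier (wgrp E)) (carrier (wgrp F))"
    using f(2) by (simp add: iso_def)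
  have gi: "?g \<in> iso (wgrp F) (wgrp E)"
    using E.W.iso_set_sym f(2) by blast
  have gf: "?g (f e) = e" if "e \<in> carrier (wgrp E)" for e
    using bij_betw_inv_into_left[OF bij that] .
  have fg: "f (?g e) = e" "?g e \<in> carrier (wgrp E)" if "e \<in> carrier (wgrp F)" for e
    using bij_betw_inv_into_right[OF bij that] bij_betw_apply[OF bij_betw_inv_into[OF bij] that] by auto
  have "two_cell X X' F E ?g"
    unfolding two_cell_def
  proof (intro conjI ballI)
    show "?g \<in> hom (wgrp F) (wgrp E)" using gi by (simp add: iso_def)
    fix h assume h: "h \<in> carrier (grp2 X)"
    then have "kappa E h \<in> carrier (wgrp E)" using E.kappa_hom by (auto simp: hom_def)
    with h f(1) gf[of "kappa E h"] show "?g (kappa F h) = kappa E h" by (simp add: two_cell_def)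
  next
    fix g assume g: "g \<in> carrier (grp2 X')"
    then have "iota E g \<in> carrier (wgrp E)" using E.iota_hom by (auto simp: hom_def)
    with g f(1) gf[of "iota E g"] show "?g (iota F g) = iota E g" by (simp add: two_cell_def)
  next
    fix e assume e: "e \<in> carrier (wgrp F)"
    show "delta E (?g e) = delta F e" "gamma E (?g e) = gamma F e"
      using f(1) fg[OF e] unfolding two_cell_def by metis+
  qed
  with gi show ?thesis by (auto simp: bfly_iso_def)
qed

lemma bfly_iso_trans:
  assumes "bfly_iso X X' E F" "bfly_iso X X' F H"
  shows "bfly_iso X X' E H"
proof -
  obtain f g where f: "two_cell X X' E F f" "f \<in> iso (wgrp E) (wgrp F)"
    and g: "two_cell X X' F H g" "g \<in> iso (wgrp F) (wgrp H)"
    using assms by (auto simp: bfly_iso_def)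
  have i: "g \<circ> f \<in> iso (wgrp E) (wgrp H)"
    using f(2) g(2) by (rule iso_set_trans)
  have "f e \<in> carrier (wgrp F)" if "e \<in> carrier (wgrp E)" for e
    using f(2) that by (auto simp: iso_def hom_def)
  then have "two_cell X X' E H (g \<circ> f)"
    using f(1) g(1) i by (auto simp: two_cell_def iso_def)
  with i show ?thesis by (auto simp: bfly_iso_def)
qed


definition bfly_transport ::
  "('e \<Rightarrow> 'f) \<Rightarrow> ('e, 'h2, 'h1, 'g2, 'g1) butterfly \<Rightarrow> ('f, 'h2, 'h1, 'g2, 'g1) butterfly" where
  "bfly_transport t E = (let r = inv_into (carrier (wgrp E)) t in
     \<lparr>wgrp = \<lparr>carrier = t ` carrier (wgrp E), mult = (\<lambda>a b. t (r a \<otimes>\<^bsub>wgrp E\<^esub> r b)), one = t \<one>\<^bsub>wgrp E\<^esub>\<rparr>,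
      kappa = t \<circ> kappa E, iota = t \<circ> iota E, delta = delta E \<circ> r, gamma = gamma E \<circ> r\<rparr>)"

lemma
  assumes E: "is_butterfly X X' E" and inj: "inj_on t (carrier (wgrp E))"
  shows is_butterfly_transport: "is_butterfly X X' (bfly_transport t E)"
    and bfly_iso_transport: "bfly_iso X X' E (bfly_transport t E)"
proof -
  interpret E: is_butterfly X X' E by fact
  define F where "F = bfly_transport t E"
  define r where "r = inv_into (carrier (wgrp E)) t"
  have rt [simp]: "r (t e) = e" if "e \<in> carrier (wgrp E)" for e
    using inj that by (simp add: r_def)
  have F [simp]: "carrier (wgrp F) = t ` carrier (wgrp E)" "\<one>\<^bsub>wgrp F\<^esub> = t \<one>\<^bsub>wgrp E\<^esub>"
    "kappa F h = t (kappa E h)" "iota F g = t (iota E g)" "delta F u = delta E (r u)" "gamma F u = gamma E (r u)"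
    for h g u by (simp_all add: F_def bfly_transport_def Let_def r_def)
  have multF [simp]: "t a \<otimes>\<^bsub>wgrp F\<^esub> t b = t (a \<otimes>\<^bsub>wgrp E\<^esub> b)"
    if "a \<in> carrier (wgrp E)" "b \<in> carrier (wgrp E)" for a b
    using that inj by (simp add: F_def bfly_transport_def Let_def)
  have grp: "group (wgrp F)"
  proof (rule groupI)
    fix x assume "x \<in> carrier (wgrp F)"
    then obtain e where "e \<in> carrier (wgrp E)" "x = t e" by auto
    then show "\<exists>y\<in>carrier (wgrp F). y \<otimes>\<^bsub>wgrp F\<^esub> x = \<one>\<^bsub>wgrp F\<^esub>"
      by (intro bexI[of _ "t (inv\<^bsub>wgrp E\<^esub> e)"]) auto
  qed (auto simp: E.W.m_assoc)
  interpret W: group "wgrp F" by fact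
  have invF [simp]: "inv\<^bsub>wgrp F\<^esub> (t e) = t (inv\<^bsub>wgrp E\<^esub> e)" if "e \<in> carrier (wgrp E)" for e
    using that by (intro W.inv_equality) auto
  have tiso: "t \<in> iso (wgrp E) (wgrp F)"
    using inj by (auto simp: iso_def hom_def bij_betw_def)
  have kc [simp]: "kappa E h \<in> carrier (wgrp E)" if "h \<in> carrier (grp2 X)" for h
    using E.kappa_hom that by (auto simp: hom_def)
  have ic [simp]: "iota E g \<in> carrier (wgrp E)" if "g \<in> carrier (grp2 X')" for g
    using E.iota_hom that by (auto simp: hom_def)
  have tc: "two_cell X X' E F t"
    using tiso by (auto simp: two_cell_def iso_def)
  with tiso show "bfly_iso X X' E (bfly_transport t E)"
    by (auto simp: bfly_iso_def F_def)
  show "is_butterfly X X' (bfly_transport t E)"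
    unfolding F_def[symmetric]
  proof unfold_locales
    show "kappa F \<in> hom (grp2 X) (wgrp F)" "iota F \<in> hom (grp2 X') (wgrp F)"
      using E.kappa_hom E.iota_hom by (auto simp: hom_def Pi_iff)
    show "delta F \<in> hom (wgrp F) (grp1 X)" "gamma F \<in> hom (wgrp F) (grp1 X')"
      using E.delta_hom E.gamma_hom by (auto simp: hom_def Pi_iff)
    show "inj_on (iota F) (carrier (grp2 X'))"
      using E.iota_inj inj by (auto simp: inj_on_def)
    have "iota F ` carrier (grp2 X') = t ` (iota E ` carrier (grp2 X'))" by auto
    also have "\<dots> = kernel (wgrp F) (grp1 X) (delta F)"
      unfolding E.iota_delta_exact by (auto simp: kernel_def)
    finally show "iota F ` carrier (grp2 X') = kernel (wgrp F) (grp1 X) (delta F)" .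
    show "delta F ` carrier (wgrp F) = carrier (grp1 X)"
      using E.delta_surj by (auto simp: image_image)
  next
    fix e h assume "e \<in> carrier (wgrp F)" "h \<in> carrier (grp2 X)"
    then show "kappa F (act X (delta F e) h) = e \<otimes>\<^bsub>wgrp F\<^esub> kappa F h \<otimes>\<^bsub>wgrp F\<^esub> inv\<^bsub>wgrp F\<^esub> e"
      by (auto simp: E.kappa_act)
  next
    fix e g assume "e \<in> carrier (wgrp F)" "g \<in> carrier (grp2 X')"
    then show "iota F (act X' (gamma F e) g) = e \<otimes>\<^bsub>wgrp F\<^esub> iota F g \<otimes>\<^bsub>wgrp F\<^esub> inv\<^bsub>wgrp F\<^esub> e"
      by (auto simp: E.iota_act)
  qed (auto simp: E.delta_kappa E.gamma_iota E.gamma_kappa)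
qed

lemma bfly_class_nonempty:
  assumes "is_butterfly X X' E"
  shows "bfly_class X X' E \<noteq> {}"
proof -
  interpret E: is_butterfly X X' E by fact
  let ?E = "carrier (wgrp E)"
  define s where "s = inv_into ?E (delta E)"
  define q where "q e = e \<otimes>\<^bsub>wgrp E\<^esub> inv\<^bsub>wgrp E\<^esub> (s (delta E e))" for e
  define t where "t e = (inv_into (carrier (grp2 X')) (iota E) (q e), delta E e)" for e
  interpret delta: group_hom "wgrp E" "grp1 X" "delta E"
    by (simp add: group_hom_def group_hom_axioms_def E.W.group_axioms E.X.G1.group_axioms E.delta_hom)
  have s: "s x \<in> ?E" "delta E (s x) = x" if "x \<in> carrier (grp1 X)" for x
    using that E.delta_surj by (auto simp: s_def inv_into_into f_inv_into_f)
  have q: "q e \<in> iota E ` carrier (grp2 X')" if "e \<in> ?E" for e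
    unfolding E.iota_delta_exact using that s[of "delta E e"] by (auto simp: kernel_def q_def)
  have "inj_on t ?E"
  proof (rule inj_onI)
    fix e e' assume e: "e \<in> ?E" "e' \<in> ?E" and "t e = t e'"
    then have d: "delta E e = delta E e'"
      and "inv_into (carrier (grp2 X')) (iota E) (q e) = inv_into (carrier (grp2 X')) (iota E) (q e')"
      by (auto simp: t_def)
    with q e have "q e = q e'" by (metis inv_into_injective)
    with d e s[of "delta E e'"] show "e = e'" by (simp add: q_def)
  qed
  then show ?thesis
    using is_butterfly_transport[OF assms] bfly_iso_transport[OF assms]
    by (auto simp: bfly_class_def)
qed

lemma bfly_class_eq_iff:
  assumes "is_butterfly X X' E" "is_butterfly X X' F"
  shows "bfly_class X X' E = bfly_class X X' F \<longleftrightarrow> bfly_iso X X' E F"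
proof
  assume eq: "bfly_class X X' E = bfly_class X X' F"
  obtain H where "H \<in> bfly_class X X' E" using bfly_class_nonempty[OF assms(1)] by blast
  with eq have "bfly_iso X X' E H" "bfly_iso X X' F H" by (auto simp: bfly_class_def)
  then show "bfly_iso X X' E F" using bfly_iso_trans bfly_iso_sym[OF _ assms(2)] by blast
next
  assume iso: "bfly_iso X X' E F"
  show "bfly_class X X' E = bfly_class X X' F"
    unfolding bfly_class_def
    using bfly_iso_trans[OF iso] bfly_iso_trans[OF bfly_iso_sym[OF iso assms(1)]] by blast
qed

text \<open>
  Composites are taken in diagrammatic order: \<open>bfly_comp X' E E'\<close> is first \<open>E\<close>, then \<open>E'\<close>, with
  \<open>X'\<close> the crossed module in the middle. Its group is a quotient, so its elements are cosets, on
  which functions are given by their common value on all representatives.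
\<close>

definition bfly_pullback ::
  "('g2, 'g1, 'z) crossed_mod_scheme \<Rightarrow> ('e, 'h2, 'h1, 'g2, 'g1) butterfly \<Rightarrow>
   ('f, 'g2, 'g1, 'k2, 'k1) butterfly \<Rightarrow> ('e \<times> 'f) monoid" where
  "bfly_pullback X' E E' = (wgrp E \<times>\<times> wgrp E')
     \<lparr>carrier := {(e, e'). e \<in> carrier (wgrp E) \<and> e' \<in> carrier (wgrp E') \<and> gamma E e = delta E' e'}\<rparr>"

definition bfly_antidiag ::
  "('g2, 'g1, 'z) crossed_mod_scheme \<Rightarrow> ('e, 'h2, 'h1, 'g2, 'g1) butterfly \<Rightarrow>
   ('f, 'g2, 'g1, 'k2, 'k1) butterfly \<Rightarrow> ('e \<times> 'f) set" where
  "bfly_antidiag X' E E' = (\<lambda>g. (iota E g, kappa E' g)) ` carrier (grp2 X')"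

definition bfly_comp ::
  "('g2, 'g1, 'z) crossed_mod_scheme \<Rightarrow> ('e, 'h2, 'h1, 'g2, 'g1) butterfly \<Rightarrow>
   ('f, 'g2, 'g1, 'k2, 'k1) butterfly \<Rightarrow> (('e \<times> 'f) set, 'h2, 'h1, 'k2, 'k1) butterfly" where
  "bfly_comp X' E E' =
    (let Q = bfly_pullback X' E E'; N = bfly_antidiag X' E E' in
     \<lparr>wgrp = Q Mod N,
      kappa = (\<lambda>h. N #>\<^bsub>Q\<^esub> (kappa E h, \<one>\<^bsub>wgrp E'\<^esub>)),
      iota = (\<lambda>k. N #>\<^bsub>Q\<^esub> (\<one>\<^bsub>wgrp E\<^esub>, iota E' k)),
      delta = (\<lambda>u. the_elem ((\<lambda>(e, e'). delta E e) ` u)),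
      gamma = (\<lambda>u. the_elem ((\<lambda>(e, e'). gamma E' e') ` u))\<rparr>)"

text \<open>
  The butterfly of a strict morphism \<open>(f2, f1)\<close> of crossed modules: the group is the semidirect
  product of \<open>grp2 X'\<close> and \<open>grp1 X\<close>, the latter acting via \<open>f1\<close>. For \<open>f2 = f1 = id\<close> this is the
  identity butterfly.
\<close>

definition strict_bfly ::
  "('h2, 'h1, 'y) crossed_mod_scheme \<Rightarrow> ('g2, 'g1, 'z) crossed_mod_scheme \<Rightarrow>
   ('h2 \<Rightarrow> 'g2) \<Rightarrow> ('h1 \<Rightarrow> 'g1) \<Rightarrow> ('h2, 'h1, 'g2, 'g1) std_butterfly" where
  "strict_bfly X X' f2 f1 =
     \<lparr>wgrp = \<lparr>carrier = carrier (grp2 X') \<times> carrier (grp1 X),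
              mult = (\<lambda>(g, x) (g', x'). (g \<otimes>\<^bsub>grp2 X'\<^esub> act X' (f1 x) g', x \<otimes>\<^bsub>grp1 X\<^esub> x')),
              one = (\<one>\<^bsub>grp2 X'\<^esub>, \<one>\<^bsub>grp1 X\<^esub>)\<rparr>,
      kappa = (\<lambda>h. (inv\<^bsub>grp2 X'\<^esub> (f2 h), bdry X h)),
      iota = (\<lambda>g. (g, \<one>\<^bsub>grp1 X\<^esub>)),
      delta = (\<lambda>(g, x). x),
      gamma = (\<lambda>(g, x). bdry X' g \<otimes>\<^bsub>grp1 X'\<^esub> f1 x)\<rparr>"

definition id_bfly :: "('g2, 'g1, 'z) crossed_mod_scheme \<Rightarrow> ('g2, 'g1, 'g2, 'g1) std_butterfly" where
  "id_bfly X = strict_bfly X X (\<lambda>g. g) (\<lambda>x. x)"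


section \<open>The category of crossed extensions and classes of butterflies\<close>

definition bext_hom ::
  "('h2, 'h1, 'b, 'c) crossed_ext \<Rightarrow> ('g2, 'g1, 'd, 'k) crossed_ext \<Rightarrow>
   ('h2, 'h1, 'g2, 'g1) std_butterfly set set" where
  "bext_hom X X' = {bfly_class X X' E | E. is_butterfly X X' (E :: ('h2, 'h1, 'g2, 'g1) std_butterfly)}"

text \<open>Again in diagrammatic order: first \<open>\<E>\<close>, then \<open>\<E>'\<close>.\<close>

definition bext_comp ::
  "('h2, 'h1, 'b, 'c) crossed_ext \<Rightarrow> ('g2, 'g1, 'd, 'k) crossed_ext \<Rightarrow> ('k2, 'k1, 'l, 'm) crossed_ext \<Rightarrow>
   ('h2, 'h1, 'g2, 'g1) std_butterfly set \<Rightarrow> ('g2, 'g1, 'k2, 'k1) std_butterfly set \<Rightarrow>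
   ('h2, 'h1, 'k2, 'k1) std_butterfly set" where
  "bext_comp X X' X'' \<E> \<E>' = the_elem ((\<lambda>(E, E'). bfly_class X X'' (bfly_comp X' E E')) ` (\<E> \<times> \<E>'))"

definition bext_id :: "('g2, 'g1, 'b, 'c) crossed_ext \<Rightarrow> ('g2, 'g1, 'g2, 'g1) std_butterfly set" where
  "bext_id X = bfly_class X X (id_bfly X)"

definition bext_is_iso ::
  "('h2, 'h1, 'b, 'c) crossed_ext \<Rightarrow> ('g2, 'g1, 'd, 'k) crossed_ext \<Rightarrow>
   ('h2, 'h1, 'g2, 'g1) std_butterfly set \<Rightarrow> bool" where
  "bext_is_iso X X' \<E> \<longleftrightarrow> \<E> \<in> bext_hom X X' \<and>
     (\<exists>\<F>\<in>bext_hom X' X. bext_comp X X' X \<E> \<F> = bext_id X \<and> bext_comp X' X X' \<F> \<E> = bext_id X')"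

definition bfly_mod ::
  "('h2, 'h1, 'b, 'c) crossed_ext \<Rightarrow> ('g2, 'g1, 'd, 'k) crossed_ext \<Rightarrow>
   ('e, 'h2, 'h1, 'g2, 'g1) butterfly \<Rightarrow> ('c \<Rightarrow> 'k) \<times> ('b \<Rightarrow> 'd)" where
  "bfly_mod X X' E =
    (\<lambda>c\<in>carrier (coker_grp X). THE c'. \<exists>e\<in>carrier (wgrp E).
        coker_map X (delta E e) = c \<and> coker_map X' (gamma E e) = c',
     \<lambda>b\<in>carrier (ker_grp X). THE b'. b' \<in> carrier (ker_grp X') \<and>
        kappa E (ker_map X b) \<otimes>\<^bsub>wgrp E\<^esub> iota E (ker_map X' b') = \<one>\<^bsub>wgrp E\<^esub>)"

text \<open>The functor \<open>P\<close> on arrows; on objects it is \<open>\<Pi>\<^sub>m\<close>.\<close>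

definition bext_P ::
  "('h2, 'h1, 'b, 'c) crossed_ext \<Rightarrow> ('g2, 'g1, 'd, 'k) crossed_ext \<Rightarrow>
   ('h2, 'h1, 'g2, 'g1) std_butterfly set \<Rightarrow> ('c \<Rightarrow> 'k) \<times> ('b \<Rightarrow> 'd)" where
  "bext_P X X' \<E> = the_elem (bfly_mod X X' ` \<E>)"

definition bext_hom_over ::
  "('h2, 'h1, 'b, 'c) crossed_ext \<Rightarrow> ('g2, 'g1, 'd, 'k) crossed_ext \<Rightarrow>
   ('c \<Rightarrow> 'k) \<times> ('b \<Rightarrow> 'd) \<Rightarrow> ('h2, 'h1, 'g2, 'g1) std_butterfly set set" where
  "bext_hom_over X X' \<phi> = {\<E> \<in> bext_hom X X'. bext_P X X' \<E> = \<phi>}"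

definition fibre_hom ::
  "('c, 'b) gp_module \<Rightarrow> ('h2, 'h1, 'b, 'c) crossed_ext \<Rightarrow> ('g2, 'g1, 'b, 'c) crossed_ext \<Rightarrow>
   ('h2, 'h1, 'g2, 'g1) std_butterfly set set" where
  "fibre_hom M X X' = {\<E> \<in> bext_hom_over X X' (mod_id M). \<Pi>\<^sub>m X = M \<and> \<Pi>\<^sub>m X' = M}"

text \<open>
  Multiplication is composition of arrows in the usual order, \<open>\<F> \<circ> \<F>'\<close>. The carrier consists of
  all endomorphisms of \<open>X\<close> in its fibre; that they are automorphisms amounts to this monoid being
  a group.
\<close>

definition fibre_aut ::
  "('g2, 'g1, 'b, 'c) crossed_ext \<Rightarrow> ('g2, 'g1, 'g2, 'g1) std_butterfly set monoid" where
  "fibre_aut X = \<lparr>carrier = fibre_hom (\<Pi>\<^sub>m X) X X, mult = (\<lambda>\<F> \<F>'. bext_comp X X X \<F>' \<F>), one = bext_id X\<rparr>"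


section \<open>Base change of crossed extensions\<close>

text \<open>
  \<open>upper_star C \<phi>0 X'\<close> is the pullback of \<open>X'\<close> along \<open>\<phi>0\<close>, a homomorphism from \<open>C\<close> to the
  cokernel of \<open>X'\<close>.
\<close>

definition upper_star ::
  "'c monoid \<Rightarrow> ('c \<Rightarrow> 'k) \<Rightarrow> ('g2, 'g1, 'd, 'k) crossed_ext \<Rightarrow> ('g2, 'g1 \<times> 'c, 'd, 'c) crossed_ext" where
  "upper_star C \<phi>0 X' =
     \<lparr>grp2 = grp2 X',
      grp1 = (grp1 X' \<times>\<times> C)
        \<lparr>carrier := {(x, c). x \<in> carrier (grp1 X') \<and> c \<in> carrier C \<and> coker_map X' x = \<phi>0 c}\<rparr>,
      bdry = (\<lambda>g. (bdry X' g, \<one>\<^bsub>C\<^esub>)),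
      act = (\<lambda>(x, c). act X' x),
      ker_grp = ker_grp X',
      coker_grp = C,
      ker_map = ker_map X',
      coker_map = snd\<rparr>"

definition pushout_antidiag ::
  "('b \<Rightarrow> 'd) \<Rightarrow> ('h2, 'h1, 'b, 'c) crossed_ext \<Rightarrow> ('d \<times> 'h2) set" where
  "pushout_antidiag \<phi> X = (\<lambda>b. (\<phi> b, inv\<^bsub>grp2 X\<^esub> (ker_map X b))) ` carrier (ker_grp X)"

text \<open>
  \<open>lower_star (\<phi>0, \<phi>) X M'\<close> is the pushforward of \<open>X\<close> along the module morphism
  \<open>(\<phi>0, \<phi>)\<close> from \<open>\<Pi>\<^sub>m X\<close> to \<open>M'\<close>.
\<close>

definition lower_star ::
  "('c \<Rightarrow> 'k) \<times> ('b \<Rightarrow> 'd) \<Rightarrow> ('h2, 'h1, 'b, 'c) crossed_ext \<Rightarrow> ('k, 'd) gp_module \<Rightarrow>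
   (('d \<times> 'h2) set, 'h1, 'd, 'c) crossed_ext" where
  "lower_star \<phi> X M' =
    (let D = mod_grp M' \<times>\<times> grp2 X; N = pushout_antidiag (snd \<phi>) X in
     \<lparr>grp2 = D Mod N,
      grp1 = grp1 X,
      bdry = (\<lambda>u. the_elem ((\<lambda>(b', h). bdry X h) ` u)),
      act = (\<lambda>x. \<lambda>u\<in>carrier (D Mod N).
        the_elem ((\<lambda>(b', h). N #>\<^bsub>D\<^esub> (smul M' (fst \<phi> (coker_map X x)) b', act X x h)) ` u)),
      ker_grp = mod_grp M',
      coker_grp = coker_grp X,
      ker_map = (\<lambda>b'. N #>\<^bsub>D\<^esub> (b', \<one>\<^bsub>grp2 X\<^esub>)),
      coker_map = coker_map X\<rparr>)"

text \<open>The canonical arrows from \<open>upper_star\<close> and to \<open>lower_star\<close>, given by strict morphisms.\<close>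

definition upper_star_arrow ::
  "'c monoid \<Rightarrow> ('c \<Rightarrow> 'k) \<Rightarrow> ('g2, 'g1, 'd, 'k) crossed_ext \<Rightarrow>
   ('g2, 'g1 \<times> 'c, 'g2, 'g1) std_butterfly set" where
  "upper_star_arrow C \<phi>0 X' = (let U = upper_star C \<phi>0 X' in
     bfly_class U X' (strict_bfly U X' (\<lambda>g. g) fst))"

definition lower_star_arrow ::
  "('c \<Rightarrow> 'k) \<times> ('b \<Rightarrow> 'd) \<Rightarrow> ('h2, 'h1, 'b, 'c) crossed_ext \<Rightarrow> ('k, 'd) gp_module \<Rightarrow>
   ('h2, 'h1, ('d \<times> 'h2) set, 'h1) std_butterfly set" where
  "lower_star_arrow \<phi> X M' = (let L = lower_star \<phi> X M' in
     bfly_class X L (strict_bfly X L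
       (\<lambda>h. pushout_antidiag (snd \<phi>) X #>\<^bsub>mod_grp M' \<times>\<times> grp2 X\<^esub> (\<one>\<^bsub>mod_grp M'\<^esub>, h)) (\<lambda>x. x)))"

text \<open>
  Composition with the canonical arrows, from the arrows between the two base changes lying in
  the fibre to the arrows from \<open>X\<close> to \<open>X'\<close> lying over \<open>\<phi>\<close>.
\<close>

definition base_change_map ::
  "('h2, 'h1, 'b, 'c) crossed_ext \<Rightarrow> ('g2, 'g1, 'd, 'k) crossed_ext \<Rightarrow> ('c \<Rightarrow> 'k) \<times> ('b \<Rightarrow> 'd) \<Rightarrow>
   (('d \<times> 'h2) set, 'h1, 'g2, 'g1 \<times> 'c) std_butterfly set \<Rightarrow> ('h2, 'h1, 'g2, 'g1) std_butterfly set" where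
  "base_change_map X X' \<phi> \<A> =
    (let L = lower_star \<phi> X (\<Pi>\<^sub>m X'); U = upper_star (coker_grp X) (fst \<phi>) X' in
     bext_comp X L X' (lower_star_arrow \<phi> X (\<Pi>\<^sub>m X'))
       (bext_comp L U X' \<A> (upper_star_arrow (coker_grp X) (fst \<phi>) X')))"

text \<open>
  The action of the automorphisms of \<open>upper_star\<close> in the fibre, transported along
  \<open>base_change_map\<close> from the action by postcomposition.
\<close>

definition base_change_action ::
  "('h2, 'h1, 'b, 'c) crossed_ext \<Rightarrow> ('g2, 'g1, 'd, 'k) crossed_ext \<Rightarrow> ('c \<Rightarrow> 'k) \<times> ('b \<Rightarrow> 'd) \<Rightarrow>
   ('g2, 'g1 \<times> 'c, 'g2, 'g1 \<times> 'c) std_butterfly set \<Rightarrow>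
   ('h2, 'h1, 'g2, 'g1) std_butterfly set \<Rightarrow> ('h2, 'h1, 'g2, 'g1) std_butterfly set" where
  "base_change_action X X' \<phi> \<F> =
    (let L = lower_star \<phi> X (\<Pi>\<^sub>m X'); U = upper_star (coker_grp X) (fst \<phi>) X' in
     (\<lambda>\<E>\<in>bext_hom_over X X' \<phi>.
       base_change_map X X' \<phi>
         (bext_comp L U U (inv_into (fibre_hom (\<Pi>\<^sub>m U) L U) (base_change_map X X' \<phi>) \<E>) \<F>)))"

locale simply_transitive_action = group_action +
  assumes simply_transitive: "\<lbrakk>x \<in> E; y \<in> E\<rbrakk> \<Longrightarrow> \<exists>!g. g \<in> carrier G \<and> \<phi> g x = y"

end

theory Submission
  imports Defs
begin

text \<open>
  An arrow \<open>A\<close> from \<open>lower_star\<close> to \<open>upper_star\<close> in the fibre and the arrow from \<open>X\<close> to \<open>X'\<close>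
  over \<open>\<phi>\<close> that it induces have the same underlying group, the same \<open>iota\<close> and the same \<open>delta\<close>.
  Restricting \<open>kappa\<close> along \<open>h \<mapsto> [1, h]\<close> and projecting \<open>gamma\<close> to \<open>grp1 X'\<close> forgets nothing:
  the missing component of \<open>gamma\<close> is the projection of \<open>delta\<close> to the cokernel and \<open>kappa [b, 1]\<close>
  is inverse to \<open>iota (j' b)\<close>, both because \<open>A\<close> lies over the identity. Hence composition with the
  canonical arrows is bijective. Since exchanging the two wings of a butterfly over an identity
  yields an inverse, the fibre is a groupoid, in which the automorphisms of an object act simply
  transitively on the arrows to it from any other object that admits one.
\<close>

section \<open>Groups and crossed extensions\<close>

text \<open>The obstacle is that composites are quotients: their elements are cosets, their types
  grow with every composition, and a map out of one would have to be defined through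
  representatives. The cure is to work with cells, multiplicative functions on the pairs
  \<open>(e, e')\<close> of the pullback that behave like the quotient map. Any butterfly that
  receives a cell is a composite up to isomorphism, so each composite can be presented by its most
  convenient model: the unchanged group for composition with a strict morphism that is the identity
  on one level, the semidirect product for a butterfly over an identity followed by its exchange.
  Isomorphisms between two models are given by multiplicative relations rather than by functions.
  Exchanging the wings needs the hypothesis of lying over an identity, because a butterfly is exact
  along \<open>iota\<close> and \<open>delta\<close> alone. The hypothesis matches the kernels and
  the cokernels of the two crossed modules, and a chase then makes \<open>kappa\<close> and
  \<open>gamma\<close> exact as well.\<close>

lemma (in group) mult_inv_cancel [simp]:
  assumes "x \<in> carrier G" "y \<in> carrier G"
  shows "inv x \<otimes> (x \<otimes> y) = y" "x \<otimes> (inv x \<otimes> y) = y"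
  using assms by (simp_all flip: m_assoc)

lemma (in group) eq_conjugateI:
  assumes "a \<otimes> e = e \<otimes> b" "a \<in> carrier G" "b \<in> carrier G" "e \<in> carrier G"
  shows "a = e \<otimes> b \<otimes> inv e"
  using assms by (metis inv_solve_right m_closed)

lemma (in group) inv_eq_of_mult_eq_one:
  assumes "x \<otimes> y = \<one>" "x \<in> carrier G" "y \<in> carrier G"
  shows "x = inv y" "y = inv x"
  using assms inv_equality inv_comm by (metis inv_inv)+

section \<open>Actions as homomorphisms into permutation and automorphism groups\<close>

lemma hom_into_BijGroupI:
  assumes "group G"
    and ext: "\<And>x. x \<in> carrier G \<Longrightarrow> a x \<in> extensional S"
    and closed: "\<And>x s. x \<in> carrier G \<Longrightarrow> s \<in> S \<Longrightarrow> a x s \<in> S"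
    and comp: "\<And>x y s. \<lbrakk>x \<in> carrier G; y \<in> carrier G; s \<in> S\<rbrakk> \<Longrightarrow> a (x \<otimes>\<^bsub>G\<^esub> y) s = a x (a y s)"
    and one: "\<And>s. s \<in> S \<Longrightarrow> a \<one>\<^bsub>G\<^esub> s = s"
  shows "a \<in> hom G (BijGroup S)"
proof -
  interpret G: group G by fact
  have Bij: "a x \<in> Bij S" if x: "x \<in> carrier G" for x
  proof -
    \<comment> \<open>The inverse permutation is the action of the inverse element.\<close>
    have "bij_betw (a x) S S"
      by (rule bij_betwI[where g = "a (inv\<^bsub>G\<^esub> x)"])
        (use x closed one comp[of "inv\<^bsub>G\<^esub> x" x] comp[of x "inv\<^bsub>G\<^esub> x"] in auto)
    with ext[OF x] show ?thesis by (simp add: Bij_def)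
  qed
  \<comment> \<open>Both sides are extensional on \<open>S\<close>, so agreement on \<open>S\<close>
    is equality.\<close>
  have "a (x \<otimes>\<^bsub>G\<^esub> y) = compose S (a x) (a y)"
    if "x \<in> carrier G" "y \<in> carrier G" for x y
    using that ext[of "x \<otimes>\<^bsub>G\<^esub> y"] comp
    by (intro extensionalityI[where A = S]) (auto simp: compose_def)
  then show ?thesis
    using Bij by (auto simp: hom_def BijGroup_def)
qed

lemma hom_into_AutoGroupI:
  assumes "group G" "group H"
    and ext: "\<And>x. x \<in> carrier G \<Longrightarrow> a x \<in> extensional (carrier H)"
    and closed: "\<And>x h. x \<in> carrier G \<Longrightarrow> h \<in> carrier H \<Longrightarrow> a x h \<in> carrier H"
    and mult: "\<And>x h h'. \<lbrakk>x \<in> carrier G; h \<in> carrier H; h' \<in> carrier H\<rbrakk> \<Longrightarrow> a x (h \<otimes>\<^bsub>H\<^esub> h') = a x h \<otimes>\<^bsub>H\<^esub> a x h'"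
    and comp: "\<And>x y h. \<lbrakk>x \<in> carrier G; y \<in> carrier G; h \<in> carrier H\<rbrakk> \<Longrightarrow> a (x \<otimes>\<^bsub>G\<^esub> y) h = a x (a y h)"
    and one: "\<And>h. h \<in> carrier H \<Longrightarrow> a \<one>\<^bsub>G\<^esub> h = h"
  shows "a \<in> hom G (AutoGroup H)"
proof -
  have "a \<in> hom G (BijGroup (carrier H))"
    using \<open>group G\<close> ext closed comp one by (rule hom_into_BijGroupI)
  then show ?thesis
    using mult closed by (auto simp: hom_def AutoGroup_def BijGroup_def auto_def)
qed

lemma
  assumes "group G" "group H" and a: "a \<in> hom G (AutoGroup H)"
  shows AutoGroup_hom_ext: "x \<in> carrier G \<Longrightarrow> a x \<in> extensional (carrier H)"
    and AutoGroup_hom_closed: "\<lbrakk>x \<in> carrier G; h \<in> carrier H\<rbrakk> \<Longrightarrow> a x h \<in> carrier H"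
    and AutoGroup_hom_mult: "\<lbrakk>x \<in> carrier G; h \<in> carrier H; h' \<in> carrier H\<rbrakk> \<Longrightarrow> a x (h \<otimes>\<^bsub>H\<^esub> h') = a x h \<otimes>\<^bsub>H\<^esub> a x h'"
    and AutoGroup_hom_comp: "\<lbrakk>x \<in> carrier G; y \<in> carrier G; h \<in> carrier H\<rbrakk> \<Longrightarrow> a (x \<otimes>\<^bsub>G\<^esub> y) h = a x (a y h)"
    and AutoGroup_hom_one: "h \<in> carrier H \<Longrightarrow> a \<one>\<^bsub>G\<^esub> h = h"
proof -
  interpret G: group G by fact
  interpret H: group H by fact
  have auto: "a x \<in> auto H" if "x \<in> carrier G" for x
    using a that by (auto simp: hom_def AutoGroup_def)
  then show "x \<in> carrier G \<Longrightarrow> a x \<in> extensional (carrier H)"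
    by (auto simp: auto_def Bij_def)
  show "\<lbrakk>x \<in> carrier G; h \<in> carrier H\<rbrakk> \<Longrightarrow> a x h \<in> carrier H"
    using auto by (auto simp: auto_def hom_def)
  show "\<lbrakk>x \<in> carrier G; h \<in> carrier H; h' \<in> carrier H\<rbrakk> \<Longrightarrow> a x (h \<otimes>\<^bsub>H\<^esub> h') = a x h \<otimes>\<^bsub>H\<^esub> a x h'"
    using auto by (auto simp: auto_def hom_def)
  show "\<lbrakk>x \<in> carrier G; y \<in> carrier G; h \<in> carrier H\<rbrakk> \<Longrightarrow> a (x \<otimes>\<^bsub>G\<^esub> y) h = a x (a y h)"
    using a auto by (auto simp: hom_def AutoGroup_def BijGroup_def auto_def compose_def)
  have "a \<one>\<^bsub>G\<^esub> = \<one>\<^bsub>AutoGroup H\<^esub>"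
    using hom_one[OF a \<open>group G\<close> H.AutoGroup] .
  then show "h \<in> carrier H \<Longrightarrow> a \<one>\<^bsub>G\<^esub> h = h"
    by (simp add: AutoGroup_def BijGroup_def)
qed

text \<open>Functions on quotients are defined as the common value that \<open>the_elem\<close>
  picks from the image of a coset. This evaluates them at one representative, once \<open>f\<close>
  is known to be invariant under left multiplication by \<open>N\<close>.\<close>

lemma the_elem_image_r_coset:
  assumes "group G" "subgroup N G" "a \<in> carrier G"
    and "\<And>n. n \<in> N \<Longrightarrow> f (n \<otimes>\<^bsub>G\<^esub> a) = f a"
  shows "the_elem (f ` (N #>\<^bsub>G\<^esub> a)) = f a"
proof -
  have "f ` (N #>\<^bsub>G\<^esub> a) = {f a}"
  proof (intro equalityI subsetI)
    fix y assume "y \<in> {f a}"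
    with assms(4) subgroup.one_closed[OF assms(2)] show "y \<in> f ` (N #>\<^bsub>G\<^esub> a)"
      by (intro image_eqI[where x = "\<one>\<^bsub>G\<^esub> \<otimes>\<^bsub>G\<^esub> a"]) (auto simp: r_coset_def)
  qed (use assms(4) in \<open>auto simp: r_coset_def\<close>)
  then show ?thesis by simp
qed

section \<open>Crossed modules\<close>

context crossed_module begin

sublocale bdry: group_hom "grp2 X" "grp1 X" "bdry X"
  using bdry_hom by (simp add: group_hom_def group_hom_axioms_def G2.group_axioms G1.group_axioms)

lemmas act_ext = AutoGroup_hom_ext[OF G1.group_axioms G2.group_axioms act_hom]
lemmas act_closed [simp, intro] = AutoGroup_hom_closed[OF G1.group_axioms G2.group_axioms act_hom]
lemmas act_mult = AutoGroup_hom_mult[OF G1.group_axioms G2.group_axioms act_hom]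
lemmas act_comp = AutoGroup_hom_comp[OF G1.group_axioms G2.group_axioms act_hom]
lemmas act_one [simp] = AutoGroup_hom_one[OF G1.group_axioms G2.group_axioms act_hom]

lemma act_group_hom: "x \<in> carrier (grp1 X) \<Longrightarrow> group_hom (grp2 X) (grp2 X) (act X x)"
  by (auto simp: group_hom_def group_hom_axioms_def hom_def act_mult G2.group_axioms)

lemma act_one_right [simp]: "x \<in> carrier (grp1 X) \<Longrightarrow> act X x \<one>\<^bsub>grp2 X\<^esub> = \<one>\<^bsub>grp2 X\<^esub>"
  using group_hom.hom_one[OF act_group_hom] .

lemma act_inv: "\<lbrakk>x \<in> carrier (grp1 X); g \<in> carrier (grp2 X)\<rbrakk> \<Longrightarrow>
    act X x (inv\<^bsub>grp2 X\<^esub> g) = inv\<^bsub>grp2 X\<^esub> (act X x g)"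
  using group_hom.hom_inv[OF act_group_hom] .

text \<open>By the Peiffer identity conjugation by \<open>g\<close> is the action of its boundary,
  which is trivial.\<close>

lemma ker_bdry_central:
  assumes "g \<in> carrier (grp2 X)" "bdry X g = \<one>\<^bsub>grp1 X\<^esub>" "h \<in> carrier (grp2 X)"
  shows "g \<otimes>\<^bsub>grp2 X\<^esub> h = h \<otimes>\<^bsub>grp2 X\<^esub> g"
  using peiffer[of g h] assms
  by (metis G2.inv_closed G2.inv_solve_right' G2.m_closed act_one)

end

section \<open>Crossed extensions and the module they induce\<close>

context crossed_extension begin

sublocale ker: group_hom "ker_grp X" "grp2 X" "ker_map X"
  using ker_map_hom by (simp add: group_hom_def group_hom_axioms_def G2.group_axioms B.group_axioms)

sublocale coker: group_hom "grp1 X" "coker_grp X" "coker_map X"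
  using coker_map_hom by (simp add: group_hom_def group_hom_axioms_def G1.group_axioms C.group_axioms)

lemma bdry_ker_map [simp]: "b \<in> carrier (ker_grp X) \<Longrightarrow> bdry X (ker_map X b) = \<one>\<^bsub>grp1 X\<^esub>"
  using exact2 by (auto simp: kernel_def)

lemma coker_map_bdry [simp]: "g \<in> carrier (grp2 X) \<Longrightarrow> coker_map X (bdry X g) = \<one>\<^bsub>coker_grp X\<^esub>"
  using exact1 by (auto simp: kernel_def)

lemma ker_bdryE:
  assumes "g \<in> carrier (grp2 X)" "bdry X g = \<one>\<^bsub>grp1 X\<^esub>"
  obtains b where "b \<in> carrier (ker_grp X)" "g = ker_map X b"
  using exact2 assms by (auto simp: kernel_def)

lemma ker_coker_mapE:
  assumes "x \<in> carrier (grp1 X)" "coker_map X x = \<one>\<^bsub>coker_grp X\<^esub>"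
  obtains g where "g \<in> carrier (grp2 X)" "x = bdry X g"
  using exact1 assms by (auto simp: kernel_def)

lemma coker_map_surjE:
  assumes "c \<in> carrier (coker_grp X)"
  obtains x where "x \<in> carrier (grp1 X)" "c = coker_map X x"
  using coker_map_surj assms by auto

lemma coker_map_eqE:
  assumes "x \<in> carrier (grp1 X)" "y \<in> carrier (grp1 X)" "coker_map X x = coker_map X y"
  obtains g where "g \<in> carrier (grp2 X)" "x = bdry X g \<otimes>\<^bsub>grp1 X\<^esub> y"
proof -
  have "coker_map X (x \<otimes>\<^bsub>grp1 X\<^esub> inv\<^bsub>grp1 X\<^esub> y) = \<one>\<^bsub>coker_grp X\<^esub>"
    using assms by simp
  then obtain g where g: "g \<in> carrier (grp2 X)" "x \<otimes>\<^bsub>grp1 X\<^esub> inv\<^bsub>grp1 X\<^esub> y = bdry X g"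
    using ker_coker_mapE assms by (metis G1.inv_closed G1.m_closed)
  then have "x = bdry X g \<otimes>\<^bsub>grp1 X\<^esub> y"
    using assms by (metis G1.inv_solve_right bdry.hom_closed)
  with g that show ?thesis by blast
qed

lemma ker_map_eq_iff [simp]:
  "\<lbrakk>b \<in> carrier (ker_grp X); b' \<in> carrier (ker_grp X)\<rbrakk> \<Longrightarrow> ker_map X b = ker_map X b' \<longleftrightarrow> b = b'"
  using ker_map_inj by (auto simp: inj_on_def)

lemma ker_map_central:
  assumes "b \<in> carrier (ker_grp X)" "h \<in> carrier (grp2 X)"
  shows "ker_map X b \<otimes>\<^bsub>grp2 X\<^esub> h = h \<otimes>\<^bsub>grp2 X\<^esub> ker_map X b"
  using assms by (intro ker_bdry_central) auto

text \<open>\<open>ker_map\<close> embeds the kernel group into the centre of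
  \<open>grp2 X\<close>.\<close>

lemma comm_group_ker_grp: "comm_group (ker_grp X)"
proof (rule B.group_comm_groupI)
  fix b b' assume b: "b \<in> carrier (ker_grp X)" "b' \<in> carrier (ker_grp X)"
  then have "ker_map X (b \<otimes>\<^bsub>ker_grp X\<^esub> b') = ker_map X (b' \<otimes>\<^bsub>ker_grp X\<^esub> b)"
    using ker_map_central[OF b(1), of "ker_map X b'"] by simp
  with b show "b \<otimes>\<^bsub>ker_grp X\<^esub> b' = b' \<otimes>\<^bsub>ker_grp X\<^esub> b"
    by (simp del: ker.hom_mult)
qed

lemma ext_module_simps [simp]: "scal_grp (\<Pi>\<^sub>m X) = coker_grp X" "mod_grp (\<Pi>\<^sub>m X) = ker_grp X"
  by (simp_all add: ext_module_def)

lemma act_ker_mapE: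
  assumes "x \<in> carrier (grp1 X)" "b \<in> carrier (ker_grp X)"
  obtains b' where "b' \<in> carrier (ker_grp X)" "act X x (ker_map X b) = ker_map X b'"
  using ker_bdryE[of "act X x (ker_map X b)"] assms by (auto simp: equivariant)

text \<open>Two lifts of the same cokernel element differ by a boundary, a boundary acts by
  conjugation, and elements of the kernel are central. Hence the action of
  \<open>coker_grp X\<close> on \<open>ker_grp X\<close> is well defined.\<close>

lemma act_ker_map_cong:
  assumes "x \<in> carrier (grp1 X)" "y \<in> carrier (grp1 X)" "coker_map X x = coker_map X y"
    and "b \<in> carrier (ker_grp X)"
  shows "act X x (ker_map X b) = act X y (ker_map X b)"
proof -
  obtain g where g: "g \<in> carrier (grp2 X)" "x = bdry X g \<otimes>\<^bsub>grp1 X\<^esub> y"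
    using coker_map_eqE assms by metis
  obtain b' where b': "b' \<in> carrier (ker_grp X)" "act X y (ker_map X b) = ker_map X b'"
    using act_ker_mapE assms by metis
  have "act X x (ker_map X b) = act X (bdry X g) (ker_map X b')"
    using assms g b' by (simp add: act_comp)
  also have "\<dots> = ker_map X b'"
    using g b' ker_map_central[OF b'(1) g(1)] by (simp add: peiffer) (metis G2.inv_solve_right' G2.m_closed ker.hom_closed)
  finally show ?thesis using b' by simp
qed

text \<open>Replaces the definite description in \<open>ext_module\<close> by an equation in
  \<open>grp2 X\<close>, from which the module laws are then derived.\<close>

lemma smul_eqI:
  assumes "x \<in> carrier (grp1 X)" "b \<in> carrier (ker_grp X)" "b' \<in> carrier (ker_grp X)"
    and "ker_map X b' = act X x (ker_map X b)"
  shows "smul (\<Pi>\<^sub>m X) (coker_map X x) b = b'"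
proof -
  have "(THE b'. b' \<in> carrier (ker_grp X) \<and>
     (\<exists>y\<in>carrier (grp1 X). coker_map X y = coker_map X x \<and> ker_map X b' = act X y (ker_map X b))) = b'"
  proof (rule the_equality)
    fix b'' assume b'': "b'' \<in> carrier (ker_grp X) \<and>
      (\<exists>y\<in>carrier (grp1 X). coker_map X y = coker_map X x \<and> ker_map X b'' = act X y (ker_map X b))"
    then have "ker_map X b'' = ker_map X b'"
      using act_ker_map_cong[OF _ assms(1) _ assms(2)] assms(4) by metis
    with b'' assms(3) show "b'' = b'" using ker_map_eq_iff by blast
  qed (use assms in blast)
  with assms show ?thesis by (simp add: ext_module_def)
qed

lemma ker_map_smul:
  assumes "x \<in> carrier (grp1 X)" "b \<in> carrier (ker_grp X)"
  shows "ker_map X (smul (\<Pi>\<^sub>m X) (coker_map X x) b) = act X x (ker_map X b)"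
    and "smul (\<Pi>\<^sub>m X) (coker_map X x) b \<in> carrier (ker_grp X)"
  using act_ker_mapE[OF assms] smul_eqI[OF assms] by metis+

lemma smul_closed [simp, intro]:
  assumes "c \<in> carrier (coker_grp X)" "b \<in> carrier (ker_grp X)"
  shows "smul (\<Pi>\<^sub>m X) c b \<in> carrier (ker_grp X)"
  using assms ker_map_smul(2) coker_map_surjE by metis

lemma smul_mult:
  assumes "c \<in> carrier (coker_grp X)" "b \<in> carrier (ker_grp X)" "b' \<in> carrier (ker_grp X)"
  shows "smul (\<Pi>\<^sub>m X) c (b \<otimes>\<^bsub>ker_grp X\<^esub> b') = smul (\<Pi>\<^sub>m X) c b \<otimes>\<^bsub>ker_grp X\<^esub> smul (\<Pi>\<^sub>m X) c b'"
proof -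
  obtain x where "x \<in> carrier (grp1 X)" "c = coker_map X x" using coker_map_surjE assms by metis
  then show ?thesis using assms by (auto intro!: smul_eqI simp: ker_map_smul act_mult)
qed

lemma smul_comp:
  assumes "c \<in> carrier (coker_grp X)" "c' \<in> carrier (coker_grp X)" "b \<in> carrier (ker_grp X)"
  shows "smul (\<Pi>\<^sub>m X) (c \<otimes>\<^bsub>coker_grp X\<^esub> c') b = smul (\<Pi>\<^sub>m X) c (smul (\<Pi>\<^sub>m X) c' b)"
proof -
  obtain x where x: "x \<in> carrier (grp1 X)" "c = coker_map X x" using coker_map_surjE assms by metis
  obtain y where y: "y \<in> carrier (grp1 X)" "c' = coker_map X y" using coker_map_surjE assms by metis
  have "smul (\<Pi>\<^sub>m X) (coker_map X (x \<otimes>\<^bsub>grp1 X\<^esub> y)) b = smul (\<Pi>\<^sub>m X) c (smul (\<Pi>\<^sub>m X) c' b)"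
    using assms x y by (intro smul_eqI) (auto simp: ker_map_smul act_comp)
  with x y show ?thesis by simp
qed

lemma smul_one [simp]: "b \<in> carrier (ker_grp X) \<Longrightarrow> smul (\<Pi>\<^sub>m X) \<one>\<^bsub>coker_grp X\<^esub> b = b"
  using smul_eqI[of "\<one>\<^bsub>grp1 X\<^esub>" b b] by simp

text \<open>A fibre is defined by equality of module records, so scalar multiplications have to
  agree off the carriers as well. They are extensional, and comparing values on the carriers is
  enough.\<close>

lemma ext_module_eqI:
  assumes "\<And>c b. \<lbrakk>c \<in> carrier (coker_grp X); b \<in> carrier (ker_grp X)\<rbrakk> \<Longrightarrow> smul (\<Pi>\<^sub>m X) c b = s c b"
  shows "\<Pi>\<^sub>m X = \<lparr>scal_grp = coker_grp X, mod_grp = ker_grp X,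
    smul = \<lambda>c\<in>carrier (coker_grp X). \<lambda>b\<in>carrier (ker_grp X). s c b\<rparr>"
proof -
  have "smul (\<Pi>\<^sub>m X) = (\<lambda>c\<in>carrier (coker_grp X). \<lambda>b\<in>carrier (ker_grp X). smul (\<Pi>\<^sub>m X) c b)"
    by (simp add: ext_module_def cong: restrict_cong)
  also have "\<dots> = (\<lambda>c\<in>carrier (coker_grp X). \<lambda>b\<in>carrier (ker_grp X). s c b)"
    using assms by (simp cong: restrict_cong)
  finally show ?thesis by (intro gp_module.equality) simp_all
qed

end

section \<open>Butterflies and their composites\<close>

context is_butterfly begin

sublocale kappa: group_hom "grp2 X" "wgrp E" "kappa E"
  using kappa_hom by (simp add: group_hom_def group_hom_axioms_def X.G2.group_axioms W.group_axioms)

sublocale iota: group_hom "grp2 X'" "wgrp E" "iota E"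
  using iota_hom by (simp add: group_hom_def group_hom_axioms_def X'.G2.group_axioms W.group_axioms)

sublocale delta: group_hom "wgrp E" "grp1 X" "delta E"
  using delta_hom by (simp add: group_hom_def group_hom_axioms_def X.G1.group_axioms W.group_axioms)

sublocale gamma: group_hom "wgrp E" "grp1 X'" "gamma E"
  using gamma_hom by (simp add: group_hom_def group_hom_axioms_def X'.G1.group_axioms W.group_axioms)

lemmas structure_simps [simp] = delta_kappa gamma_iota gamma_kappa

lemma delta_iota [simp]: "g \<in> carrier (grp2 X') \<Longrightarrow> delta E (iota E g) = \<one>\<^bsub>grp1 X\<^esub>"
  using iota_delta_exact by (auto simp: kernel_def)

lemma iota_eq_iff [simp]:
  "\<lbrakk>g \<in> carrier (grp2 X'); g' \<in> carrier (grp2 X')\<rbrakk> \<Longrightarrow> iota E g = iota E g' \<longleftrightarrow> g = g'"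
  using iota_inj by (auto simp: inj_on_def)

lemma iota_eq_one_iff [simp]:
  "g \<in> carrier (grp2 X') \<Longrightarrow> iota E g = \<one>\<^bsub>wgrp E\<^esub> \<longleftrightarrow> g = \<one>\<^bsub>grp2 X'\<^esub>"
  using iota_eq_iff[of g "\<one>\<^bsub>grp2 X'\<^esub>"] by (simp del: iota_eq_iff)

lemma ker_deltaE:
  assumes "e \<in> carrier (wgrp E)" "delta E e = \<one>\<^bsub>grp1 X\<^esub>"
  obtains g where "g \<in> carrier (grp2 X')" "e = iota E g"
  using iota_delta_exact assms by (auto simp: kernel_def)

lemma delta_eqE:
  assumes "e \<in> carrier (wgrp E)" "f \<in> carrier (wgrp E)" "delta E e = delta E f"
  obtains g where "g \<in> carrier (grp2 X')" "e = f \<otimes>\<^bsub>wgrp E\<^esub> iota E g"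
proof -
  have "delta E (inv\<^bsub>wgrp E\<^esub> f \<otimes>\<^bsub>wgrp E\<^esub> e) = \<one>\<^bsub>grp1 X\<^esub>"
    using assms by simp
  then obtain g where "g \<in> carrier (grp2 X')" "inv\<^bsub>wgrp E\<^esub> f \<otimes>\<^bsub>wgrp E\<^esub> e = iota E g"
    using ker_deltaE assms by (metis W.inv_closed W.m_closed)
  with that assms show ?thesis by (metis W.mult_inv_cancel(2))
qed

lemma delta_surjE:
  assumes "x \<in> carrier (grp1 X)"
  obtains e where "e \<in> carrier (wgrp E)" "delta E e = x"
  using delta_surj assms by (metis imageE)

lemma conj_kappa:
  "\<lbrakk>e \<in> carrier (wgrp E); h \<in> carrier (grp2 X)\<rbrakk> \<Longrightarrow>
    e \<otimes>\<^bsub>wgrp E\<^esub> kappa E h = kappa E (act X (delta E e) h) \<otimes>\<^bsub>wgrp E\<^esub> e"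
  by (simp add: kappa_act W.m_assoc)

lemma conj_iota:
  "\<lbrakk>e \<in> carrier (wgrp E); g \<in> carrier (grp2 X')\<rbrakk> \<Longrightarrow>
    e \<otimes>\<^bsub>wgrp E\<^esub> iota E g = iota E (act X' (gamma E e) g) \<otimes>\<^bsub>wgrp E\<^esub> e"
  by (simp add: iota_act W.m_assoc)

text \<open>Conjugation by \<open>kappa E h\<close> acts on the image of \<open>iota\<close> through
  \<open>gamma E (kappa E h)\<close>, which is trivial.\<close>

lemma kappa_iota_commute:
  "\<lbrakk>h \<in> carrier (grp2 X); g \<in> carrier (grp2 X')\<rbrakk> \<Longrightarrow>
    kappa E h \<otimes>\<^bsub>wgrp E\<^esub> iota E g = iota E g \<otimes>\<^bsub>wgrp E\<^esub> kappa E h"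
  using conj_iota[of "kappa E h" g] by simp

end

text \<open>A form of the axioms suited to quotients: conjugation is replaced by commutation, which
  avoids computing inverses, injectivity by a trivial kernel, and exactness by two elementary
  statements.\<close>

lemma is_butterflyI:
  assumes "crossed_module X" "crossed_module X'" "group (wgrp E)"
    and "kappa E \<in> hom (grp2 X) (wgrp E)" "iota E \<in> hom (grp2 X') (wgrp E)"
    and "delta E \<in> hom (wgrp E) (grp1 X)" "gamma E \<in> hom (wgrp E) (grp1 X')"
    and "\<And>h. h \<in> carrier (grp2 X) \<Longrightarrow> delta E (kappa E h) = bdry X h"
    and "\<And>g. g \<in> carrier (grp2 X') \<Longrightarrow> gamma E (iota E g) = bdry X' g"
    and "\<And>h. h \<in> carrier (grp2 X) \<Longrightarrow> gamma E (kappa E h) = \<one>\<^bsub>grp1 X'\<^esub>"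
    and "\<And>g. g \<in> carrier (grp2 X') \<Longrightarrow> delta E (iota E g) = \<one>\<^bsub>grp1 X\<^esub>"
    and "\<And>g. \<lbrakk>g \<in> carrier (grp2 X'); iota E g = \<one>\<^bsub>wgrp E\<^esub>\<rbrakk> \<Longrightarrow> g = \<one>\<^bsub>grp2 X'\<^esub>"
    and "\<And>e. \<lbrakk>e \<in> carrier (wgrp E); delta E e = \<one>\<^bsub>grp1 X\<^esub>\<rbrakk> \<Longrightarrow> \<exists>g\<in>carrier (grp2 X'). e = iota E g"
    and "\<And>x. x \<in> carrier (grp1 X) \<Longrightarrow> \<exists>e\<in>carrier (wgrp E). delta E e = x"
    and "\<And>e h. \<lbrakk>e \<in> carrier (wgrp E); h \<in> carrier (grp2 X)\<rbrakk> \<Longrightarrow>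
      kappa E (act X (delta E e) h) \<otimes>\<^bsub>wgrp E\<^esub> e = e \<otimes>\<^bsub>wgrp E\<^esub> kappa E h"
    and "\<And>e g. \<lbrakk>e \<in> carrier (wgrp E); g \<in> carrier (grp2 X')\<rbrakk> \<Longrightarrow>
      iota E (act X' (gamma E e) g) \<otimes>\<^bsub>wgrp E\<^esub> e = e \<otimes>\<^bsub>wgrp E\<^esub> iota E g"
  shows "is_butterfly X X' E"
proof -
  interpret X: crossed_module X by fact
  interpret X': crossed_module X' by fact
  interpret W: group "wgrp E" by fact
  interpret iota: group_hom "grp2 X'" "wgrp E" "iota E"
    using assms by (simp add: group_hom_def group_hom_axioms_def)
  interpret kappa: group_hom "grp2 X" "wgrp E" "kappa E"
    using assms by (simp add: group_hom_def group_hom_axioms_def)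
  interpret delta: group_hom "wgrp E" "grp1 X" "delta E"
    using assms by (simp add: group_hom_def group_hom_axioms_def)
  interpret gamma: group_hom "wgrp E" "grp1 X'" "gamma E"
    using assms by (simp add: group_hom_def group_hom_axioms_def)
  show ?thesis
  proof unfold_locales
    show "inj_on (iota E) (carrier (grp2 X'))"
      using assms(12) by (simp add: iota.inj_on_one_iff)
    show "iota E ` carrier (grp2 X') = kernel (wgrp E) (grp1 X) (delta E)"
      using assms(11,13) by (auto simp: kernel_def)
    show "delta E ` carrier (wgrp E) = carrier (grp1 X)"
      using assms(14) by force
  next
    fix e h assume "e \<in> carrier (wgrp E)" "h \<in> carrier (grp2 X)"
    then show "kappa E (act X (delta E e) h) = e \<otimes>\<^bsub>wgrp E\<^esub> kappa E h \<otimes>\<^bsub>wgrp E\<^esub> inv\<^bsub>wgrp E\<^esub> e"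
      by (intro W.eq_conjugateI assms(15)) auto
  next
    fix e g assume "e \<in> carrier (wgrp E)" "g \<in> carrier (grp2 X')"
    then show "iota E (act X' (gamma E e) g) = e \<otimes>\<^bsub>wgrp E\<^esub> iota E g \<otimes>\<^bsub>wgrp E\<^esub> inv\<^bsub>wgrp E\<^esub> e"
      by (intro W.eq_conjugateI assms(16)) auto
  qed (use assms(4-10) in auto)
qed

text \<open>The short five lemma.\<close>

lemma two_cell_imp_bfly_iso:
  assumes "is_butterfly X X' E" "is_butterfly X X' F" and f: "two_cell X X' E F f"
  shows "bfly_iso X X' E F"
proof -
  interpret E: is_butterfly X X' E by fact
  interpret F: is_butterfly X X' F by fact
  interpret f: group_hom "wgrp E" "wgrp F" f
    using f by (simp add: group_hom_def group_hom_axioms_def E.W.group_axioms F.W.group_axioms two_cell_def)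
  have fi: "f (iota E g) = iota F g" if "g \<in> carrier (grp2 X')" for g
    using f that by (simp add: two_cell_def)
  have fd: "delta F (f e) = delta E e" if "e \<in> carrier (wgrp E)" for e
    using f that by (simp add: two_cell_def)
  have "inj_on f (carrier (wgrp E))"
    unfolding f.inj_on_one_iff
  proof (intro allI impI)
    fix e assume e: "e \<in> carrier (wgrp E)" "f e = \<one>\<^bsub>wgrp F\<^esub>"
    then have "delta E e = \<one>\<^bsub>grp1 X\<^esub>" using fd[of e] by simp
    with e(1) obtain g where "g \<in> carrier (grp2 X')" "e = iota E g" by (rule E.ker_deltaE)
    with e fi show "e = \<one>\<^bsub>wgrp E\<^esub>" by simp
  qed
  moreover have "carrier (wgrp F) \<subseteq> f ` carrier (wgrp E)"
  proof
    fix y assume y: "y \<in> carrier (wgrp F)"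
    then obtain e where e: "e \<in> carrier (wgrp E)" "delta E e = delta F y"
      using E.delta_surjE F.delta.hom_closed by metis
    then obtain g where g: "g \<in> carrier (grp2 X')" "y = f e \<otimes>\<^bsub>wgrp F\<^esub> iota F g"
      using F.delta_eqE[of y "f e"] y fd by auto
    with e fi have "y = f (e \<otimes>\<^bsub>wgrp E\<^esub> iota E g)" by simp
    moreover have "e \<otimes>\<^bsub>wgrp E\<^esub> iota E g \<in> carrier (wgrp E)" using e g by simp
    ultimately show "y \<in> f ` carrier (wgrp E)" by (rule image_eqI)
  qed
  ultimately have "f \<in> iso (wgrp E) (wgrp F)"
    using f.homh by (auto simp: iso_def bij_betw_def)
  with f show ?thesis by (auto simp: bfly_iso_def)
qed

text \<open>\<open>R\<close> is the graph of the desired map, closed under products and inverses. As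
  it contains the pairs coming from \<open>iota\<close> and one pair over each element of
  \<open>grp1 X\<close>, it is total by exactness of \<open>iota\<close> and \<open>delta\<close>;
  as it relates the unit only to the unit, it is single-valued. A relation spares the choice of
  representatives that a map out of a quotient would require.\<close>

lemma bfly_iso_relI:
  assumes "is_butterfly X X' E" "is_butterfly X X' F"
    and R: "\<And>e f. R e f \<Longrightarrow> e \<in> carrier (wgrp E) \<and> f \<in> carrier (wgrp F) \<and>
        delta F f = delta E e \<and> gamma F f = gamma E e"
    and mult: "\<And>e f e' f'. \<lbrakk>R e f; R e' f'\<rbrakk> \<Longrightarrow> R (e \<otimes>\<^bsub>wgrp E\<^esub> e') (f \<otimes>\<^bsub>wgrp F\<^esub> f')"
    and inv: "\<And>e f. R e f \<Longrightarrow> R (inv\<^bsub>wgrp E\<^esub> e) (inv\<^bsub>wgrp F\<^esub> f)"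
    and kap: "\<And>h. h \<in> carrier (grp2 X) \<Longrightarrow> R (kappa E h) (kappa F h)"
    and iot: "\<And>g. g \<in> carrier (grp2 X') \<Longrightarrow> R (iota E g) (iota F g)"
    and tot: "\<And>x. x \<in> carrier (grp1 X) \<Longrightarrow> \<exists>e f. R e f \<and> delta E e = x"
    and single: "\<And>f. R \<one>\<^bsub>wgrp E\<^esub> f \<Longrightarrow> f = \<one>\<^bsub>wgrp F\<^esub>"
  shows "bfly_iso X X' E F"
proof -
  interpret E: is_butterfly X X' E by fact
  interpret F: is_butterfly X X' F by fact
  have ex: "\<exists>f. R e f" if e: "e \<in> carrier (wgrp E)" for e
  proof -
    obtain e1 f1 where 1: "R e1 f1" "delta E e1 = delta E e"
      using tot[OF E.delta.hom_closed[OF e]] by auto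
    then obtain g where "g \<in> carrier (grp2 X')" "e = e1 \<otimes>\<^bsub>wgrp E\<^esub> iota E g"
      using E.delta_eqE[of e e1] R e by metis
    with mult[OF 1(1) iot] show ?thesis by blast
  qed
  have uniq: "f = f'" if "R e f" "R e f'" for e f f'
  proof -
    have "R (e \<otimes>\<^bsub>wgrp E\<^esub> inv\<^bsub>wgrp E\<^esub> e) (f \<otimes>\<^bsub>wgrp F\<^esub> inv\<^bsub>wgrp F\<^esub> f')"
      using that by (intro mult inv)
    then have "f \<otimes>\<^bsub>wgrp F\<^esub> inv\<^bsub>wgrp F\<^esub> f' = \<one>\<^bsub>wgrp F\<^esub>" using single R that(1) by simp
    with R that show ?thesis by (metis F.W.inv_closed F.W.inv_inv F.W.inv_equality)
  qed
  define t where "t e = (SOME f. R e f)" for e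
  have t: "R e (t e)" if "e \<in> carrier (wgrp E)" for e
    unfolding t_def using ex[OF that] by (rule someI_ex)
  have "two_cell X X' E F t"
    unfolding two_cell_def
  proof (intro conjI ballI homI)
    fix e e' assume "e \<in> carrier (wgrp E)" "e' \<in> carrier (wgrp E)"
    then show "t (e \<otimes>\<^bsub>wgrp E\<^esub> e') = t e \<otimes>\<^bsub>wgrp F\<^esub> t e'"
      using uniq t mult by (meson E.W.m_closed)
  qed (use R t uniq kap iot in \<open>blast+\<close>)
  then show ?thesis using two_cell_imp_bfly_iso assms(1,2) by metis
qed

text \<open>
  A cell \<open>m\<close> presents \<open>G\<close> as the composite of \<open>E\<close> and \<open>E'\<close>: it is the composition of the quotient
  map from the pullback with an isomorphism from \<open>bfly_comp X' E E'\<close> to \<open>G\<close>.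
\<close>

locale comp_cell =
  E: is_butterfly X X' E + E': is_butterfly X' X'' E' + G: is_butterfly X X'' G
  for X :: "('h2, 'h1, 'x) crossed_mod_scheme" and X' :: "('g2, 'g1, 'y) crossed_mod_scheme"
    and X'' :: "('k2, 'k1, 'z) crossed_mod_scheme"
    and E :: "('e, 'h2, 'h1, 'g2, 'g1) butterfly" and E' :: "('f, 'g2, 'g1, 'k2, 'k1) butterfly"
    and G :: "('g, 'h2, 'h1, 'k2, 'k1) butterfly" +
  fixes m :: "'e \<Rightarrow> 'f \<Rightarrow> 'g"
  assumes cell_closed: "\<lbrakk>e \<in> carrier (wgrp E); e' \<in> carrier (wgrp E'); gamma E e = delta E' e'\<rbrakk> \<Longrightarrow>
      m e e' \<in> carrier (wgrp G)"
    and delta_cell: "\<lbrakk>e \<in> carrier (wgrp E); e' \<in> carrier (wgrp E'); gamma E e = delta E' e'\<rbrakk> \<Longrightarrow>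
      delta G (m e e') = delta E e"
    and gamma_cell: "\<lbrakk>e \<in> carrier (wgrp E); e' \<in> carrier (wgrp E'); gamma E e = delta E' e'\<rbrakk> \<Longrightarrow>
      gamma G (m e e') = gamma E' e'"
    and cell_mult: "\<lbrakk>e \<in> carrier (wgrp E); e' \<in> carrier (wgrp E'); gamma E e = delta E' e';
        a \<in> carrier (wgrp E); a' \<in> carrier (wgrp E'); gamma E a = delta E' a'\<rbrakk> \<Longrightarrow>
      m (e \<otimes>\<^bsub>wgrp E\<^esub> a) (e' \<otimes>\<^bsub>wgrp E'\<^esub> a') = m e e' \<otimes>\<^bsub>wgrp G\<^esub> m a a'"
    and cell_kappa: "h \<in> carrier (grp2 X) \<Longrightarrow> m (kappa E h) \<one>\<^bsub>wgrp E'\<^esub> = kappa G h"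
    and cell_iota: "k \<in> carrier (grp2 X'') \<Longrightarrow> m \<one>\<^bsub>wgrp E\<^esub> (iota E' k) = iota G k"
    and cell_antidiag: "g \<in> carrier (grp2 X') \<Longrightarrow> m (iota E g) (kappa E' g) = \<one>\<^bsub>wgrp G\<^esub>"
begin

lemma cell_one: "m \<one>\<^bsub>wgrp E\<^esub> \<one>\<^bsub>wgrp E'\<^esub> = \<one>\<^bsub>wgrp G\<^esub>"
  using cell_kappa[of "\<one>\<^bsub>grp2 X\<^esub>"] by simp

lemma cell_inv:
  assumes "e \<in> carrier (wgrp E)" "e' \<in> carrier (wgrp E')" "gamma E e = delta E' e'"
  shows "m (inv\<^bsub>wgrp E\<^esub> e) (inv\<^bsub>wgrp E'\<^esub> e') = inv\<^bsub>wgrp G\<^esub> (m e e')"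
  using assms cell_mult[of "inv\<^bsub>wgrp E\<^esub> e" "inv\<^bsub>wgrp E'\<^esub> e'" e e']
  by (intro G.W.inv_equality[symmetric]) (simp_all add: cell_one cell_closed)

text \<open>The axioms only require the cell to kill the antidiagonal; that it kills nothing more is
  forced by exactness. A killed pair has \<open>e = iota E g\<close>, so \<open>e'\<close> is
  \<open>kappa E' g\<close> times some \<open>iota E' k\<close>, and the cell takes this pair to
  \<open>iota G k\<close>, so \<open>k\<close> is trivial.\<close>

lemma cell_kernelE:
  assumes e: "e \<in> carrier (wgrp E)" "e' \<in> carrier (wgrp E')" "gamma E e = delta E' e'"
    and "m e e' = \<one>\<^bsub>wgrp G\<^esub>"
  obtains g where "g \<in> carrier (grp2 X')" "e = iota E g" "e' = kappa E' g"
proof -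
  have "delta E e = \<one>\<^bsub>grp1 X\<^esub>" using delta_cell[OF e] assms(4) by simp
  then obtain g where g: "g \<in> carrier (grp2 X')" "e = iota E g" using E.ker_deltaE e by metis
  with e have "delta E' e' = delta E' (kappa E' g)" by simp
  then obtain k where k: "k \<in> carrier (grp2 X'')" "e' = kappa E' g \<otimes>\<^bsub>wgrp E'\<^esub> iota E' k"
    using E'.delta_eqE e g by (metis E'.kappa.hom_closed)
  have "m e e' = m (iota E g \<otimes>\<^bsub>wgrp E\<^esub> \<one>\<^bsub>wgrp E\<^esub>) (kappa E' g \<otimes>\<^bsub>wgrp E'\<^esub> iota E' k)"
    using g k by simp
  also have "\<dots> = m (iota E g) (kappa E' g) \<otimes>\<^bsub>wgrp G\<^esub> m \<one>\<^bsub>wgrp E\<^esub> (iota E' k)"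
    using g k by (intro cell_mult) auto
  also have "\<dots> = iota G k" using g k by (simp add: cell_antidiag cell_iota)
  finally have "k = \<one>\<^bsub>grp2 X''\<^esub>" using assms(4) k by simp
  with g k that show ?thesis by simp
qed

lemma lift_delta:
  assumes "e \<in> carrier (wgrp E)"
  obtains e' where "e' \<in> carrier (wgrp E')" "gamma E e = delta E' e'"
  using E'.delta_surjE[of "gamma E e"] assms by (metis E.gamma.hom_closed)

text \<open>Some pair has a value with the same \<open>delta\<close> as \<open>x\<close>; the
  remaining factor \<open>iota G k\<close> is absorbed into the second coordinate.\<close>

lemma cell_surjE:
  assumes x: "x \<in> carrier (wgrp G)"
  obtains e e' where "e \<in> carrier (wgrp E)" "e' \<in> carrier (wgrp E')" "gamma E e = delta E' e'" "x = m e e'"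
proof -
  obtain e where e: "e \<in> carrier (wgrp E)" "delta E e = delta G x"
    using E.delta_surjE x G.delta.hom_closed by metis
  obtain e' where e': "e' \<in> carrier (wgrp E')" "gamma E e = delta E' e'"
    using lift_delta e by metis
  obtain k where k: "k \<in> carrier (grp2 X'')" "x = m e e' \<otimes>\<^bsub>wgrp G\<^esub> iota G k"
    using G.delta_eqE[of x "m e e'"] x e e' cell_closed delta_cell by metis
  then have "x = m (e \<otimes>\<^bsub>wgrp E\<^esub> \<one>\<^bsub>wgrp E\<^esub>) (e' \<otimes>\<^bsub>wgrp E'\<^esub> iota E' k)"
    using e e' by (subst cell_mult) (auto simp: cell_iota)
  with e e' k show ?thesis by (intro that[of e "e' \<otimes>\<^bsub>wgrp E'\<^esub> iota E' k"]) auto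
qed

end

text \<open>With identity 2-cells this says that all composites of \<open>E\<close> and
  \<open>E'\<close> are isomorphic, in general that composition respects isomorphism. The relation
  pairs \<open>m e e'\<close> with \<open>n (f e) (f' e')\<close>; it is single-valued by
  \<open>cell_kernelE\<close>, since \<open>f\<close> and \<open>f'\<close> carry antidiagonal pairs
  to antidiagonal pairs.\<close>

lemma comp_cell_imp_bfly_iso:
  assumes "comp_cell X X' X'' E E' G m" "comp_cell X X' X'' F F' H n"
    and f: "two_cell X X' E F f" and f': "two_cell X' X'' E' F' f'"
  shows "bfly_iso X X'' G H"
proof -
  interpret m: comp_cell X X' X'' E E' G m by fact
  interpret n: comp_cell X X' X'' F F' H n by fact
  interpret f: group_hom "wgrp E" "wgrp F" f
    using f by (simp add: group_hom_def group_hom_axioms_def m.E.W.group_axioms n.E.W.group_axioms two_cell_def)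
  interpret f': group_hom "wgrp E'" "wgrp F'" f'
    using f' by (simp add: group_hom_def group_hom_axioms_def m.E'.W.group_axioms n.E'.W.group_axioms two_cell_def)
  define ok where "ok e e' \<longleftrightarrow> e \<in> carrier (wgrp E) \<and> e' \<in> carrier (wgrp E') \<and> gamma E e = delta E' e'" for e e'
  define R where "R x y \<longleftrightarrow> (\<exists>e e'. ok e e' \<and> x = m e e' \<and> y = n (f e) (f' e'))" for x y
  have R_I: "R (m e e') (n (f e) (f' e'))" if "ok e e'" for e e'
    using that by (auto simp: R_def)
  have ok_f: "f e \<in> carrier (wgrp F)" "f' e' \<in> carrier (wgrp F')" "gamma F (f e) = delta F' (f' e')" if "ok e e'" for e e'
    using that f f' by (auto simp: ok_def two_cell_def)
  show ?thesis
  proof (rule bfly_iso_relI[where R = R])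
    fix x y assume "R x y"
    then show "x \<in> carrier (wgrp G) \<and> y \<in> carrier (wgrp H) \<and> delta H y = delta G x \<and> gamma H y = gamma G x"
      using ok_f f f'
      by (auto simp: R_def ok_def m.cell_closed n.cell_closed m.delta_cell n.delta_cell
        m.gamma_cell n.gamma_cell two_cell_def)
  next
    fix x y x' y' assume "R x y" "R x' y'"
    then obtain e e' a a' where *: "ok e e'" "x = m e e'" "y = n (f e) (f' e')"
      "ok a a'" "x' = m a a'" "y' = n (f a) (f' a')" by (auto simp: R_def)
    moreover have "ok (e \<otimes>\<^bsub>wgrp E\<^esub> a) (e' \<otimes>\<^bsub>wgrp E'\<^esub> a')" using * by (simp add: ok_def)
    ultimately show "R (x \<otimes>\<^bsub>wgrp G\<^esub> x') (y \<otimes>\<^bsub>wgrp H\<^esub> y')"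
      using R_I[of "e \<otimes>\<^bsub>wgrp E\<^esub> a" "e' \<otimes>\<^bsub>wgrp E'\<^esub> a'"] ok_f[of e e'] ok_f[of a a']
      by (simp add: ok_def m.cell_mult n.cell_mult)
  next
    fix x y assume "R x y"
    then obtain e e' where *: "ok e e'" "x = m e e'" "y = n (f e) (f' e')" by (auto simp: R_def)
    then show "R (inv\<^bsub>wgrp G\<^esub> x) (inv\<^bsub>wgrp H\<^esub> y)"
      using R_I[of "inv\<^bsub>wgrp E\<^esub> e" "inv\<^bsub>wgrp E'\<^esub> e'"] ok_f[of e e']
      by (simp add: ok_def m.cell_inv n.cell_inv)
  next
    fix h assume "h \<in> carrier (grp2 X)"
    then show "R (kappa G h) (kappa H h)"
      using R_I[of "kappa E h" "\<one>\<^bsub>wgrp E'\<^esub>"] f by (simp add: ok_def two_cell_def m.cell_kappa n.cell_kappa)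
  next
    fix k assume "k \<in> carrier (grp2 X'')"
    then show "R (iota G k) (iota H k)"
      using R_I[of "\<one>\<^bsub>wgrp E\<^esub>" "iota E' k"] f' by (simp add: ok_def two_cell_def m.cell_iota n.cell_iota)
  next
    fix x assume "x \<in> carrier (grp1 X)"
    then obtain e where "e \<in> carrier (wgrp E)" "delta E e = x" using m.E.delta_surjE by metis
    moreover from this obtain e' where "e' \<in> carrier (wgrp E')" "gamma E e = delta E' e'"
      using m.lift_delta by metis
    ultimately show "\<exists>u v. R u v \<and> delta G u = x"
      using R_I[of e e'] m.delta_cell by (metis ok_def)
  next
    fix y assume "R \<one>\<^bsub>wgrp G\<^esub> y"
    then obtain e e' where *: "ok e e'" "m e e' = \<one>\<^bsub>wgrp G\<^esub>" "y = n (f e) (f' e')" by (auto simp: R_def)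
    then obtain g where "g \<in> carrier (grp2 X')" "e = iota E g" "e' = kappa E' g"
      using m.cell_kernelE[of e e'] by (auto simp: ok_def)
    with * f f' show "y = \<one>\<^bsub>wgrp H\<^esub>" by (simp add: two_cell_def n.cell_antidiag)
  qed unfold_locales
qed

lemma two_cell_id: "two_cell X X' E E (\<lambda>e. e)"
  by (auto simp: two_cell_def hom_def)

section \<open>The quotient of the pullback is a composite\<close>

locale composable_butterflies =
  E: is_butterfly X X' E + E': is_butterfly X' X'' E'
  for X :: "('h2, 'h1, 'x) crossed_mod_scheme" and X' :: "('g2, 'g1, 'y) crossed_mod_scheme"
    and X'' :: "('k2, 'k1, 'z) crossed_mod_scheme"
    and E :: "('e, 'h2, 'h1, 'g2, 'g1) butterfly" and E' :: "('f, 'g2, 'g1, 'k2, 'k1) butterfly"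
begin

abbreviation "Q \<equiv> bfly_pullback X' E E'"
abbreviation "N \<equiv> bfly_antidiag X' E E'"
abbreviation "D \<equiv> bfly_comp X' E E'"
definition "q e e' = N #>\<^bsub>Q\<^esub> (e, e')"

lemma Q_simps [simp]:
  "(e, e') \<in> carrier Q \<longleftrightarrow> e \<in> carrier (wgrp E) \<and> e' \<in> carrier (wgrp E') \<and> gamma E e = delta E' e'"
  "(e, e') \<otimes>\<^bsub>Q\<^esub> (a, a') = (e \<otimes>\<^bsub>wgrp E\<^esub> a, e' \<otimes>\<^bsub>wgrp E'\<^esub> a')"
  "\<one>\<^bsub>Q\<^esub> = (\<one>\<^bsub>wgrp E\<^esub>, \<one>\<^bsub>wgrp E'\<^esub>)"
  by (simp_all add: bfly_pullback_def DirProd_def)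

sublocale Q: group Q
proof (rule groupI)
  fix x assume "x \<in> carrier Q"
  then show "\<exists>y\<in>carrier Q. y \<otimes>\<^bsub>Q\<^esub> x = \<one>\<^bsub>Q\<^esub>"
    by (cases x) (auto intro!: bexI[of _ "(inv\<^bsub>wgrp E\<^esub> fst x, inv\<^bsub>wgrp E'\<^esub> snd x)"])
qed (auto simp: E.W.m_assoc E'.W.m_assoc)

lemma inv_Q [simp]:
  "(e, e') \<in> carrier Q \<Longrightarrow> inv\<^bsub>Q\<^esub> (e, e') = (inv\<^bsub>wgrp E\<^esub> e, inv\<^bsub>wgrp E'\<^esub> e')"
  by (rule Q.inv_equality) auto

lemma antidiag_memE:
  assumes "n \<in> N"
  obtains g where "g \<in> carrier (grp2 X')" "n = (iota E g, kappa E' g)"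
  using assms by (auto simp: bfly_antidiag_def)

sublocale N: normal N Q
proof (unfold Q.normal_inv_iff, intro conjI ballI)
  have "(iota E g, kappa E' g) \<otimes>\<^bsub>Q\<^esub> (iota E g', kappa E' g') \<in> N"
    if "g \<in> carrier (grp2 X')" "g' \<in> carrier (grp2 X')" for g g'
    using that unfolding bfly_antidiag_def
    by (intro image_eqI[where x = "g \<otimes>\<^bsub>grp2 X'\<^esub> g'"]) auto
  moreover have "inv\<^bsub>Q\<^esub> (iota E g, kappa E' g) \<in> N" if "g \<in> carrier (grp2 X')" for g
    using that unfolding bfly_antidiag_def
    by (intro image_eqI[where x = "inv\<^bsub>grp2 X'\<^esub> g"]) auto
  ultimately show "subgroup N Q"
    by (intro Q.subgroupI) (auto simp: bfly_antidiag_def)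
next
  fix x n assume "x \<in> carrier Q" "n \<in> N"
  then obtain e e' g where x: "x = (e, e')" "(e, e') \<in> carrier Q"
    and g: "g \<in> carrier (grp2 X')" "n = (iota E g, kappa E' g)"
    by (cases x) (auto elim: antidiag_memE)
  \<comment> \<open>The two coordinates are acted on through \<open>gamma E e\<close> and
    \<open>delta E' e'\<close>, which coincide in the pullback.\<close>
  have "x \<otimes>\<^bsub>Q\<^esub> n \<otimes>\<^bsub>Q\<^esub> inv\<^bsub>Q\<^esub> x =
      (iota E (act X' (gamma E e) g), kappa E' (act X' (delta E' e') g))"
    using x g E.iota_act[of e g] E'.kappa_act[of e' g] by simp
  with x g show "x \<otimes>\<^bsub>Q\<^esub> n \<otimes>\<^bsub>Q\<^esub> inv\<^bsub>Q\<^esub> x \<in> N"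
    by (auto simp: bfly_antidiag_def)
qed

lemma D_simps:
  "wgrp D = Q Mod N" "kappa D h = q (kappa E h) \<one>\<^bsub>wgrp E'\<^esub>" "iota D k = q \<one>\<^bsub>wgrp E\<^esub> (iota E' k)"
  by (simp_all add: bfly_comp_def q_def Let_def)

sublocale D: group "wgrp D"
  using N.factorgroup_is_group by (simp add: D_simps)

lemma q_closed: "(e, e') \<in> carrier Q \<Longrightarrow> q e e' \<in> carrier (wgrp D)"
  unfolding D_simps carrier_FactGroup q_def by (rule imageI)

lemma q_surjE:
  assumes "x \<in> carrier (wgrp D)"
  obtains e e' where "(e, e') \<in> carrier Q" "x = q e e'"
proof -
  obtain z where "z \<in> carrier Q" "x = N #>\<^bsub>Q\<^esub> z"
    using assms unfolding D_simps carrier_FactGroup by (rule imageE)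
  with that show ?thesis by (cases z) (simp add: q_def)
qed

lemma q_mult:
  assumes "(e, e') \<in> carrier Q" "(a, a') \<in> carrier Q"
  shows "q e e' \<otimes>\<^bsub>wgrp D\<^esub> q a a' = q (e \<otimes>\<^bsub>wgrp E\<^esub> a) (e' \<otimes>\<^bsub>wgrp E'\<^esub> a')"
  using N.rcos_sum[OF assms] by (simp add: D_simps q_def)

lemma q_eq_one_iff:
  assumes "(e, e') \<in> carrier Q"
  shows "q e e' = \<one>\<^bsub>wgrp D\<^esub> \<longleftrightarrow> (\<exists>g\<in>carrier (grp2 X'). e = iota E g \<and> e' = kappa E' g)"
proof -
  have "q e e' = N \<longleftrightarrow> (e, e') \<in> N"
    unfolding q_def using assms Q.coset_join1 Q.coset_join2 N.subgroup_axioms N.subset by blast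
  then show ?thesis by (auto simp: D_simps bfly_antidiag_def)
qed

lemma
  assumes e: "(e, e') \<in> carrier Q"
  shows delta_q: "delta D (q e e') = delta E e" and gamma_q: "gamma D (q e e') = gamma E' e'"
proof -
  note coset = the_elem_image_r_coset[OF Q.group_axioms N.subgroup_axioms e]
  have "the_elem ((\<lambda>(e, e'). delta E e) ` (N #>\<^bsub>Q\<^esub> (e, e'))) = (\<lambda>(e, e'). delta E e) (e, e')"
    by (rule coset) (use e in \<open>auto elim!: antidiag_memE\<close>)
  then show "delta D (q e e') = delta E e"
    by (simp add: bfly_comp_def Let_def q_def)
  have "the_elem ((\<lambda>(e, e'). gamma E' e') ` (N #>\<^bsub>Q\<^esub> (e, e'))) = (\<lambda>(e, e'). gamma E' e') (e, e')"
    by (rule coset) (use e in \<open>auto elim!: antidiag_memE\<close>)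
  then show "gamma D (q e e') = gamma E' e'"
    by (simp add: bfly_comp_def Let_def q_def)
qed

lemma is_butterfly_comp: "is_butterfly X X'' D"
proof (rule is_butterflyI)
  show "crossed_module X" "crossed_module X''" "group (wgrp D)" by unfold_locales
  show "kappa D \<in> hom (grp2 X) (wgrp D)"
    by (auto simp: hom_def D_simps(2) q_closed q_mult)
  show "iota D \<in> hom (grp2 X'') (wgrp D)"
    by (auto simp: hom_def D_simps(3) q_closed q_mult)
  show "delta D \<in> hom (wgrp D) (grp1 X)"
    by (auto simp: hom_def q_mult delta_q elim!: q_surjE)
  show "gamma D \<in> hom (wgrp D) (grp1 X'')"
    by (auto simp: hom_def q_mult gamma_q elim!: q_surjE)
  show "delta D (kappa D h) = bdry X h" "gamma D (kappa D h) = \<one>\<^bsub>grp1 X''\<^esub>"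
    if "h \<in> carrier (grp2 X)" for h
    using that by (simp_all add: D_simps(2) delta_q gamma_q)
  show "delta D (iota D k) = \<one>\<^bsub>grp1 X\<^esub>" "gamma D (iota D k) = bdry X'' k"
    if "k \<in> carrier (grp2 X'')" for k
    using that by (simp_all add: D_simps(3) delta_q gamma_q)
  show "k = \<one>\<^bsub>grp2 X''\<^esub>" if k: "k \<in> carrier (grp2 X'')" "iota D k = \<one>\<^bsub>wgrp D\<^esub>" for k
  proof -
    \<comment> \<open>An antidiagonal element with trivial first coordinate is trivial, by
      injectivity of \<open>iota E\<close>.\<close>
    obtain g where "g \<in> carrier (grp2 X')" "\<one>\<^bsub>wgrp E\<^esub> = iota E g" "iota E' k = kappa E' g"
      using k q_eq_one_iff[of "\<one>\<^bsub>wgrp E\<^esub>" "iota E' k"] by (auto simp: D_simps(3))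
    with k(1) show ?thesis by (metis E.iota_eq_one_iff E'.iota_eq_one_iff E'.kappa.hom_one)
  qed
  show "\<exists>k\<in>carrier (grp2 X''). x = iota D k" if x: "x \<in> carrier (wgrp D)" "delta D x = \<one>\<^bsub>grp1 X\<^esub>" for x
  proof -
    obtain e e' where e: "(e, e') \<in> carrier Q" "x = q e e'" using x q_surjE by metis
    then have "delta E e = \<one>\<^bsub>grp1 X\<^esub>" using x delta_q by simp
    then obtain g where g: "g \<in> carrier (grp2 X')" "e = iota E g" using E.ker_deltaE e by auto
    with e have "delta E' e' = delta E' (kappa E' g)" by simp
    then obtain k where k: "k \<in> carrier (grp2 X'')" "e' = kappa E' g \<otimes>\<^bsub>wgrp E'\<^esub> iota E' k"
      using E'.delta_eqE[of e' "kappa E' g"] e g by auto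
    \<comment> \<open>In the pullback \<open>(e, e')\<close> is the product of the antidiagonal
      element of \<open>g\<close> and \<open>(1, iota E' k)\<close>.\<close>
    have "q (iota E g) (kappa E' g) = \<one>\<^bsub>wgrp D\<^esub>" using g q_eq_one_iff by auto
    then have "x = iota D k"
      using q_mult[of "iota E g" "kappa E' g" "\<one>\<^bsub>wgrp E\<^esub>" "iota E' k"] e g k q_closed
      by (simp add: D_simps(3))
    with k show ?thesis by blast
  qed
  show "\<exists>u\<in>carrier (wgrp D). delta D u = x" if x: "x \<in> carrier (grp1 X)" for x
  proof -
    obtain e where e: "e \<in> carrier (wgrp E)" "delta E e = x" using E.delta_surjE x by metis
    obtain e' where "e' \<in> carrier (wgrp E')" "delta E' e' = gamma E e"
      using E'.delta_surjE e E.gamma.hom_closed by metis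
    with e have "(e, e') \<in> carrier Q" by simp
    with e q_closed delta_q show ?thesis by metis
  qed
  show "kappa D (act X (delta D u) h) \<otimes>\<^bsub>wgrp D\<^esub> u = u \<otimes>\<^bsub>wgrp D\<^esub> kappa D h"
    if "u \<in> carrier (wgrp D)" "h \<in> carrier (grp2 X)" for u h
    using that by (auto simp: D_simps(2) q_mult delta_q E.conj_kappa elim!: q_surjE)
  show "iota D (act X'' (gamma D u) k) \<otimes>\<^bsub>wgrp D\<^esub> u = u \<otimes>\<^bsub>wgrp D\<^esub> iota D k"
    if "u \<in> carrier (wgrp D)" "k \<in> carrier (grp2 X'')" for u k
    using that by (auto simp: D_simps(3) q_mult gamma_q E'.conj_iota elim!: q_surjE)
qed

lemma comp_cell_q: "comp_cell X X' X'' E E' D q"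
proof -
  interpret D: is_butterfly X X'' D by (rule is_butterfly_comp)
  show ?thesis
    by unfold_locales (auto simp: q_closed q_mult delta_q gamma_q D_simps(2,3) q_eq_one_iff)
qed

end

lemma comp_cell_bfly_comp:
  assumes "is_butterfly X X' E" "is_butterfly X' X'' E'"
  obtains m where "comp_cell X X' X'' E E' (bfly_comp X' E E') m"
  using composable_butterflies.comp_cell_q[OF composable_butterflies.intro[OF assms]] that by metis

lemma is_butterfly_bfly_comp:
  assumes "is_butterfly X X' E" "is_butterfly X' X'' E'"
  shows "is_butterfly X X'' (bfly_comp X' E E')"
  using composable_butterflies.is_butterfly_comp[OF composable_butterflies.intro[OF assms]] .

text \<open>Both bracketings are multiplicative in matching triples \<open>(e, e', e'')\<close>, so
  the relation pairing their values is the graph of the associator. The point to check is that a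
  triple killed by \<open>l\<close> is killed by \<open>r\<close>: such a triple is
  \<open>(iota E x, kappa E' x * iota E' g, kappa E'' g)\<close> for suitable \<open>x\<close> and
  \<open>g\<close>.\<close>

lemma comp_cell_assoc:
  assumes "comp_cell X X' X'' E E' F m1" "comp_cell X X'' X''' F E'' G m2"
    and "comp_cell X' X'' X''' E' E'' H m3" "comp_cell X X' X''' E H K m4"
  shows "bfly_iso X X''' G K"
proof -
  interpret m1: comp_cell X X' X'' E E' F m1 by fact
  interpret m2: comp_cell X X'' X''' F E'' G m2 by fact
  interpret m3: comp_cell X' X'' X''' E' E'' H m3 by fact
  interpret m4: comp_cell X X' X''' E H K m4 by fact
  define ok where "ok e e' e'' \<longleftrightarrow> e \<in> carrier (wgrp E) \<and> e' \<in> carrier (wgrp E') \<and> e'' \<in> carrier (wgrp E'') \<and>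
    gamma E e = delta E' e' \<and> gamma E' e' = delta E'' e''" for e e' e''
  define l where "l e e' e'' = m2 (m1 e e') e''" for e e' e''
  define r where "r e e' e'' = m4 e (m3 e' e'')" for e e' e''
  define R where "R x y \<longleftrightarrow> (\<exists>e e' e''. ok e e' e'' \<and> x = l e e' e'' \<and> y = r e e' e'')" for x y
  have R_I: "R (l e e' e'') (r e e' e'')" if "ok e e' e''" for e e' e''
    using that by (auto simp: R_def)
  note cells = m1.cell_closed m2.cell_closed m3.cell_closed m4.cell_closed
    m1.delta_cell m2.delta_cell m3.delta_cell m4.delta_cell
    m1.gamma_cell m2.gamma_cell m3.gamma_cell m4.gamma_cell
  have mult: "l (e \<otimes>\<^bsub>wgrp E\<^esub> a) (e' \<otimes>\<^bsub>wgrp E'\<^esub> a') (e'' \<otimes>\<^bsub>wgrp E''\<^esub> a'') = l e e' e'' \<otimes>\<^bsub>wgrp G\<^esub> l a a' a''"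
    "r (e \<otimes>\<^bsub>wgrp E\<^esub> a) (e' \<otimes>\<^bsub>wgrp E'\<^esub> a') (e'' \<otimes>\<^bsub>wgrp E''\<^esub> a'') = r e e' e'' \<otimes>\<^bsub>wgrp K\<^esub> r a a' a''"
    "ok (e \<otimes>\<^bsub>wgrp E\<^esub> a) (e' \<otimes>\<^bsub>wgrp E'\<^esub> a') (e'' \<otimes>\<^bsub>wgrp E''\<^esub> a'')"
    if "ok e e' e''" "ok a a' a''" for e e' e'' a a' a''
    using that by (simp_all add: l_def r_def ok_def cells m1.cell_mult m2.cell_mult m3.cell_mult m4.cell_mult)
  have inv: "l (inv\<^bsub>wgrp E\<^esub> e) (inv\<^bsub>wgrp E'\<^esub> e') (inv\<^bsub>wgrp E''\<^esub> e'') = inv\<^bsub>wgrp G\<^esub> (l e e' e'')"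
    "r (inv\<^bsub>wgrp E\<^esub> e) (inv\<^bsub>wgrp E'\<^esub> e') (inv\<^bsub>wgrp E''\<^esub> e'') = inv\<^bsub>wgrp K\<^esub> (r e e' e'')"
    "ok (inv\<^bsub>wgrp E\<^esub> e) (inv\<^bsub>wgrp E'\<^esub> e') (inv\<^bsub>wgrp E''\<^esub> e'')"
    if "ok e e' e''" for e e' e''
    using that by (simp_all add: l_def r_def ok_def cells m1.cell_inv m2.cell_inv m3.cell_inv m4.cell_inv)
  show ?thesis
  proof (rule bfly_iso_relI[where R = R])
    fix x y assume "R x y"
    then show "x \<in> carrier (wgrp G) \<and> y \<in> carrier (wgrp K) \<and> delta K y = delta G x \<and> gamma K y = gamma G x"
      by (auto simp: R_def ok_def l_def r_def cells)
  next
    fix x y x' y' assume "R x y" "R x' y'"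
    then show "R (x \<otimes>\<^bsub>wgrp G\<^esub> x') (y \<otimes>\<^bsub>wgrp K\<^esub> y')"
      unfolding R_def using mult by metis
  next
    fix x y assume "R x y"
    then show "R (inv\<^bsub>wgrp G\<^esub> x) (inv\<^bsub>wgrp K\<^esub> y)"
      unfolding R_def using inv by metis
  next
    fix h assume "h \<in> carrier (grp2 X)"
    then show "R (kappa G h) (kappa K h)"
      using R_I[of "kappa E h" "\<one>\<^bsub>wgrp E'\<^esub>" "\<one>\<^bsub>wgrp E''\<^esub>"]
      by (simp add: ok_def l_def r_def m1.cell_kappa m2.cell_kappa m3.cell_one m4.cell_kappa)
  next
    fix k assume "k \<in> carrier (grp2 X''')"
    then show "R (iota G k) (iota K k)"
      using R_I[of "\<one>\<^bsub>wgrp E\<^esub>" "\<one>\<^bsub>wgrp E'\<^esub>" "iota E'' k"]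
      by (simp add: ok_def l_def r_def m1.cell_one m2.cell_iota m3.cell_iota m4.cell_iota)
  next
    fix x assume "x \<in> carrier (grp1 X)"
    then obtain e where e: "e \<in> carrier (wgrp E)" "delta E e = x" using m1.E.delta_surjE by metis
    then obtain e' where e': "e' \<in> carrier (wgrp E')" "gamma E e = delta E' e'"
      using m1.lift_delta by metis
    then obtain e'' where "e'' \<in> carrier (wgrp E'')" "gamma E' e' = delta E'' e''"
      using m3.lift_delta by metis
    with e e' have "ok e e' e''" "delta G (l e e' e'') = x" by (simp_all add: ok_def l_def cells)
    with R_I show "\<exists>u v. R u v \<and> delta G u = x" by metis
  next
    fix y assume "R \<one>\<^bsub>wgrp G\<^esub> y"
    then obtain e e' e'' where *: "ok e e' e''" "m2 (m1 e e') e'' = \<one>\<^bsub>wgrp G\<^esub>" "y = r e e' e''"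
      by (auto simp: R_def l_def)
    then obtain g where g: "g \<in> carrier (grp2 X'')" "m1 e e' = iota F g" "e'' = kappa E'' g"
      using m2.cell_kernelE[of "m1 e e'" e''] by (auto simp: ok_def cells)
    \<comment> \<open>Dividing by \<open>iota E' g\<close> turns the value \<open>iota F g\<close>
      of \<open>m1\<close> into the unit, so that \<open>cell_kernelE\<close> applies to
      \<open>m1\<close>.\<close>
    have "m1 (e \<otimes>\<^bsub>wgrp E\<^esub> \<one>\<^bsub>wgrp E\<^esub>) (e' \<otimes>\<^bsub>wgrp E'\<^esub> iota E' (inv\<^bsub>grp2 X''\<^esub> g)) = \<one>\<^bsub>wgrp F\<^esub>"
      using * g m1.cell_iota[of "inv\<^bsub>grp2 X''\<^esub> g"] by (subst m1.cell_mult) (auto simp: ok_def)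
    then obtain x where x: "x \<in> carrier (grp2 X')" "e = iota E x"
      "e' \<otimes>\<^bsub>wgrp E'\<^esub> iota E' (inv\<^bsub>grp2 X''\<^esub> g) = kappa E' x"
      using m1.cell_kernelE[of e "e' \<otimes>\<^bsub>wgrp E'\<^esub> iota E' (inv\<^bsub>grp2 X''\<^esub> g)"] * g by (auto simp: ok_def)
    then have e': "e' = kappa E' x \<otimes>\<^bsub>wgrp E'\<^esub> iota E' g"
      using * g m1.E'.W.inv_solve_right[of "kappa E' x" e' "iota E' g"] by (simp add: ok_def)
    have "m3 e' e'' = m3 (kappa E' x \<otimes>\<^bsub>wgrp E'\<^esub> iota E' g) (\<one>\<^bsub>wgrp E''\<^esub> \<otimes>\<^bsub>wgrp E''\<^esub> kappa E'' g)"
      using e' g by simp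
    also have "\<dots> = kappa H x"
      using x g by (subst m3.cell_mult) (auto simp: m3.cell_kappa m3.cell_antidiag)
    finally show "y = \<one>\<^bsub>wgrp K\<^esub>" using * x by (simp add: r_def m4.cell_antidiag)
  qed unfold_locales
qed

section \<open>Butterflies of strict morphisms and composition with them\<close>

locale strict_morphism =
  X: crossed_module X + X': crossed_module X'
  for X :: "('h2, 'h1, 'y) crossed_mod_scheme" and X' :: "('g2, 'g1, 'z) crossed_mod_scheme"
    and f2 :: "'h2 \<Rightarrow> 'g2" and f1 :: "'h1 \<Rightarrow> 'g1" +
  assumes f2_hom: "f2 \<in> hom (grp2 X) (grp2 X')"
    and f1_hom: "f1 \<in> hom (grp1 X) (grp1 X')"
    and bdry_f2: "h \<in> carrier (grp2 X) \<Longrightarrow> bdry X' (f2 h) = f1 (bdry X h)"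
    and f2_act: "\<lbrakk>x \<in> carrier (grp1 X); h \<in> carrier (grp2 X)\<rbrakk> \<Longrightarrow> f2 (act X x h) = act X' (f1 x) (f2 h)"
begin

sublocale f2: group_hom "grp2 X" "grp2 X'" f2
  using f2_hom by (simp add: group_hom_def group_hom_axioms_def X.G2.group_axioms X'.G2.group_axioms)

sublocale f1: group_hom "grp1 X" "grp1 X'" f1
  using f1_hom by (simp add: group_hom_def group_hom_axioms_def X.G1.group_axioms X'.G1.group_axioms)

abbreviation "S \<equiv> strict_bfly X X' f2 f1"

lemma strict_bfly_simps [simp]:
  "carrier (wgrp S) = carrier (grp2 X') \<times> carrier (grp1 X)"
  "(g, x) \<otimes>\<^bsub>wgrp S\<^esub> (g', x') = (g \<otimes>\<^bsub>grp2 X'\<^esub> act X' (f1 x) g', x \<otimes>\<^bsub>grp1 X\<^esub> x')"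
  "\<one>\<^bsub>wgrp S\<^esub> = (\<one>\<^bsub>grp2 X'\<^esub>, \<one>\<^bsub>grp1 X\<^esub>)"
  "kappa S h = (inv\<^bsub>grp2 X'\<^esub> (f2 h), bdry X h)" "iota S g = (g, \<one>\<^bsub>grp1 X\<^esub>)"
  "delta S (g, x) = x" "gamma S (g, x) = bdry X' g \<otimes>\<^bsub>grp1 X'\<^esub> f1 x"
  by (simp_all add: strict_bfly_def)

lemma group_strict_bfly: "group (wgrp S)"
proof (rule groupI)
  fix u assume "u \<in> carrier (wgrp S)"
  then obtain g x where u: "u = (g, x)" "g \<in> carrier (grp2 X')" "x \<in> carrier (grp1 X)" by auto
  show "\<exists>v\<in>carrier (wgrp S). v \<otimes>\<^bsub>wgrp S\<^esub> u = \<one>\<^bsub>wgrp S\<^esub>"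
  proof (rule bexI)
    show "(act X' (f1 (inv\<^bsub>grp1 X\<^esub> x)) (inv\<^bsub>grp2 X'\<^esub> g), inv\<^bsub>grp1 X\<^esub> x) \<otimes>\<^bsub>wgrp S\<^esub> u = \<one>\<^bsub>wgrp S\<^esub>"
      using u by (simp add: X'.act_inv)
  qed (use u in simp)
qed (auto simp: X'.G2.m_assoc X.G1.m_assoc X'.act_mult X'.act_comp)

lemma is_butterfly_strict_bfly: "is_butterfly X X' S"
proof (rule is_butterflyI)
  show "crossed_module X" "crossed_module X'" "group (wgrp S)"
    by (rule X.crossed_module_axioms X'.crossed_module_axioms group_strict_bfly)+
  \<comment> \<open>The inverse in the first coordinate of \<open>kappa\<close> reverses products.
    The twist by the action of \<open>f1 (bdry X h)\<close>, which by the Peiffer identity is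
    conjugation by \<open>f2 h\<close>, restores the order.\<close>
  show "kappa S \<in> hom (grp2 X) (wgrp S)"
    by (auto simp: hom_def X'.G2.inv_mult_group X'.G2.m_assoc X'.peiffer simp flip: bdry_f2)
  show "iota S \<in> hom (grp2 X') (wgrp S)" by (auto simp: hom_def)
  show "delta S \<in> hom (wgrp S) (grp1 X)" by (auto simp: hom_def)
  show "gamma S \<in> hom (wgrp S) (grp1 X')"
    by (auto simp: hom_def X'.equivariant X'.G1.m_assoc)
  show "kappa S (act X (delta S e) h) \<otimes>\<^bsub>wgrp S\<^esub> e = e \<otimes>\<^bsub>wgrp S\<^esub> kappa S h"
    if "e \<in> carrier (wgrp S)" "h \<in> carrier (grp2 X)" for e h
  proof -
    have "bdry X (act X x h) \<otimes>\<^bsub>grp1 X\<^esub> x = x \<otimes>\<^bsub>grp1 X\<^esub> bdry X h" if "x \<in> carrier (grp1 X)" for x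
      using that \<open>h \<in> carrier (grp2 X)\<close> by (simp add: X.equivariant X.G1.m_assoc)
    with that show ?thesis
      by (auto simp: X'.peiffer X'.G2.m_assoc f2_act X'.act_inv simp flip: bdry_f2)
  qed
  show "iota S (act X' (gamma S e) g) \<otimes>\<^bsub>wgrp S\<^esub> e = e \<otimes>\<^bsub>wgrp S\<^esub> iota S g"
    if "e \<in> carrier (wgrp S)" "g \<in> carrier (grp2 X')" for e g
    using that by (auto simp: X'.act_comp X'.peiffer X'.G2.m_assoc)
qed (auto simp: bdry_f2)

end

definition precomp_bfly ::
  "('l2 \<Rightarrow> 'h2) \<Rightarrow> ('e, 'h2, 'h1, 'g2, 'g1) butterfly \<Rightarrow> ('e, 'l2, 'h1, 'g2, 'g1) butterfly" where
  "precomp_bfly f2 E = \<lparr>wgrp = wgrp E, kappa = \<lambda>h. kappa E (f2 h), iota = iota E, delta = delta E, gamma = gamma E\<rparr>"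

definition postcomp_bfly ::
  "('g1 \<Rightarrow> 'k1) \<Rightarrow> ('e, 'h2, 'h1, 'g2, 'g1) butterfly \<Rightarrow> ('e, 'h2, 'h1, 'g2, 'k1) butterfly" where
  "postcomp_bfly f1 E = \<lparr>wgrp = wgrp E, kappa = kappa E, iota = iota E, delta = delta E, gamma = \<lambda>e. f1 (gamma E e)\<rparr>"

lemma precomp_bfly_simps [simp]:
  "wgrp (precomp_bfly f2 E) = wgrp E" "kappa (precomp_bfly f2 E) h = kappa E (f2 h)"
  "iota (precomp_bfly f2 E) = iota E" "delta (precomp_bfly f2 E) = delta E" "gamma (precomp_bfly f2 E) = gamma E"
  by (simp_all add: precomp_bfly_def)

lemma postcomp_bfly_simps [simp]:
  "wgrp (postcomp_bfly f1 E) = wgrp E" "kappa (postcomp_bfly f1 E) = kappa E"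
  "iota (postcomp_bfly f1 E) = iota E" "delta (postcomp_bfly f1 E) = delta E"
  "gamma (postcomp_bfly f1 E) e = f1 (gamma E e)"
  by (simp_all add: postcomp_bfly_def)

text \<open>
  Precomposition with a strict morphism \<open>(f2, id)\<close> and postcomposition with a strict morphism
  \<open>(id, f1)\<close> do not change the group of a butterfly, so no quotient is needed to describe them.
\<close>

lemma comp_cell_precomp:
  assumes "strict_morphism X X' f2 (\<lambda>x. x)" "grp1 X = grp1 X'" "is_butterfly X' X'' E"
  shows "comp_cell X X' X'' (strict_bfly X X' f2 (\<lambda>x. x)) E (precomp_bfly f2 E)
    (\<lambda>(l, x) e. inv\<^bsub>wgrp E\<^esub> (kappa E l) \<otimes>\<^bsub>wgrp E\<^esub> e)"
proof -
  interpret f: strict_morphism X X' f2 "\<lambda>x. x" by fact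
  interpret S: is_butterfly X X' f.S by (rule f.is_butterfly_strict_bfly)
  interpret E: is_butterfly X' X'' E by fact
  have [simp]: "grp1 X = grp1 X'" by fact
  have bf: "bdry X' (f2 h) = bdry X h" if "h \<in> carrier (grp2 X)" for h
    using f.bdry_f2 that by simp
  interpret P: is_butterfly X X'' "precomp_bfly f2 E"
  proof (rule is_butterflyI)
    show "crossed_module X" "crossed_module X''" "group (wgrp (precomp_bfly f2 E))"
      by simp_all unfold_locales
    show "kappa (precomp_bfly f2 E) \<in> hom (grp2 X) (wgrp (precomp_bfly f2 E))"
      by (auto simp: hom_def)
    show "kappa (precomp_bfly f2 E) (act X (delta (precomp_bfly f2 E) e) h) \<otimes>\<^bsub>wgrp (precomp_bfly f2 E)\<^esub> e =
      e \<otimes>\<^bsub>wgrp (precomp_bfly f2 E)\<^esub> kappa (precomp_bfly f2 E) h"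
      if "e \<in> carrier (wgrp (precomp_bfly f2 E))" "h \<in> carrier (grp2 X)" for e h
      using that by (simp add: f.f2_act E.conj_kappa)
    show "\<exists>g\<in>carrier (grp2 X''). e = iota (precomp_bfly f2 E) g"
      if "e \<in> carrier (wgrp (precomp_bfly f2 E))" "delta (precomp_bfly f2 E) e = \<one>\<^bsub>grp1 X\<^esub>" for e
      using that E.ker_deltaE[of e] by auto
    show "\<exists>e\<in>carrier (wgrp (precomp_bfly f2 E)). delta (precomp_bfly f2 E) e = x"
      if "x \<in> carrier (grp1 X)" for x
      using that E.delta_surjE[of x] by auto
  qed (use E.iota_hom E.delta_hom E.gamma_hom in \<open>auto simp: bf E.conj_iota\<close>)
  show ?thesis
  proof unfold_locales
    fix e e' assume "e \<in> carrier (wgrp f.S)" "e' \<in> carrier (wgrp E)" "gamma f.S e = delta E e'"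
    moreover obtain l x where e: "e = (l, x)" by force
    ultimately have *: "l \<in> carrier (grp2 X')" "x \<in> carrier (grp1 X')" "e' \<in> carrier (wgrp E)"
      "delta E e' = bdry X' l \<otimes>\<^bsub>grp1 X'\<^esub> x" by simp_all
    from * e show "(case e of (l, x) \<Rightarrow> \<lambda>e. inv\<^bsub>wgrp E\<^esub> (kappa E l) \<otimes>\<^bsub>wgrp E\<^esub> e) e' \<in> carrier (wgrp (precomp_bfly f2 E))"
      "delta (precomp_bfly f2 E) ((case e of (l, x) \<Rightarrow> \<lambda>e. inv\<^bsub>wgrp E\<^esub> (kappa E l) \<otimes>\<^bsub>wgrp E\<^esub> e) e') = delta f.S e"
      "gamma (precomp_bfly f2 E) ((case e of (l, x) \<Rightarrow> \<lambda>e. inv\<^bsub>wgrp E\<^esub> (kappa E l) \<otimes>\<^bsub>wgrp E\<^esub> e) e') = gamma E e'"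
      by (simp_all)
    fix a a' assume "a \<in> carrier (wgrp f.S)" "a' \<in> carrier (wgrp E)" "gamma f.S a = delta E a'"
    moreover obtain k y where a: "a = (k, y)" by force
    ultimately have **: "k \<in> carrier (grp2 X')" "y \<in> carrier (grp1 X')" "a' \<in> carrier (wgrp E)" by simp_all
    \<comment> \<open>As \<open>delta E e'\<close> is \<open>bdry X' l\<close> times
      \<open>x\<close>, the Peiffer identity makes \<open>act X' (delta E e') k\<close> the
      conjugate of \<open>act X' x k\<close> by \<open>l\<close>. This moves
      \<open>kappa E k\<close> past \<open>e'\<close>.\<close>
    have "kappa E (l \<otimes>\<^bsub>grp2 X'\<^esub> act X' x k) \<otimes>\<^bsub>wgrp E\<^esub> (inv\<^bsub>wgrp E\<^esub> (kappa E l) \<otimes>\<^bsub>wgrp E\<^esub> e') =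
        kappa E (act X' (delta E e') k) \<otimes>\<^bsub>wgrp E\<^esub> e'"
      using * ** by (simp add: f.X'.act_comp f.X'.peiffer E.W.m_assoc)
    also have "\<dots> = e' \<otimes>\<^bsub>wgrp E\<^esub> kappa E k" using * ** by (simp add: E.conj_kappa)
    finally have "inv\<^bsub>wgrp E\<^esub> (kappa E l) \<otimes>\<^bsub>wgrp E\<^esub> e' =
        inv\<^bsub>wgrp E\<^esub> kappa E (l \<otimes>\<^bsub>grp2 X'\<^esub> act X' x k) \<otimes>\<^bsub>wgrp E\<^esub> (e' \<otimes>\<^bsub>wgrp E\<^esub> kappa E k)"
      using * ** by (intro E.W.inv_solve_left[THEN iffD2]) (auto simp del: E.kappa.hom_mult)
    with * ** show "(case e \<otimes>\<^bsub>wgrp f.S\<^esub> a of (l, x) \<Rightarrow> \<lambda>e. inv\<^bsub>wgrp E\<^esub> (kappa E l) \<otimes>\<^bsub>wgrp E\<^esub> e) (e' \<otimes>\<^bsub>wgrp E\<^esub> a') =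
      (case e of (l, x) \<Rightarrow> \<lambda>e. inv\<^bsub>wgrp E\<^esub> (kappa E l) \<otimes>\<^bsub>wgrp E\<^esub> e) e' \<otimes>\<^bsub>wgrp (precomp_bfly f2 E)\<^esub>
      (case a of (l, x) \<Rightarrow> \<lambda>e. inv\<^bsub>wgrp E\<^esub> (kappa E l) \<otimes>\<^bsub>wgrp E\<^esub> e) a'"
      by (simp add: e a E.W.m_assoc del: E.kappa.hom_mult)
  qed simp_all
qed

text \<open>Here left multiplication by the antidiagonal element of \<open>g\<close> brings
  \<open>(e, (g, x))\<close> to a pair with first coordinate \<open>iota E g * e\<close> and second
  coordinate \<open>(1, y)\<close>, where \<open>y\<close> is determined by the first.\<close>

lemma comp_cell_postcomp:
  assumes "strict_morphism X' X'' (\<lambda>g. g) f1" "grp2 X' = grp2 X''" "is_butterfly X X' E"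
  shows "comp_cell X X' X'' E (strict_bfly X' X'' (\<lambda>g. g) f1) (postcomp_bfly f1 E)
    (\<lambda>e (g, x). iota E g \<otimes>\<^bsub>wgrp E\<^esub> e)"
proof -
  interpret f: strict_morphism X' X'' "\<lambda>g. g" f1 by fact
  interpret S: is_butterfly X' X'' f.S by (rule f.is_butterfly_strict_bfly)
  interpret E: is_butterfly X X' E by fact
  have [simp]: "grp2 X' = grp2 X''" by fact
  interpret iota: group_hom "grp2 X''" "wgrp E" "iota E" using E.iota.group_hom_axioms by simp
  have acts: "act X'' (f1 x) g = act X' x g" if "x \<in> carrier (grp1 X')" "g \<in> carrier (grp2 X'')" for x g
    using f.f2_act that by simp
  have bf: "f1 (bdry X' g) = bdry X'' g" if "g \<in> carrier (grp2 X'')" for g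
    using f.bdry_f2 that by simp
  interpret P: is_butterfly X X'' "postcomp_bfly f1 E"
  proof (rule is_butterflyI)
    show "crossed_module X" "crossed_module X''" "group (wgrp (postcomp_bfly f1 E))"
      by simp_all unfold_locales
    show "gamma (postcomp_bfly f1 E) \<in> hom (wgrp (postcomp_bfly f1 E)) (grp1 X'')"
      by (auto simp: hom_def)
    show "iota (postcomp_bfly f1 E) \<in> hom (grp2 X'') (wgrp (postcomp_bfly f1 E))"
      using E.iota_hom by simp
    show "iota (postcomp_bfly f1 E) (act X'' (gamma (postcomp_bfly f1 E) e) h) \<otimes>\<^bsub>wgrp (postcomp_bfly f1 E)\<^esub> e =
      e \<otimes>\<^bsub>wgrp (postcomp_bfly f1 E)\<^esub> iota (postcomp_bfly f1 E) h"
      if "e \<in> carrier (wgrp (postcomp_bfly f1 E))" "h \<in> carrier (grp2 X'')" for e h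
      using that by (simp add: acts E.conj_iota)
    show "\<exists>g\<in>carrier (grp2 X''). e = iota (postcomp_bfly f1 E) g"
      if "e \<in> carrier (wgrp (postcomp_bfly f1 E))" "delta (postcomp_bfly f1 E) e = \<one>\<^bsub>grp1 X\<^esub>" for e
      using that E.ker_deltaE[of e] by auto
    show "\<exists>e\<in>carrier (wgrp (postcomp_bfly f1 E)). delta (postcomp_bfly f1 E) e = x"
      if "x \<in> carrier (grp1 X)" for x
      using that E.delta_surjE[of x] by auto
  qed (use E.kappa_hom E.delta_hom E.iota_eq_one_iff in \<open>auto simp: bf E.conj_kappa\<close>)
  show ?thesis
  proof unfold_locales
    fix e e' assume "e \<in> carrier (wgrp E)" "e' \<in> carrier (wgrp f.S)" "gamma E e = delta f.S e'"
    moreover obtain g x where e': "e' = (g, x)" by force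
    ultimately have *: "g \<in> carrier (grp2 X'')" "x \<in> carrier (grp1 X')" "e \<in> carrier (wgrp E)"
      "gamma E e = x" by simp_all
    from * e' show "(case e' of (g, x) \<Rightarrow> iota E g \<otimes>\<^bsub>wgrp E\<^esub> e) \<in> carrier (wgrp (postcomp_bfly f1 E))"
      "delta (postcomp_bfly f1 E) (case e' of (g, x) \<Rightarrow> iota E g \<otimes>\<^bsub>wgrp E\<^esub> e) = delta E e"
      "gamma (postcomp_bfly f1 E) (case e' of (g, x) \<Rightarrow> iota E g \<otimes>\<^bsub>wgrp E\<^esub> e) = gamma f.S e'"
      by (simp_all add: bf)
    fix a a' assume "a \<in> carrier (wgrp E)" "a' \<in> carrier (wgrp f.S)" "gamma E a = delta f.S a'"
    moreover obtain k y where a': "a' = (k, y)" by force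
    ultimately have **: "k \<in> carrier (grp2 X'')" "y \<in> carrier (grp1 X')" "a \<in> carrier (wgrp E)" by simp_all
    have "iota E (act X' x k) \<otimes>\<^bsub>wgrp E\<^esub> (e \<otimes>\<^bsub>wgrp E\<^esub> a) = e \<otimes>\<^bsub>wgrp E\<^esub> (iota E k \<otimes>\<^bsub>wgrp E\<^esub> a)"
      using * ** E.conj_iota[of e k] f.X.act_closed[of x k] by (simp flip: E.W.m_assoc)
    with * ** f.X.act_closed[of x k]
    show "(case e' \<otimes>\<^bsub>wgrp f.S\<^esub> a' of (g, x) \<Rightarrow> iota E g \<otimes>\<^bsub>wgrp E\<^esub> (e \<otimes>\<^bsub>wgrp E\<^esub> a)) =
      (case e' of (g, x) \<Rightarrow> iota E g \<otimes>\<^bsub>wgrp E\<^esub> e) \<otimes>\<^bsub>wgrp (postcomp_bfly f1 E)\<^esub>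
      (case a' of (g, x) \<Rightarrow> iota E g \<otimes>\<^bsub>wgrp E\<^esub> a)"
      by (simp add: e' a' E.W.m_assoc acts)
  qed simp_all
qed

section \<open>The category of crossed extensions and its fibres\<close>

lemma strict_morphism_id:
  assumes "crossed_module X"
  shows "strict_morphism X X (\<lambda>g. g) (\<lambda>x. x)"
  using assms by (auto simp: strict_morphism_def strict_morphism_axioms_def hom_def)

lemmas id_bfly_simps = strict_morphism.strict_bfly_simps[OF strict_morphism_id, folded id_bfly_def]

lemma is_butterfly_id_bfly: "crossed_module X \<Longrightarrow> is_butterfly X X (id_bfly X)"
  unfolding id_bfly_def by (rule strict_morphism.is_butterfly_strict_bfly[OF strict_morphism_id])

lemma comp_cell_id_left:
  assumes "is_butterfly X X' E"
  obtains m where "comp_cell X X X' (id_bfly X) E E m"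
proof -
  have "precomp_bfly (\<lambda>g. g) E = E" by (simp add: precomp_bfly_def)
  with comp_cell_precomp[OF strict_morphism_id refl assms] that show ?thesis
    using assms by (simp add: id_bfly_def is_butterfly_def)
qed

lemma comp_cell_id_right:
  assumes "is_butterfly X X' E"
  obtains m where "comp_cell X X' X' E (id_bfly X') E m"
proof -
  have "postcomp_bfly (\<lambda>x. x) E = E" by (simp add: postcomp_bfly_def)
  with comp_cell_postcomp[OF strict_morphism_id refl assms] that show ?thesis
    using assms by (simp add: id_bfly_def is_butterfly_def)
qed

lemma bfly_class_in_bext_hom:
  assumes "is_butterfly X X' E"
  shows "bfly_class X X' E \<in> bext_hom X X'"
proof -
  obtain F where "is_butterfly X X' F" "bfly_iso X X' E F" "F \<in> bfly_class X X' E"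
    using bfly_class_nonempty[OF assms] by (auto simp: bfly_class_def)
  with assms show ?thesis
    unfolding bext_hom_def using bfly_class_eq_iff by blast
qed

lemma bext_homE:
  assumes "\<E> \<in> bext_hom X X'"
  obtains E where "E \<in> \<E>" "is_butterfly X X' E" "\<E> = bfly_class X X' E"
proof -
  have "E \<in> bfly_class X X' E" if "is_butterfly X X' E" for E
    using two_cell_imp_bfly_iso[OF that that two_cell_id] that by (simp add: bfly_class_def)
  with assms that show ?thesis by (auto simp: bext_hom_def)
qed

text \<open>\<open>bext_comp\<close> collects the composites of all representatives; they agree by
  \<open>comp_cell_imp_bfly_iso\<close>, so any cell may be used to compute a composite of classes.
  From here on \<open>bfly_comp\<close> serves only to show that some composite exists.\<close>

lemma bext_comp_bfly_class:
  assumes "comp_cell X X' X'' E E' G m"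
  shows "bext_comp X X' X'' (bfly_class X X' E) (bfly_class X' X'' E') = bfly_class X X'' G"
proof -
  interpret comp_cell X X' X'' E E' G m by fact
  have "bfly_class X X'' (bfly_comp X' F F') = bfly_class X X'' G"
    if F: "F \<in> bfly_class X X' E" "F' \<in> bfly_class X' X'' E'" for F F'
  proof -
    obtain f where f: "two_cell X X' E F f" using F by (auto simp: bfly_class_def bfly_iso_def)
    obtain f' where f': "two_cell X' X'' E' F' f'" using F by (auto simp: bfly_class_def bfly_iso_def)
    have bf: "is_butterfly X X' F" "is_butterfly X' X'' F'" using F by (auto simp: bfly_class_def)
    then obtain n where "comp_cell X X' X'' F F' (bfly_comp X' F F') n" by (rule comp_cell_bfly_comp)
    then have "bfly_iso X X'' G (bfly_comp X' F F')"
      using comp_cell_imp_bfly_iso[OF assms _ f f'] by metis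
    then show ?thesis
      using bfly_class_eq_iff[OF G.is_butterfly_axioms is_butterfly_bfly_comp[OF bf]] by metis
  qed
  then have "(\<lambda>(E, E'). bfly_class X X'' (bfly_comp X' E E')) ` (bfly_class X X' E \<times> bfly_class X' X'' E') =
      {bfly_class X X'' G}"
    using bfly_class_nonempty[OF E.is_butterfly_axioms] bfly_class_nonempty[OF E'.is_butterfly_axioms]
    by fast
  then show ?thesis by (simp add: bext_comp_def)
qed

lemma bext_comp_assoc:
  assumes "\<E> \<in> bext_hom X X'" "\<F> \<in> bext_hom X' X''" "\<G> \<in> bext_hom X'' X'''"
  shows "bext_comp X X'' X''' (bext_comp X X' X'' \<E> \<F>) \<G> = bext_comp X X' X''' \<E> (bext_comp X' X'' X''' \<F> \<G>)"
proof -
  obtain E where E: "E \<in> \<E>" "is_butterfly X X' E" "\<E> = bfly_class X X' E"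
    using assms(1) by (rule bext_homE)
  obtain F where F: "F \<in> \<F>" "is_butterfly X' X'' F" "\<F> = bfly_class X' X'' F"
    using assms(2) by (rule bext_homE)
  obtain G where G: "G \<in> \<G>" "is_butterfly X'' X''' G" "\<G> = bfly_class X'' X''' G"
    using assms(3) by (rule bext_homE)
  note * = E(2,3) F(2,3) G(2,3)
  let ?EF = "bfly_comp X' E F" and ?FG = "bfly_comp X'' F G"
  have EF: "is_butterfly X X'' ?EF" and FG: "is_butterfly X' X''' ?FG"
    using * is_butterfly_bfly_comp by blast+
  obtain m1 where m1: "comp_cell X X' X'' E F ?EF m1" using * comp_cell_bfly_comp by metis
  obtain m2 where m2: "comp_cell X X'' X''' ?EF G (bfly_comp X'' ?EF G) m2"
    using * EF comp_cell_bfly_comp by metis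
  obtain m3 where m3: "comp_cell X' X'' X''' F G ?FG m3" using * comp_cell_bfly_comp by metis
  obtain m4 where m4: "comp_cell X X' X''' E ?FG (bfly_comp X' E ?FG) m4"
    using * FG comp_cell_bfly_comp by metis
  have "bfly_iso X X''' (bfly_comp X'' ?EF G) (bfly_comp X' E ?FG)"
    using comp_cell_assoc[OF m1 m2 m3 m4] .
  then have "bfly_class X X''' (bfly_comp X'' ?EF G) = bfly_class X X''' (bfly_comp X' E ?FG)"
    using bfly_class_eq_iff[OF is_butterfly_bfly_comp[OF EF G(2)] is_butterfly_bfly_comp[OF E(2) FG]] by simp
  then show ?thesis
    using * by (simp add: bext_comp_bfly_class[OF m1] bext_comp_bfly_class[OF m2]
      bext_comp_bfly_class[OF m3] bext_comp_bfly_class[OF m4])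
qed

lemma
  assumes "\<E> \<in> bext_hom X X'"
  shows bext_comp_id_left: "bext_comp X X X' (bext_id X) \<E> = \<E>"
    and bext_comp_id_right: "bext_comp X X' X' \<E> (bext_id X') = \<E>"
proof -
  obtain E where "E \<in> \<E>" and E: "is_butterfly X X' E" "\<E> = bfly_class X X' E"
    using assms by (rule bext_homE)
  show "bext_comp X X X' (bext_id X) \<E> = \<E>"
    using comp_cell_id_left[OF E(1)] bext_comp_bfly_class unfolding E(2) bext_id_def by metis
  show "bext_comp X X' X' \<E> (bext_id X') = \<E>"
    using comp_cell_id_right[OF E(1)] bext_comp_bfly_class unfolding E(2) bext_id_def by metis
qed

section \<open>The functor P on representatives and its fibres\<close>

definition bfly_over ::
  "('h2, 'h1, 'b, 'c) crossed_ext \<Rightarrow> ('g2, 'g1, 'd, 'k) crossed_ext \<Rightarrow>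
   ('e, 'h2, 'h1, 'g2, 'g1) butterfly \<Rightarrow> ('c \<Rightarrow> 'k) \<Rightarrow> ('b \<Rightarrow> 'd) \<Rightarrow> bool" where
  "bfly_over X X' E \<phi>0 \<phi> \<longleftrightarrow>
    (\<forall>e\<in>carrier (wgrp E). \<phi>0 (coker_map X (delta E e)) = coker_map X' (gamma E e)) \<and>
    (\<forall>b\<in>carrier (ker_grp X). \<phi> b \<in> carrier (ker_grp X') \<and>
       kappa E (ker_map X b) \<otimes>\<^bsub>wgrp E\<^esub> iota E (ker_map X' (\<phi> b)) = \<one>\<^bsub>wgrp E\<^esub>)"

locale extension_butterfly =
  is_butterfly X X' E + X: crossed_extension X + X': crossed_extension X'
  for X :: "('h2, 'h1, 'b, 'c) crossed_ext" and X' :: "('g2, 'g1, 'd, 'k) crossed_ext"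
    and E :: "('e, 'h2, 'h1, 'g2, 'g1) butterfly"
begin

text \<open>Elements \<open>e\<close> and \<open>f\<close> over the same cokernel element differ by
  factors \<open>kappa E h\<close> and \<open>iota E g\<close>; \<open>gamma\<close> kills the first
  and sends the second to a boundary. This makes the cokernel component of \<open>bfly_mod\<close>
  well defined.\<close>

lemma coker_map_gamma_cong:
  assumes "e \<in> carrier (wgrp E)" "f \<in> carrier (wgrp E)" "coker_map X (delta E e) = coker_map X (delta E f)"
  shows "coker_map X' (gamma E e) = coker_map X' (gamma E f)"
proof -
  obtain h where h: "h \<in> carrier (grp2 X)" "delta E e = bdry X h \<otimes>\<^bsub>grp1 X\<^esub> delta E f"
    using X.coker_map_eqE assms by (metis delta.hom_closed)
  then have "delta E e = delta E (kappa E h \<otimes>\<^bsub>wgrp E\<^esub> f)" using assms by simp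
  then obtain g where "g \<in> carrier (grp2 X')" "e = (kappa E h \<otimes>\<^bsub>wgrp E\<^esub> f) \<otimes>\<^bsub>wgrp E\<^esub> iota E g"
    using delta_eqE assms h by (metis W.m_closed kappa.hom_closed)
  with assms h show ?thesis by simp
qed

text \<open>\<open>kappa E (ker_map X b)\<close> is killed by \<open>delta\<close>, so it is some
  \<open>iota E g\<close>, and by \<open>gamma\<close>, so \<open>bdry X' g\<close> is
  trivial.\<close>

lemma kappa_ker_mapE:
  assumes "b \<in> carrier (ker_grp X)"
  obtains b' where "b' \<in> carrier (ker_grp X')"
    "kappa E (ker_map X b) \<otimes>\<^bsub>wgrp E\<^esub> iota E (ker_map X' b') = \<one>\<^bsub>wgrp E\<^esub>"
proof -
  obtain g where g: "g \<in> carrier (grp2 X')" "kappa E (ker_map X b) = iota E g"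
    using ker_deltaE[of "kappa E (ker_map X b)"] assms by auto
  then have "bdry X' g = \<one>\<^bsub>grp1 X'\<^esub>" using assms by (metis gamma_iota gamma_kappa X.ker.hom_closed)
  then obtain b' where "b' \<in> carrier (ker_grp X')" "g = ker_map X' b'"
    using X'.ker_bdryE[of g] g assms by auto
  with g that[of "inv\<^bsub>ker_grp X'\<^esub> b'"] show ?thesis by simp
qed

lemma bfly_mod_eqI:
  assumes "bfly_over X X' E \<phi>0 \<phi>"
    and "\<phi>0 \<in> extensional (carrier (coker_grp X))" "\<phi> \<in> extensional (carrier (ker_grp X))"
  shows "bfly_mod X X' E = (\<phi>0, \<phi>)"
proof -
  have "(THE c'. \<exists>e\<in>carrier (wgrp E). coker_map X (delta E e) = c \<and> coker_map X' (gamma E e) = c') = \<phi>0 c"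
    if "c \<in> carrier (coker_grp X)" for c
  proof -
    obtain x where "x \<in> carrier (grp1 X)" "c = coker_map X x" using X.coker_map_surjE \<open>c \<in> _\<close> by metis
    then obtain e where "e \<in> carrier (wgrp E)" "c = coker_map X (delta E e)" using delta_surjE by metis
    with assms(1) show ?thesis
      by (intro the_equality) (auto simp: bfly_over_def intro: coker_map_gamma_cong)
  qed
  moreover have "(THE b'. b' \<in> carrier (ker_grp X') \<and>
      kappa E (ker_map X b) \<otimes>\<^bsub>wgrp E\<^esub> iota E (ker_map X' b') = \<one>\<^bsub>wgrp E\<^esub>) = \<phi> b"
    if b: "b \<in> carrier (ker_grp X)" for b
  proof (rule the_equality)
    show *: "\<phi> b \<in> carrier (ker_grp X') \<and> kappa E (ker_map X b) \<otimes>\<^bsub>wgrp E\<^esub> iota E (ker_map X' (\<phi> b)) = \<one>\<^bsub>wgrp E\<^esub>"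
      using assms(1) b by (simp add: bfly_over_def)
    fix b' assume b': "b' \<in> carrier (ker_grp X') \<and>
      kappa E (ker_map X b) \<otimes>\<^bsub>wgrp E\<^esub> iota E (ker_map X' b') = \<one>\<^bsub>wgrp E\<^esub>"
    have "iota E (ker_map X' b'') = inv\<^bsub>wgrp E\<^esub> kappa E (ker_map X b)" if "b'' \<in> carrier (ker_grp X') \<and>
      kappa E (ker_map X b) \<otimes>\<^bsub>wgrp E\<^esub> iota E (ker_map X' b'') = \<one>\<^bsub>wgrp E\<^esub>" for b''
      using that b by (intro W.inv_eq_of_mult_eq_one(2)) simp_all
    from this[OF *] this[OF b'] have "iota E (ker_map X' b') = iota E (ker_map X' (\<phi> b))" by simp
    with * b' show "b' = \<phi> b" by simp
  qed
  ultimately show ?thesis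
    using assms(2,3) by (auto simp: bfly_mod_def fun_eq_iff extensional_def restrict_def)
qed

text \<open>Every butterfly lies over some pair of maps, and over only one extensional pair, so the
  definite descriptions may be traded for \<open>bfly_over\<close>. The latter ignores values off
  the carriers, which lets the identity be written as \<open>\<lambda>c. c\<close>.\<close>

lemma bfly_mod_iff:
  assumes "\<phi>0 \<in> extensional (carrier (coker_grp X))" "\<phi> \<in> extensional (carrier (ker_grp X))"
  shows "bfly_mod X X' E = (\<phi>0, \<phi>) \<longleftrightarrow> bfly_over X X' E \<phi>0 \<phi>"
proof -
  define \<psi>0 where "\<psi>0 = (\<lambda>c\<in>carrier (coker_grp X).
    coker_map X' (gamma E (SOME e. e \<in> carrier (wgrp E) \<and> coker_map X (delta E e) = c)))"
  define \<psi> where "\<psi> = (\<lambda>b\<in>carrier (ker_grp X). SOME b'. b' \<in> carrier (ker_grp X') \<and>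
    kappa E (ker_map X b) \<otimes>\<^bsub>wgrp E\<^esub> iota E (ker_map X' b') = \<one>\<^bsub>wgrp E\<^esub>)"
  have "\<psi>0 (coker_map X (delta E e)) = coker_map X' (gamma E e)" if e: "e \<in> carrier (wgrp E)" for e
  proof -
    let ?P = "\<lambda>f. f \<in> carrier (wgrp E) \<and> coker_map X (delta E f) = coker_map X (delta E e)"
    have "?P (SOME f. ?P f)" by (rule someI[where x = e]) (simp add: e)
    then have "coker_map X' (gamma E (SOME f. ?P f)) = coker_map X' (gamma E e)"
      using e by (intro coker_map_gamma_cong) auto
    with e show ?thesis by (simp add: \<psi>0_def)
  qed
  moreover have "\<psi> b \<in> carrier (ker_grp X') \<and> kappa E (ker_map X b) \<otimes>\<^bsub>wgrp E\<^esub> iota E (ker_map X' (\<psi> b)) = \<one>\<^bsub>wgrp E\<^esub>"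
    if b: "b \<in> carrier (ker_grp X)" for b
    using kappa_ker_mapE[OF b] b unfolding \<psi>_def by simp (rule someI_ex, metis)
  ultimately have over: "bfly_over X X' E \<psi>0 \<psi>" by (simp add: bfly_over_def)
  then have "bfly_mod X X' E = (\<psi>0, \<psi>)" by (rule bfly_mod_eqI) (simp_all add: \<psi>0_def \<psi>_def)
  with over bfly_mod_eqI[OF _ assms] show ?thesis by auto
qed

end

lemma bfly_mod_cong:
  assumes X: "crossed_extension X" "crossed_extension X'"
    and E: "is_butterfly X X' E" "is_butterfly X X' F" "bfly_iso X X' E F"
  shows "bfly_mod X X' E = bfly_mod X X' F"
proof -
  obtain f where f: "two_cell X X' E F f" and iso: "f \<in> iso (wgrp E) (wgrp F)"
    using E(3) by (auto simp: bfly_iso_def)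
  interpret E: extension_butterfly X X' E using X E by (simp add: extension_butterfly_def)
  interpret F: extension_butterfly X X' F using X E by (simp add: extension_butterfly_def)
  interpret f: group_hom "wgrp E" "wgrp F" f
    using f by (simp add: group_hom_def group_hom_axioms_def E.W.group_axioms F.W.group_axioms two_cell_def)
  have carr: "carrier (wgrp F) = f ` carrier (wgrp E)" using iso by (auto simp: iso_def bij_betw_def)
  obtain \<phi>0 \<phi> where \<phi>: "bfly_mod X X' E = (\<phi>0, \<phi>)"
    "\<phi>0 \<in> extensional (carrier (coker_grp X))" "\<phi> \<in> extensional (carrier (ker_grp X))"
    by (simp add: bfly_mod_def)
  then have over: "bfly_over X X' E \<phi>0 \<phi>" by (simp add: E.bfly_mod_iff)
  have "kappa F (ker_map X b) \<otimes>\<^bsub>wgrp F\<^esub> iota F (ker_map X' (\<phi> b)) = \<one>\<^bsub>wgrp F\<^esub>"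
    if "b \<in> carrier (ker_grp X)" for b
  proof -
    have b: "\<phi> b \<in> carrier (ker_grp X')"
      "kappa E (ker_map X b) \<otimes>\<^bsub>wgrp E\<^esub> iota E (ker_map X' (\<phi> b)) = \<one>\<^bsub>wgrp E\<^esub>"
      using over that by (simp_all add: bfly_over_def)
    have "kappa F (ker_map X b) \<otimes>\<^bsub>wgrp F\<^esub> iota F (ker_map X' (\<phi> b)) =
        f (kappa E (ker_map X b) \<otimes>\<^bsub>wgrp E\<^esub> iota E (ker_map X' (\<phi> b)))"
      using f that b(1) by (simp add: two_cell_def)
    also have "\<dots> = \<one>\<^bsub>wgrp F\<^esub>" unfolding b(2) by (rule f.hom_one)
    finally show ?thesis .
  qed
  then have "bfly_over X X' F \<phi>0 \<phi>"
    using over f by (auto simp: bfly_over_def carr two_cell_def)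
  with \<phi> show ?thesis using F.bfly_mod_eqI by simp
qed

lemma bext_P_bfly_class:
  assumes "crossed_extension X" "crossed_extension X'" "is_butterfly X X' E"
  shows "bext_P X X' (bfly_class X X' E) = bfly_mod X X' E"
proof -
  have "bfly_mod X X' ` bfly_class X X' E = {bfly_mod X X' E}"
  proof -
    have "bfly_mod X X' F = bfly_mod X X' E" if "F \<in> bfly_class X X' E" for F
      using that bfly_mod_cong[OF assms, of F] by (simp add: bfly_class_def)
    then have "bfly_mod X X' ` bfly_class X X' E = (\<lambda>_. bfly_mod X X' E) ` bfly_class X X' E"
      by (intro image_cong) simp_all
    with bfly_class_nonempty[OF assms(3)] show ?thesis by (simp add: image_constant_conv)
  qed
  then show ?thesis by (simp add: bext_P_def)
qed

lemma bfly_class_in_bext_hom_over_iff: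
  assumes "crossed_extension X" "crossed_extension X'" "is_butterfly X X' E"
    and "\<phi>0 \<in> extensional (carrier (coker_grp X))" "\<phi> \<in> extensional (carrier (ker_grp X))"
  shows "bfly_class X X' E \<in> bext_hom_over X X' (\<phi>0, \<phi>) \<longleftrightarrow> bfly_over X X' E \<phi>0 \<phi>"
proof -
  interpret extension_butterfly X X' E using assms by (simp add: extension_butterfly_def)
  show ?thesis
    using assms by (simp add: bext_hom_over_def bfly_class_in_bext_hom bext_P_bfly_class bfly_mod_iff)
qed

lemma bfly_class_in_fibre_hom_iff:
  assumes "crossed_extension X" "crossed_extension X'" "\<Pi>\<^sub>m X = M" "\<Pi>\<^sub>m X' = M" "is_butterfly X X' E"
  shows "bfly_class X X' E \<in> fibre_hom M X X' \<longleftrightarrow> bfly_over X X' E (\<lambda>c. c) (\<lambda>b. b)"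
proof -
  interpret extension_butterfly X X' E using assms by (simp add: extension_butterfly_def)
  have "bfly_class X X' E \<in> fibre_hom M X X' \<longleftrightarrow>
      bfly_over X X' E (\<lambda>c\<in>carrier (coker_grp X). c) (\<lambda>b\<in>carrier (ker_grp X). b)"
    using assms(3,4) by (auto simp: fibre_hom_def mod_id_def
      bfly_class_in_bext_hom_over_iff[OF assms(1,2,5)])
  also have "\<dots> \<longleftrightarrow> bfly_over X X' E (\<lambda>c. c) (\<lambda>b. b)"
    by (simp add: bfly_over_def)
  finally show ?thesis .
qed

lemma fibre_homE:
  assumes "crossed_extension X" "crossed_extension X'" "\<E> \<in> fibre_hom M X X'"
  obtains E where "E \<in> \<E>" "is_butterfly X X' E" "bfly_over X X' E (\<lambda>c. c) (\<lambda>b. b)" "\<E> = bfly_class X X' E"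
    "\<Pi>\<^sub>m X = M" "\<Pi>\<^sub>m X' = M"
proof -
  have "\<E> \<in> bext_hom X X'" "\<Pi>\<^sub>m X = M" "\<Pi>\<^sub>m X' = M"
    using assms(3) by (auto simp: fibre_hom_def bext_hom_over_def)
  moreover from this obtain E where E: "E \<in> \<E>" "is_butterfly X X' E" "\<E> = bfly_class X X' E"
    by (metis bext_homE)
  ultimately show ?thesis
    using that[OF E(1,2) _ E(3)] bfly_class_in_fibre_hom_iff[OF assms(1,2) _ _ E(2)] assms(3) by metis
qed

lemma fibre_hom_subset: "\<E> \<in> fibre_hom M X X' \<Longrightarrow> \<E> \<in> bext_hom X X'"
  by (simp add: fibre_hom_def bext_hom_over_def)

lemma bext_id_in_fibre_hom:
  assumes "crossed_extension X"
  shows "bext_id X \<in> fibre_hom (\<Pi>\<^sub>m X) X X"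
proof -
  interpret X: crossed_extension X by fact
  have "bfly_over X X (id_bfly X) (\<lambda>c. c) (\<lambda>b. b)"
    by (auto simp: bfly_over_def id_bfly_simps[OF X.crossed_module_axioms])
  then show ?thesis
    unfolding bext_id_def
    using bfly_class_in_fibre_hom_iff[OF assms assms refl refl is_butterfly_id_bfly] X.crossed_module_axioms
    by simp
qed

lemma fibre_comp_closed:
  assumes X: "crossed_extension X" "crossed_extension X'" "crossed_extension X''"
    and \<E>: "\<E> \<in> fibre_hom M X X'" and \<F>: "\<F> \<in> fibre_hom M X' X''"
  shows "bext_comp X X' X'' \<E> \<F> \<in> fibre_hom M X X''"
proof -
  obtain E where "E \<in> \<E>" and E: "is_butterfly X X' E" "bfly_over X X' E (\<lambda>c. c) (\<lambda>b. b)" "\<E> = bfly_class X X' E"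
    "\<Pi>\<^sub>m X = M" "\<Pi>\<^sub>m X' = M"
    using fibre_homE[OF X(1,2) \<E>] .
  obtain F where "F \<in> \<F>" and F: "is_butterfly X' X'' F" "bfly_over X' X'' F (\<lambda>c. c) (\<lambda>b. b)" "\<F> = bfly_class X' X'' F"
    "\<Pi>\<^sub>m X' = M" "\<Pi>\<^sub>m X'' = M"
    using fibre_homE[OF X(2,3) \<F>] .
  let ?G = "bfly_comp X' E F"
  obtain m where m: "comp_cell X X' X'' E F ?G m" using comp_cell_bfly_comp E F by metis
  interpret comp_cell X X' X'' E F ?G m by fact
  interpret X: crossed_extension X by fact
  interpret X': crossed_extension X' by fact
  interpret X'': crossed_extension X'' by fact
  have B: "ker_grp X' = ker_grp X" "ker_grp X'' = ker_grp X"
    using E(4,5) F(4,5) X.ext_module_simps(2) X'.ext_module_simps(2) X''.ext_module_simps(2) by metis+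
  have "bfly_over X X'' ?G (\<lambda>c. c) (\<lambda>b. b)"
    unfolding bfly_over_def
  proof (intro conjI ballI)
    fix x assume "x \<in> carrier (wgrp ?G)"
    then obtain e f where "e \<in> carrier (wgrp E)" "f \<in> carrier (wgrp F)" "gamma E e = delta F f" "x = m e f"
      by (rule cell_surjE)
    then show "coker_map X (delta ?G x) = coker_map X'' (gamma ?G x)"
      using E(2) F(2) by (simp add: bfly_over_def delta_cell gamma_cell)
  next
    fix b assume b: "b \<in> carrier (ker_grp X)"
    then show "b \<in> carrier (ker_grp X'')" by (simp add: B)
    \<comment> \<open>Over identities \<open>kappa E (ker_map X b)\<close> and
      \<open>iota F (ker_map X'' b)\<close> come from the same element of the middle crossed module,
      so they form an antidiagonal pair.\<close>
    let ?g = "inv\<^bsub>grp2 X'\<^esub> ker_map X' b"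
    have kb: "ker_map X b \<in> carrier (grp2 X)" "ker_map X' b \<in> carrier (grp2 X')" "ker_map X'' b \<in> carrier (grp2 X'')"
      using b X.ker.hom_closed X'.ker.hom_closed X''.ker.hom_closed by (simp_all add: B)
    have 1: "kappa E (ker_map X b) \<otimes>\<^bsub>wgrp E\<^esub> iota E (ker_map X' b) = \<one>\<^bsub>wgrp E\<^esub>"
      "kappa F (ker_map X' b) \<otimes>\<^bsub>wgrp F\<^esub> iota F (ker_map X'' b) = \<one>\<^bsub>wgrp F\<^esub>"
      using b E(2) F(2) by (simp_all add: bfly_over_def B)
    have eq: "kappa E (ker_map X b) = iota E ?g" "iota F (ker_map X'' b) = kappa F ?g"
      using E.W.inv_eq_of_mult_eq_one(1)[OF 1(1)] E'.W.inv_eq_of_mult_eq_one(2)[OF 1(2)] kb by simp_all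
    have "gamma E (kappa E (ker_map X b)) = delta F \<one>\<^bsub>wgrp F\<^esub>" "gamma E \<one>\<^bsub>wgrp E\<^esub> = delta F (iota F (ker_map X'' b))"
      using kb by simp_all
    then have "kappa ?G (ker_map X b) \<otimes>\<^bsub>wgrp ?G\<^esub> iota ?G (ker_map X'' b) = m (kappa E (ker_map X b)) (iota F (ker_map X'' b))"
      using kb cell_mult[of "kappa E (ker_map X b)" "\<one>\<^bsub>wgrp F\<^esub>" "\<one>\<^bsub>wgrp E\<^esub>" "iota F (ker_map X'' b)"]
      by (simp add: cell_kappa cell_iota)
    also have "\<dots> = \<one>\<^bsub>wgrp ?G\<^esub>"
      unfolding eq using kb by (intro cell_antidiag) simp
    finally show "kappa ?G (ker_map X b) \<otimes>\<^bsub>wgrp ?G\<^esub> iota ?G (ker_map X'' b) = \<one>\<^bsub>wgrp ?G\<^esub>" .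
  qed
  then show ?thesis
    unfolding E(3) F(3) bext_comp_bfly_class[OF m]
    using bfly_class_in_fibre_hom_iff[OF X(1,3) E(4) F(5) G.is_butterfly_axioms] by simp
qed

section \<open>Exchange of the wings and inverses in a fibre\<close>

definition flip_bfly :: "('e, 'h2, 'h1, 'g2, 'g1) butterfly \<Rightarrow> ('e, 'g2, 'g1, 'h2, 'h1) butterfly" where
  "flip_bfly E = \<lparr>wgrp = wgrp E, kappa = iota E, iota = kappa E, delta = gamma E, gamma = delta E\<rparr>"

lemma flip_bfly_simps [simp]:
  "wgrp (flip_bfly E) = wgrp E" "kappa (flip_bfly E) = iota E" "iota (flip_bfly E) = kappa E"
  "delta (flip_bfly E) = gamma E" "gamma (flip_bfly E) = delta E" "flip_bfly (flip_bfly E) = E"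
  by (simp_all add: flip_bfly_def)

text \<open>In general \<open>kappa\<close> need not be injective, nor \<open>gamma\<close>
  surjective; lying over an identity supplies both, and exactness between them. The composite of
  \<open>E\<close> with its exchange consists of pairs with equal \<open>gamma\<close> modulo the
  diagonal of \<open>iota\<close>. Such a pair is recorded by \<open>delta E e\<close> and by the
  element of \<open>grp2 X\<close> that \<open>kappa\<close> sends to
  \<open>e' * inv e\<close>.\<close>

lemma
  assumes X: "crossed_extension X" "crossed_extension X'" "\<Pi>\<^sub>m X = \<Pi>\<^sub>m X'"
    and E: "is_butterfly X X' E" "bfly_over X X' E (\<lambda>c. c) (\<lambda>b. b)"
  shows is_butterfly_flip: "is_butterfly X' X (flip_bfly E)"
    and bfly_over_flip: "bfly_over X' X (flip_bfly E) (\<lambda>c. c) (\<lambda>b. b)"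
    and comp_cell_flip: "\<exists>m. comp_cell X X' X E (flip_bfly E) (id_bfly X) m"
proof -
  interpret E: extension_butterfly X X' E using X E by (simp add: extension_butterfly_def)
  have BC: "ker_grp X' = ker_grp X" "coker_grp X' = coker_grp X"
    using X(3) E.X.ext_module_simps E.X'.ext_module_simps by metis+
  have over: "kappa E (ker_map X b) \<otimes>\<^bsub>wgrp E\<^esub> iota E (ker_map X' b) = \<one>\<^bsub>wgrp E\<^esub>"
    if "b \<in> carrier (ker_grp X)" for b
    using E(2) that by (simp add: bfly_over_def)
  have coker: "coker_map X (delta E e) = coker_map X' (gamma E e)" if "e \<in> carrier (wgrp E)" for e
    using E(2) that by (simp add: bfly_over_def)
  have ker_closed: "ker_map X' b \<in> carrier (grp2 X')" if "b \<in> carrier (ker_grp X)" for b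
    using that E.X'.ker.hom_closed[of b] by (simp add: BC)
  have kappa_inj: "h = \<one>\<^bsub>grp2 X\<^esub>" if h: "h \<in> carrier (grp2 X)" "kappa E h = \<one>\<^bsub>wgrp E\<^esub>" for h
  proof -
    have "bdry X h = \<one>\<^bsub>grp1 X\<^esub>" using h E.delta_kappa[of h] by simp
    then obtain b where b: "b \<in> carrier (ker_grp X)" "h = ker_map X b" using E.X.ker_bdryE h by metis
    have "iota E (ker_map X' b) = \<one>\<^bsub>wgrp E\<^esub>" using over[OF b(1)] h b ker_closed by simp
    then have "ker_map X' b = ker_map X' \<one>\<^bsub>ker_grp X'\<^esub>" using b ker_closed by simp
    then have "b = \<one>\<^bsub>ker_grp X\<^esub>" using b E.X'.ker_map_eq_iff[of b "\<one>\<^bsub>ker_grp X'\<^esub>"] by (simp add: BC)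
    with b show ?thesis by simp
  qed
  \<comment> \<open>Split off a factor \<open>kappa E h\<close> from \<open>e\<close> so that only
    some \<open>iota E (ker_map X' b)\<close> is left; over an identity this again lies in the image
    of \<open>kappa\<close>.\<close>
  have ker_gamma: "\<exists>h\<in>carrier (grp2 X). e = kappa E h"
    if e: "e \<in> carrier (wgrp E)" "gamma E e = \<one>\<^bsub>grp1 X'\<^esub>" for e
  proof -
    have "coker_map X (delta E e) = \<one>\<^bsub>coker_grp X\<^esub>" using e coker[of e] by (simp add: BC)
    then obtain h where h: "h \<in> carrier (grp2 X)" "delta E e = bdry X h"
      using E.X.ker_coker_mapE e E.delta.hom_closed by metis
    then obtain g where g: "g \<in> carrier (grp2 X')" "e = kappa E h \<otimes>\<^bsub>wgrp E\<^esub> iota E g"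
      using E.delta_eqE[of e "kappa E h"] e by auto
    then have "bdry X' g = \<one>\<^bsub>grp1 X'\<^esub>" using e h by simp
    then obtain b where b: "b \<in> carrier (ker_grp X)" "g = ker_map X' b"
      using E.X'.ker_bdryE g by (metis BC(1))
    have "iota E (ker_map X' b) = kappa E (inv\<^bsub>grp2 X\<^esub> ker_map X b)"
      using E.W.inv_eq_of_mult_eq_one(2)[OF over[OF b(1)]] b ker_closed by simp
    with g b have "e = kappa E (h \<otimes>\<^bsub>grp2 X\<^esub> inv\<^bsub>grp2 X\<^esub> ker_map X b)" using h by simp
    moreover have "h \<otimes>\<^bsub>grp2 X\<^esub> inv\<^bsub>grp2 X\<^esub> ker_map X b \<in> carrier (grp2 X)" using h b by simp
    ultimately show ?thesis by blast
  qed
  have gamma_surj: "\<exists>e\<in>carrier (wgrp E). gamma E e = x" if x: "x \<in> carrier (grp1 X')" for x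
  proof -
    obtain y where y: "y \<in> carrier (grp1 X)" "coker_map X' x = coker_map X y"
      using E.X.coker_map_surjE x E.X'.coker.hom_closed by (metis BC(2))
    then obtain e where e: "e \<in> carrier (wgrp E)" "delta E e = y" using E.delta_surjE by metis
    with y coker have "coker_map X' x = coker_map X' (gamma E e)" by metis
    then obtain g where "g \<in> carrier (grp2 X')" "x = bdry X' g \<otimes>\<^bsub>grp1 X'\<^esub> gamma E e"
      using E.X'.coker_map_eqE x e E.gamma.hom_closed by metis
    with e show ?thesis by (intro bexI[of _ "iota E g \<otimes>\<^bsub>wgrp E\<^esub> e"]) simp_all
  qed
  show flip: "is_butterfly X' X (flip_bfly E)"
    by (rule is_butterflyI) (use kappa_inj ker_gamma gamma_surj E.kappa_hom E.iota_hom E.delta_hom E.gamma_hom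
       E.is_butterfly_axioms in \<open>auto simp: is_butterfly_def E.conj_kappa E.conj_iota\<close>)
  show "bfly_over X' X (flip_bfly E) (\<lambda>c. c) (\<lambda>b. b)"
    using over coker ker_closed E.kappa_iota_commute by (auto simp: bfly_over_def BC)
  interpret F: is_butterfly X' X "flip_bfly E" by (rule flip)
  interpret I: is_butterfly X X "id_bfly X" by (rule is_butterfly_id_bfly) (rule E.X.crossed_module_axioms)
  note id_simps = id_bfly_simps[OF E.X.crossed_module_axioms]
  \<comment> \<open>The inverse of \<open>kappa\<close> on the kernel of
    \<open>gamma\<close>.\<close>
  define k where "k e = (SOME h. h \<in> carrier (grp2 X) \<and> kappa E h = e)" for e
  have k: "k e \<in> carrier (grp2 X)" "kappa E (k e) = e" if "e \<in> carrier (wgrp E)" "gamma E e = \<one>\<^bsub>grp1 X'\<^esub>" for e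
    using someI_ex[of "\<lambda>h. h \<in> carrier (grp2 X) \<and> kappa E h = e"] ker_gamma[OF that] by (auto simp: k_def)
  have kappa_eqD: "h = h'" if "kappa E h = kappa E h'" "h \<in> carrier (grp2 X)" "h' \<in> carrier (grp2 X)" for h h'
    using E.kappa.inj_on_one_iff kappa_inj that by (metis inj_onD)
  \<comment> \<open>The order in \<open>e' * inv e\<close> is dictated by the identity butterfly:
    \<open>m (kappa E h) 1\<close> has to be \<open>(inv h, bdry X h)\<close>.\<close>
  define m where "m e e' = (k (e' \<otimes>\<^bsub>wgrp E\<^esub> inv\<^bsub>wgrp E\<^esub> e), delta E e)" for e e'
  have kk: "k (e' \<otimes>\<^bsub>wgrp E\<^esub> inv\<^bsub>wgrp E\<^esub> e) \<in> carrier (grp2 X)"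
    "kappa E (k (e' \<otimes>\<^bsub>wgrp E\<^esub> inv\<^bsub>wgrp E\<^esub> e)) = e' \<otimes>\<^bsub>wgrp E\<^esub> inv\<^bsub>wgrp E\<^esub> e"
    if "e \<in> carrier (wgrp E)" "e' \<in> carrier (wgrp E)" "gamma E e = gamma E e'" for e e'
    using that by (auto intro!: k)
  have k_kappa: "k (kappa E h) = h" if "h \<in> carrier (grp2 X)" for h
    using that by (intro kappa_eqD k) simp_all
  have "comp_cell X X' X E (flip_bfly E) (id_bfly X) m"
  proof unfold_locales
    fix e e' assume "e \<in> carrier (wgrp E)" "e' \<in> carrier (wgrp (flip_bfly E))" "gamma E e = delta (flip_bfly E) e'"
    then have e: "e \<in> carrier (wgrp E)" "e' \<in> carrier (wgrp E)" "gamma E e = gamma E e'" by simp_all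
    show "m e e' \<in> carrier (wgrp (id_bfly X))" using e kk by (simp add: m_def id_simps)
    show "delta (id_bfly X) (m e e') = delta E e" by (simp add: m_def id_simps)
    have "bdry X (k (e' \<otimes>\<^bsub>wgrp E\<^esub> inv\<^bsub>wgrp E\<^esub> e)) = delta E (e' \<otimes>\<^bsub>wgrp E\<^esub> inv\<^bsub>wgrp E\<^esub> e)"
      using E.delta_kappa[OF kk(1)[OF e]] kk(2)[OF e] by simp
    then show "gamma (id_bfly X) (m e e') = gamma (flip_bfly E) e'"
      using e by (simp add: m_def id_simps E.X.G1.m_assoc)
    fix a a' assume "a \<in> carrier (wgrp E)" "a' \<in> carrier (wgrp (flip_bfly E))" "gamma E a = delta (flip_bfly E) a'"
    then have a: "a \<in> carrier (wgrp E)" "a' \<in> carrier (wgrp E)" "gamma E a = gamma E a'" by simp_all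
    \<comment> \<open>The argument of \<open>k\<close> on the left is \<open>e' * inv e\<close>
      times the conjugate of \<open>a' * inv a\<close> by \<open>e\<close>, and
      \<open>kappa_act\<close> reads this conjugation as the action of
      \<open>delta E e\<close>.\<close>
    have "k (e' \<otimes>\<^bsub>wgrp E\<^esub> a' \<otimes>\<^bsub>wgrp E\<^esub> inv\<^bsub>wgrp E\<^esub> (e \<otimes>\<^bsub>wgrp E\<^esub> a)) =
        k (e' \<otimes>\<^bsub>wgrp E\<^esub> inv\<^bsub>wgrp E\<^esub> e) \<otimes>\<^bsub>grp2 X\<^esub> act X (delta E e) (k (a' \<otimes>\<^bsub>wgrp E\<^esub> inv\<^bsub>wgrp E\<^esub> a))"
      using e a kk kk[of "e \<otimes>\<^bsub>wgrp E\<^esub> a" "e' \<otimes>\<^bsub>wgrp E\<^esub> a'"]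
      by (intro kappa_eqD) (simp_all add: E.kappa_act E.W.m_assoc E.W.inv_mult_group)
    then show "m (e \<otimes>\<^bsub>wgrp E\<^esub> a) (e' \<otimes>\<^bsub>wgrp (flip_bfly E)\<^esub> a') = m e e' \<otimes>\<^bsub>wgrp (id_bfly X)\<^esub> m a a'"
      using e a by (simp add: m_def id_simps)
  next
    fix h assume h: "h \<in> carrier (grp2 X)"
    then show "m (kappa E h) \<one>\<^bsub>wgrp (flip_bfly E)\<^esub> = kappa (id_bfly X) h"
      using k_kappa[of "inv\<^bsub>grp2 X\<^esub> h"] by (simp add: m_def id_simps)
    from h show "m \<one>\<^bsub>wgrp E\<^esub> (iota (flip_bfly E) h) = iota (id_bfly X) h"
      using k_kappa[of h] by (simp add: m_def id_simps)
  next
    fix g assume "g \<in> carrier (grp2 X')"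
    then show "m (iota E g) (kappa (flip_bfly E) g) = \<one>\<^bsub>wgrp (id_bfly X)\<^esub>"
      using k_kappa[of "\<one>\<^bsub>grp2 X\<^esub>"] by (simp add: m_def id_simps)
  qed
  then show "\<exists>m. comp_cell X X' X E (flip_bfly E) (id_bfly X) m" by blast
qed

lemma fibre_hom_inverse:
  assumes X: "crossed_extension X" "crossed_extension X'" and \<E>: "\<E> \<in> fibre_hom M X X'"
  obtains \<F> where "\<F> \<in> fibre_hom M X' X" "bext_comp X X' X \<E> \<F> = bext_id X" "bext_comp X' X X' \<F> \<E> = bext_id X'"
proof -
  obtain E where "E \<in> \<E>" and E: "is_butterfly X X' E" "bfly_over X X' E (\<lambda>c. c) (\<lambda>b. b)" "\<E> = bfly_class X X' E"
    "\<Pi>\<^sub>m X = M" "\<Pi>\<^sub>m X' = M"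
    using fibre_homE[OF X(1,2) \<E>] .
  have eq: "\<Pi>\<^sub>m X = \<Pi>\<^sub>m X'" using E by simp
  note F = is_butterfly_flip[OF X eq E(1,2)] bfly_over_flip[OF X eq E(1,2)]
  show ?thesis
  proof
    show "bfly_class X' X (flip_bfly E) \<in> fibre_hom M X' X"
      using bfly_class_in_fibre_hom_iff[OF X(2,1) E(5,4) F(1)] F(2) by simp
    show "bext_comp X X' X \<E> (bfly_class X' X (flip_bfly E)) = bext_id X"
      using comp_cell_flip[OF X eq E(1,2)] bext_comp_bfly_class unfolding E(3) bext_id_def by metis
    \<comment> \<open>The same fact for the exchanged butterfly, whose exchange is \<open>E\<close>
      again.\<close>
    show "bext_comp X' X X' (bfly_class X' X (flip_bfly E)) \<E> = bext_id X'"
      using comp_cell_flip[OF X(2,1) eq[symmetric] F] bext_comp_bfly_class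
      unfolding E(3) bext_id_def flip_bfly_simps(6) by metis
  qed
qed

section \<open>Base change\<close>

locale extension_module_morphism =
  X: crossed_extension X + X': crossed_extension X'
  for X :: "('h2, 'h1, 'b, 'c) crossed_ext" and X' :: "('g2, 'g1, 'd, 'k) crossed_ext"
    and \<phi>0 :: "'c \<Rightarrow> 'k" and \<phi> :: "'b \<Rightarrow> 'd" +
  assumes mod_hom: "(\<phi>0, \<phi>) \<in> mod_hom (\<Pi>\<^sub>m X) (\<Pi>\<^sub>m X')"
begin

lemma \<phi>_extensional: "\<phi>0 \<in> extensional (carrier (coker_grp X))" "\<phi> \<in> extensional (carrier (ker_grp X))"
  using mod_hom by (auto simp: mod_hom_def)

sublocale \<phi>0: group_hom "coker_grp X" "coker_grp X'" \<phi>0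
  using mod_hom by (auto simp: mod_hom_def group_hom_def group_hom_axioms_def)

sublocale \<phi>: group_hom "ker_grp X" "ker_grp X'" \<phi>
  using mod_hom by (auto simp: mod_hom_def group_hom_def group_hom_axioms_def)

lemma \<phi>_smul: "\<lbrakk>c \<in> carrier (coker_grp X); b \<in> carrier (ker_grp X)\<rbrakk> \<Longrightarrow>
    \<phi> (smul (\<Pi>\<^sub>m X) c b) = smul (\<Pi>\<^sub>m X') (\<phi>0 c) (\<phi> b)"
  using mod_hom by (auto simp: mod_hom_def)

sublocale B': comm_group "ker_grp X'" by (rule X'.comm_group_ker_grp)

section \<open>The pullback of a crossed extension\<close>

abbreviation "U \<equiv> upper_star (coker_grp X) \<phi>0 X'"

lemma upper_star_simps [simp]:
  "grp2 U = grp2 X'" "ker_grp U = ker_grp X'" "coker_grp U = coker_grp X"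
  "ker_map U = ker_map X'" "coker_map U = snd"
  "bdry U g = (bdry X' g, \<one>\<^bsub>coker_grp X\<^esub>)" "act U (x, c) = act X' x"
  "(x, c) \<in> carrier (grp1 U) \<longleftrightarrow>
    x \<in> carrier (grp1 X') \<and> c \<in> carrier (coker_grp X) \<and> coker_map X' x = \<phi>0 c"
  "(x, c) \<otimes>\<^bsub>grp1 U\<^esub> (x', c') = (x \<otimes>\<^bsub>grp1 X'\<^esub> x', c \<otimes>\<^bsub>coker_grp X\<^esub> c')"
  "\<one>\<^bsub>grp1 U\<^esub> = (\<one>\<^bsub>grp1 X'\<^esub>, \<one>\<^bsub>coker_grp X\<^esub>)"
  by (simp_all add: upper_star_def DirProd_def)

lemma group_upper_star: "group (grp1 U)"
proof (rule groupI)
  fix u assume "u \<in> carrier (grp1 U)"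
  then show "\<exists>v\<in>carrier (grp1 U). v \<otimes>\<^bsub>grp1 U\<^esub> u = \<one>\<^bsub>grp1 U\<^esub>"
    by (cases u) (auto intro!: bexI[of _ "(inv\<^bsub>grp1 X'\<^esub> fst u, inv\<^bsub>coker_grp X\<^esub> snd u)"])
qed (auto simp: X'.G1.m_assoc X.C.m_assoc)

lemma crossed_extension_upper_star: "crossed_extension U"
proof -
  interpret G1: group "grp1 U" by (rule group_upper_star)
  have inv: "inv\<^bsub>grp1 U\<^esub> (x, c) = (inv\<^bsub>grp1 X'\<^esub> x, inv\<^bsub>coker_grp X\<^esub> c)" if "(x, c) \<in> carrier (grp1 U)" for x c
    using that by (intro G1.inv_equality) auto
  \<comment> \<open>Over the unit of \<open>coker_grp X\<close> the pullback condition leaves the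
    kernel of \<open>coker_map X'\<close>.\<close>
  have ker: "kernel (grp1 U) (coker_grp U) (coker_map U) = bdry U ` carrier (grp2 U)"
  proof (intro equalityI subsetI)
    fix u assume "u \<in> kernel (grp1 U) (coker_grp U) (coker_map U)"
    then obtain x where u: "u = (x, \<one>\<^bsub>coker_grp X\<^esub>)" "x \<in> carrier (grp1 X')" "coker_map X' x = \<one>\<^bsub>coker_grp X'\<^esub>"
      by (cases u) (auto simp: kernel_def)
    then obtain g where "g \<in> carrier (grp2 X')" "x = bdry X' g" using X'.ker_coker_mapE by metis
    with u show "u \<in> bdry U ` carrier (grp2 U)" by auto
  qed (auto simp: kernel_def)
  have surj: "\<exists>u\<in>carrier (grp1 U). snd u = c" if c: "c \<in> carrier (coker_grp X)" for c
  proof -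
    obtain x where "x \<in> carrier (grp1 X')" "\<phi>0 c = coker_map X' x"
      using X'.coker_map_surjE c \<phi>0.hom_closed by metis
    with c show ?thesis by (intro bexI[of _ "(x, c)"]) auto
  qed
  have closed: "snd u \<in> carrier (coker_grp X)" if "u \<in> carrier (grp1 U)" for u
    using that by (cases u) simp
  show ?thesis
  proof unfold_locales
    show "act U \<in> hom (grp1 U) (AutoGroup (grp2 U))"
      by (rule hom_into_AutoGroupI)
        (auto simp: X'.act_mult X'.act_comp X'.act_ext intro: G1.group_axioms X'.G2.group_axioms)
    show "bdry U \<in> hom (grp2 U) (grp1 U)" by (auto simp: hom_def)
    show "coker_map U \<in> hom (grp1 U) (coker_grp U)" by (auto simp: hom_def)
    show "bdry U (act U u g) = u \<otimes>\<^bsub>grp1 U\<^esub> bdry U g \<otimes>\<^bsub>grp1 U\<^esub> inv\<^bsub>grp1 U\<^esub> u"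
      if "u \<in> carrier (grp1 U)" "g \<in> carrier (grp2 U)" for u g
      using that by (cases u) (simp add: inv X'.equivariant)
    show "ker_map U ` carrier (ker_grp U) = kernel (grp2 U) (grp1 U) (bdry U)"
      using X'.exact2 by (simp add: kernel_def)
    show "coker_map U ` carrier (grp1 U) = carrier (coker_grp U)"
      using surj closed by (auto simp: image_iff)
  qed (use ker X'.ker_map_hom X'.ker_map_inj X'.G2.m_assoc X'.B.m_assoc X.C.m_assoc in \<open>auto simp: X'.peiffer\<close>)
qed

sublocale U: crossed_extension U by (rule crossed_extension_upper_star)

lemma ext_module_upper_star:
  "\<Pi>\<^sub>m U = \<lparr>scal_grp = coker_grp X, mod_grp = ker_grp X',
     smul = \<lambda>c\<in>carrier (coker_grp X). \<lambda>b\<in>carrier (ker_grp X'). smul (\<Pi>\<^sub>m X') (\<phi>0 c) b\<rparr>"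
proof -
  have "smul (\<Pi>\<^sub>m U) c b = smul (\<Pi>\<^sub>m X') (\<phi>0 c) b"
    if c: "c \<in> carrier (coker_grp X)" and b: "b \<in> carrier (ker_grp X')" for c b
  proof -
    obtain x where x: "x \<in> carrier (grp1 X')" "\<phi>0 c = coker_map X' x"
      using X'.coker_map_surjE c \<phi>0.hom_closed by metis
    then have "smul (\<Pi>\<^sub>m U) (coker_map U (x, c)) b = smul (\<Pi>\<^sub>m X') (\<phi>0 c) b"
      using b c by (intro U.smul_eqI) (simp_all add: X'.ker_map_smul)
    then show ?thesis by simp
  qed
  then show ?thesis using U.ext_module_eqI by simp
qed

section \<open>The pushout of a crossed extension\<close>

abbreviation "D \<equiv> ker_grp X' \<times>\<times> grp2 X"
abbreviation "N \<equiv> pushout_antidiag \<phi> X"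
abbreviation "L \<equiv> lower_star (\<phi>0, \<phi>) X (\<Pi>\<^sub>m X')"
definition "q b h = N #>\<^bsub>D\<^esub> (b, h)"

sublocale D: group D by (rule DirProd_group) (rule X'.B.group_axioms X.G2.group_axioms)+

lemma pushout_antidiag_memE:
  assumes "n \<in> N"
  obtains b where "b \<in> carrier (ker_grp X)" "n = (\<phi> b, inv\<^bsub>grp2 X\<^esub> ker_map X b)"
  using assms by (auto simp: pushout_antidiag_def)

sublocale N: normal N D
proof (unfold D.normal_inv_iff, intro conjI ballI)
  have "(\<phi> b, inv\<^bsub>grp2 X\<^esub> ker_map X b) \<otimes>\<^bsub>D\<^esub> (\<phi> b', inv\<^bsub>grp2 X\<^esub> ker_map X b') \<in> N"
    if "b \<in> carrier (ker_grp X)" "b' \<in> carrier (ker_grp X)" for b b'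
    using that X.ker_map_central[of b' "ker_map X b"] unfolding pushout_antidiag_def
    by (intro image_eqI[where x = "b \<otimes>\<^bsub>ker_grp X\<^esub> b'"]) (auto simp: X.G2.inv_mult_group[symmetric])
  moreover have "inv\<^bsub>D\<^esub> (\<phi> b, inv\<^bsub>grp2 X\<^esub> ker_map X b) \<in> N" if "b \<in> carrier (ker_grp X)" for b
    using that X'.B.group_axioms X.G2.group_axioms unfolding pushout_antidiag_def
    by (intro image_eqI[where x = "inv\<^bsub>ker_grp X\<^esub> b"]) auto
  ultimately show "subgroup N D"
    by (intro D.subgroupI) (auto simp: pushout_antidiag_def)
next
  fix x n assume "x \<in> carrier D" "n \<in> N"
  then obtain b' h b where x: "x = (b', h)" "b' \<in> carrier (ker_grp X')" "h \<in> carrier (grp2 X)"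
    and b: "b \<in> carrier (ker_grp X)" "n = (\<phi> b, inv\<^bsub>grp2 X\<^esub> ker_map X b)"
    by (cases x) (auto elim: pushout_antidiag_memE)
  \<comment> \<open>Both coordinates of \<open>n\<close> are central, so conjugation fixes
    \<open>n\<close>.\<close>
  have "inv\<^bsub>grp2 X\<^esub> ker_map X b = h \<otimes>\<^bsub>grp2 X\<^esub> inv\<^bsub>grp2 X\<^esub> ker_map X b \<otimes>\<^bsub>grp2 X\<^esub> inv\<^bsub>grp2 X\<^esub> h"
    using x b X.ker_map_central[of "inv\<^bsub>ker_grp X\<^esub> b" h] by (intro X.G2.eq_conjugateI) auto
  moreover have "\<phi> b = b' \<otimes>\<^bsub>ker_grp X'\<^esub> \<phi> b \<otimes>\<^bsub>ker_grp X'\<^esub> inv\<^bsub>ker_grp X'\<^esub> b'"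
    using x b by (intro X'.B.eq_conjugateI) (auto simp: B'.m_comm)
  ultimately have "x \<otimes>\<^bsub>D\<^esub> n \<otimes>\<^bsub>D\<^esub> inv\<^bsub>D\<^esub> x = n"
    using x b X'.B.group_axioms X.G2.group_axioms by simp
  with \<open>n \<in> N\<close> show "x \<otimes>\<^bsub>D\<^esub> n \<otimes>\<^bsub>D\<^esub> inv\<^bsub>D\<^esub> x \<in> N" by simp
qed

lemma lower_star_simps [simp]:
  "grp1 L = grp1 X" "ker_grp L = ker_grp X'" "coker_grp L = coker_grp X"
  "ker_map L b = q b \<one>\<^bsub>grp2 X\<^esub>" "coker_map L = coker_map X"
  by (simp_all add: lower_star_def Let_def q_def)

lemma grp2_lower_star: "grp2 L = D Mod N"
  by (simp add: lower_star_def Let_def)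

lemma q_closed [simp]: "\<lbrakk>b \<in> carrier (ker_grp X'); h \<in> carrier (grp2 X)\<rbrakk> \<Longrightarrow> q b h \<in> carrier (grp2 L)"
  unfolding grp2_lower_star carrier_FactGroup q_def by (rule imageI) simp

lemma q_surjE:
  assumes "u \<in> carrier (grp2 L)"
  obtains b h where "b \<in> carrier (ker_grp X')" "h \<in> carrier (grp2 X)" "u = q b h"
proof -
  obtain z where "z \<in> carrier D" "u = N #>\<^bsub>D\<^esub> z"
    using assms unfolding grp2_lower_star carrier_FactGroup by (rule imageE)
  with that show ?thesis by (cases z) (auto simp: q_def)
qed

lemma q_mult [simp]:
  assumes "b \<in> carrier (ker_grp X')" "h \<in> carrier (grp2 X)" "b' \<in> carrier (ker_grp X')" "h' \<in> carrier (grp2 X)"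
  shows "q b h \<otimes>\<^bsub>grp2 L\<^esub> q b' h' = q (b \<otimes>\<^bsub>ker_grp X'\<^esub> b') (h \<otimes>\<^bsub>grp2 X\<^esub> h')"
  using assms N.rcos_sum[of "(b, h)" "(b', h')"] by (simp add: grp2_lower_star q_def)

lemma group_lower_star: "group (grp2 L)"
  unfolding grp2_lower_star by (rule N.factorgroup_is_group)

lemma q_eq_one_iff:
  assumes "b \<in> carrier (ker_grp X')" "h \<in> carrier (grp2 X)"
  shows "q b h = \<one>\<^bsub>grp2 L\<^esub> \<longleftrightarrow> (\<exists>a\<in>carrier (ker_grp X). b = \<phi> a \<and> h = inv\<^bsub>grp2 X\<^esub> ker_map X a)"
proof -
  have "(b, h) \<in> carrier D" using assms by simp
  then have "q b h = N \<longleftrightarrow> (b, h) \<in> N"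
    unfolding q_def using D.coset_join1 D.coset_join2 N.subgroup_axioms N.subset by blast
  then show ?thesis by (auto simp: grp2_lower_star pushout_antidiag_def)
qed

lemma q_one: "q \<one>\<^bsub>ker_grp X'\<^esub> \<one>\<^bsub>grp2 X\<^esub> = \<one>\<^bsub>grp2 L\<^esub>"
  unfolding q_eq_one_iff[OF X'.B.one_closed X.G2.one_closed]
  by (intro bexI[of _ "\<one>\<^bsub>ker_grp X\<^esub>"]) simp_all

lemma q_antidiag:
  assumes "a \<in> carrier (ker_grp X)" "b \<in> carrier (ker_grp X')" "h \<in> carrier (grp2 X)"
  shows "q (\<phi> a \<otimes>\<^bsub>ker_grp X'\<^esub> b) (inv\<^bsub>grp2 X\<^esub> ker_map X a \<otimes>\<^bsub>grp2 X\<^esub> h) = q b h"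
proof -
  interpret L2: group "grp2 L" by (rule group_lower_star)
  have "q (\<phi> a) (inv\<^bsub>grp2 X\<^esub> ker_map X a) = \<one>\<^bsub>grp2 L\<^esub>"
    using assms q_eq_one_iff by auto
  with assms q_mult[of "\<phi> a" "inv\<^bsub>grp2 X\<^esub> ker_map X a" b h] show ?thesis by (simp del: q_mult)
qed

text \<open>The pushout relation: an element of \<open>ker_grp X\<close> crosses over to the other
  coordinate through \<phi>. This is the reason why a butterfly over an identity restricts to one
  over \<phi>.\<close>

lemma q_ker_map:
  assumes "a \<in> carrier (ker_grp X)" "b \<in> carrier (ker_grp X')"
  shows "q b (ker_map X a) = q (\<phi> a \<otimes>\<^bsub>ker_grp X'\<^esub> b) \<one>\<^bsub>grp2 X\<^esub>"
  using q_antidiag[OF assms, of "ker_map X a"] assms by simp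

lemma the_elem_image_q:
  assumes "b \<in> carrier (ker_grp X')" "h \<in> carrier (grp2 X)"
    and "\<And>a. a \<in> carrier (ker_grp X) \<Longrightarrow>
      F (\<phi> a \<otimes>\<^bsub>ker_grp X'\<^esub> b) (inv\<^bsub>grp2 X\<^esub> ker_map X a \<otimes>\<^bsub>grp2 X\<^esub> h) = F b h"
  shows "the_elem ((\<lambda>(b, h). F b h) ` q b h) = F b h"
proof -
  have "the_elem ((\<lambda>(b, h). F b h) ` (N #>\<^bsub>D\<^esub> (b, h))) = (\<lambda>(b, h). F b h) (b, h)"
    using assms by (intro the_elem_image_r_coset[OF D.group_axioms N.subgroup_axioms])
      (auto elim!: pushout_antidiag_memE)
  then show ?thesis by (simp add: q_def)
qed

lemma bdry_q [simp]:
  assumes "b \<in> carrier (ker_grp X')" "h \<in> carrier (grp2 X)"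
  shows "bdry L (q b h) = bdry X h"
  using the_elem_image_q[OF assms, of "\<lambda>b h. bdry X h"] assms(2) by (simp add: lower_star_def Let_def)

lemma act_q [simp]:
  assumes x: "x \<in> carrier (grp1 X)" and bh: "b \<in> carrier (ker_grp X')" "h \<in> carrier (grp2 X)"
  shows "act L x (q b h) = q (smul (\<Pi>\<^sub>m X') (\<phi>0 (coker_map X x)) b) (act X x h)"
proof -
  let ?F = "\<lambda>b h. q (smul (\<Pi>\<^sub>m X') (\<phi>0 (coker_map X x)) b) (act X x h)"
  have "?F (\<phi> a \<otimes>\<^bsub>ker_grp X'\<^esub> b) (inv\<^bsub>grp2 X\<^esub> ker_map X a \<otimes>\<^bsub>grp2 X\<^esub> h) = ?F b h"
    if a: "a \<in> carrier (ker_grp X)" for a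
  proof -
    \<comment> \<open>The action takes the antidiagonal element of \<open>a\<close> to that of
      \<open>?a\<close>: equivariance of \<phi> handles the first coordinate,
      \<open>ker_map_smul\<close> the second.\<close>
    let ?a = "smul (\<Pi>\<^sub>m X) (coker_map X x) a"
    have "?F (\<phi> a \<otimes>\<^bsub>ker_grp X'\<^esub> b) (inv\<^bsub>grp2 X\<^esub> ker_map X a \<otimes>\<^bsub>grp2 X\<^esub> h) =
        q (\<phi> ?a \<otimes>\<^bsub>ker_grp X'\<^esub> smul (\<Pi>\<^sub>m X') (\<phi>0 (coker_map X x)) b) (inv\<^bsub>grp2 X\<^esub> ker_map X ?a \<otimes>\<^bsub>grp2 X\<^esub> act X x h)"
      using a x bh by (simp add: X'.smul_mult \<phi>_smul X.ker_map_smul X.act_mult X.act_inv)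
    also have "\<dots> = ?F b h" using a x bh by (intro q_antidiag) auto
    finally show ?thesis .
  qed
  then have "the_elem ((\<lambda>(b, h). ?F b h) ` q b h) = ?F b h"
    by (rule the_elem_image_q[OF bh])
  then show ?thesis
    using q_closed[OF bh] unfolding grp2_lower_star by (simp add: lower_star_def Let_def q_def)
qed

lemma crossed_extension_lower_star: "crossed_extension L"
proof -
  interpret L2: group "grp2 L" by (rule group_lower_star)
  have inv_q: "inv\<^bsub>grp2 L\<^esub> q b h = q (inv\<^bsub>ker_grp X'\<^esub> b) (inv\<^bsub>grp2 X\<^esub> h)"
    if "b \<in> carrier (ker_grp X')" "h \<in> carrier (grp2 X)" for b h
    using that by (intro L2.inv_equality) (auto simp: q_one)
  have bdry_hom: "bdry L \<in> hom (grp2 L) (grp1 L)"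
    by (auto simp: hom_def elim!: q_surjE)
  have ker_hom: "ker_map L \<in> hom (ker_grp L) (grp2 L)" by (auto simp: hom_def)
  interpret ker: group_hom "ker_grp L" "grp2 L" "ker_map L"
    using ker_hom by (simp add: group_hom_def group_hom_axioms_def L2.group_axioms X'.B.group_axioms)
  show ?thesis
  proof unfold_locales
    show "act L \<in> hom (grp1 L) (AutoGroup (grp2 L))"
    proof (rule hom_into_AutoGroupI)
      show "act L x \<in> extensional (carrier (grp2 L))" if "x \<in> carrier (grp1 L)" for x
        by (simp add: lower_star_def Let_def)
    qed (auto simp: X.act_mult X.act_comp X'.smul_mult X'.smul_comp X.G1.group_axioms L2.group_axioms elim!: q_surjE)
    show "bdry L (act L x u) = x \<otimes>\<^bsub>grp1 L\<^esub> bdry L u \<otimes>\<^bsub>grp1 L\<^esub> inv\<^bsub>grp1 L\<^esub> x"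
      if "x \<in> carrier (grp1 L)" "u \<in> carrier (grp2 L)" for x u
      using that by (auto simp: X.equivariant elim!: q_surjE)
    show "act L (bdry L u) v = u \<otimes>\<^bsub>grp2 L\<^esub> v \<otimes>\<^bsub>grp2 L\<^esub> inv\<^bsub>grp2 L\<^esub> u"
      if uv: "u \<in> carrier (grp2 L)" "v \<in> carrier (grp2 L)" for u v
    proof -
      obtain b h where u: "b \<in> carrier (ker_grp X')" "h \<in> carrier (grp2 X)" "u = q b h"
        using uv(1) by (rule q_surjE)
      obtain b' h' where v: "b' \<in> carrier (ker_grp X')" "h' \<in> carrier (grp2 X)" "v = q b' h'"
        using uv(2) by (rule q_surjE)
      note * = u v
      \<comment> \<open>Boundaries act trivially on the first coordinate, so the Peiffer identity
        there is commutativity of \<open>ker_grp X'\<close>.\<close>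
      then have "b \<otimes>\<^bsub>ker_grp X'\<^esub> b' \<otimes>\<^bsub>ker_grp X'\<^esub> inv\<^bsub>ker_grp X'\<^esub> b = b'"
        by (simp add: B'.m_comm[of b b'] X'.B.m_assoc)
      with * show ?thesis by (simp add: inv_q X.peiffer)
    qed
    show "inj_on (ker_map L) (carrier (ker_grp L))"
      unfolding ker.inj_on_one_iff
    proof (intro allI impI)
      fix b assume b: "b \<in> carrier (ker_grp L)" "ker_map L b = \<one>\<^bsub>grp2 L\<^esub>"
      then obtain a where a: "a \<in> carrier (ker_grp X)" "b = \<phi> a" "\<one>\<^bsub>grp2 X\<^esub> = inv\<^bsub>grp2 X\<^esub> ker_map X a"
        using q_eq_one_iff[of b "\<one>\<^bsub>grp2 X\<^esub>"] by auto
      \<comment> \<open>\<phi> may have a kernel; it is injectivity of \<open>ker_map X\<close> that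
        forces \<open>a\<close>, and with it \<open>b\<close>, to be trivial.\<close>
      then have "ker_map X a = ker_map X \<one>\<^bsub>ker_grp X\<^esub>"
        by (metis X.G2.inv_inv X.G2.inv_one X.ker.hom_closed X.ker.hom_one)
      then have "a = \<one>\<^bsub>ker_grp X\<^esub>" using a(1) X.ker_map_eq_iff X.B.one_closed by blast
      with a show "b = \<one>\<^bsub>ker_grp L\<^esub>" by simp
    qed
    show "ker_map L ` carrier (ker_grp L) = kernel (grp2 L) (grp1 L) (bdry L)"
    proof (intro equalityI subsetI)
      fix u assume "u \<in> kernel (grp2 L) (grp1 L) (bdry L)"
      then obtain b h where bh: "b \<in> carrier (ker_grp X')" "h \<in> carrier (grp2 X)" "u = q b h" "bdry X h = \<one>\<^bsub>grp1 X\<^esub>"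
        by (auto simp: kernel_def elim!: q_surjE)
      \<comment> \<open>The pushout relation moves all of \<open>h\<close> into the first
        coordinate.\<close>
      then obtain a where "a \<in> carrier (ker_grp X)" "h = ker_map X a" using X.ker_bdryE by metis
      with bh show "u \<in> ker_map L ` carrier (ker_grp L)"
        by (auto simp: q_ker_map)
    qed (auto simp: kernel_def)
    have "bdry L ` carrier (grp2 L) = bdry X ` carrier (grp2 X)"
    proof (intro equalityI subsetI)
      fix x assume "x \<in> bdry X ` carrier (grp2 X)"
      then obtain h where "h \<in> carrier (grp2 X)" "x = bdry L (q \<one>\<^bsub>ker_grp X'\<^esub> h)" by auto
      then show "x \<in> bdry L ` carrier (grp2 L)"
        by (intro image_eqI[where x = "q \<one>\<^bsub>ker_grp X'\<^esub> h"]) auto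
    qed (auto elim!: q_surjE)
    then show "bdry L ` carrier (grp2 L) = kernel (grp1 L) (coker_grp L) (coker_map L)"
      by (simp add: X.exact1)
  qed (use bdry_hom ker_hom X.coker_map_hom X.coker_map_surj X.G1.m_assoc X.C.m_assoc in auto)
qed

sublocale L: crossed_extension L by (rule crossed_extension_lower_star)

text \<open>Equality of records is what admits arrows from \<open>L\<close> to \<open>U\<close> to
  the fibre over \<open>\<Pi>\<^sub>m U\<close>.\<close>

lemma ext_module_lower_star: "\<Pi>\<^sub>m L = \<Pi>\<^sub>m U"
proof -
  have "smul (\<Pi>\<^sub>m L) c b = smul (\<Pi>\<^sub>m X') (\<phi>0 c) b"
    if c: "c \<in> carrier (coker_grp X)" and b: "b \<in> carrier (ker_grp X')" for c b
  proof -
    obtain x where x: "x \<in> carrier (grp1 X)" "c = coker_map X x"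
      using X.coker_map_surjE c by metis
    then have "smul (\<Pi>\<^sub>m L) (coker_map L x) b = smul (\<Pi>\<^sub>m X') (\<phi>0 c) b"
      using b c by (intro L.smul_eqI) auto
    with x show ?thesis by simp
  qed
  then show ?thesis
    unfolding ext_module_upper_star using L.ext_module_eqI by simp
qed

section \<open>Composition with the canonical arrows\<close>

lemma strict_morphism_upper_star: "strict_morphism U X' (\<lambda>g. g) fst"
  by unfold_locales (auto simp: hom_def)

lemma strict_morphism_lower_star: "strict_morphism X L (q \<one>\<^bsub>ker_grp X'\<^esub>) (\<lambda>x. x)"
proof -
  \<comment> \<open>A scalar multiple of the unit is idempotent, hence trivial.\<close>
  have "smul (\<Pi>\<^sub>m X') c \<one>\<^bsub>ker_grp X'\<^esub> = \<one>\<^bsub>ker_grp X'\<^esub>" if "c \<in> carrier (coker_grp X')" for c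
    using X'.smul_mult[OF that, of "\<one>\<^bsub>ker_grp X'\<^esub>" "\<one>\<^bsub>ker_grp X'\<^esub>"] that X'.smul_closed[OF that, of "\<one>\<^bsub>ker_grp X'\<^esub>"]
    by simp
  then show ?thesis
    by unfold_locales (auto simp: hom_def)
qed

definition restrict_bfly ::
  "('e, ('d \<times> 'h2) set, 'h1, 'g2, 'g1 \<times> 'c) butterfly \<Rightarrow> ('e, 'h2, 'h1, 'g2, 'g1) butterfly" where
  "restrict_bfly A = precomp_bfly (q \<one>\<^bsub>ker_grp X'\<^esub>) (postcomp_bfly fst A)"

lemma restrict_bfly_simps [simp]:
  "wgrp (restrict_bfly A) = wgrp A" "kappa (restrict_bfly A) h = kappa A (q \<one>\<^bsub>ker_grp X'\<^esub> h)"
  "iota (restrict_bfly A) = iota A" "delta (restrict_bfly A) = delta A" "gamma (restrict_bfly A) e = fst (gamma A e)"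
  by (simp_all add: restrict_bfly_def)

text \<open>The canonical arrow from \<open>U\<close> is strict and the identity on
  \<open>grp2\<close>, the one to \<open>L\<close> is strict and the identity on
  \<open>grp1\<close>. Composing with the former alters only \<open>gamma\<close>, with the latter
  only \<open>kappa\<close>.\<close>

lemma
  assumes A: "is_butterfly L U A"
  shows is_butterfly_restrict_bfly: "is_butterfly X X' (restrict_bfly A)"
    and base_change_map_bfly_class:
      "base_change_map X X' (\<phi>0, \<phi>) (bfly_class L U A) = bfly_class X X' (restrict_bfly A)"
proof -
  have post: "comp_cell L U X' A (strict_bfly U X' (\<lambda>g. g) fst) (postcomp_bfly fst A)
      (\<lambda>e (g, x). iota A g \<otimes>\<^bsub>wgrp A\<^esub> e)"
    by (rule comp_cell_postcomp[OF strict_morphism_upper_star _ A]) simp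
  then interpret post: comp_cell L U X' A "strict_bfly U X' (\<lambda>g. g) fst" "postcomp_bfly fst A"
      "\<lambda>e (g, x). iota A g \<otimes>\<^bsub>wgrp A\<^esub> e" .
  have pre: "comp_cell X L X' (strict_bfly X L (q \<one>\<^bsub>ker_grp X'\<^esub>) (\<lambda>x. x)) (postcomp_bfly fst A) (restrict_bfly A)
      (\<lambda>(l, x) e. inv\<^bsub>wgrp (postcomp_bfly fst A)\<^esub> (kappa (postcomp_bfly fst A) l) \<otimes>\<^bsub>wgrp (postcomp_bfly fst A)\<^esub> e)"
    unfolding restrict_bfly_def
    by (rule comp_cell_precomp[OF strict_morphism_lower_star _ post.G.is_butterfly_axioms]) simp
  then show "is_butterfly X X' (restrict_bfly A)" by (simp add: comp_cell_def)
  have "(\<lambda>h. pushout_antidiag \<phi> X #>\<^bsub>mod_grp (\<Pi>\<^sub>m X') \<times>\<times> grp2 X\<^esub> (\<one>\<^bsub>mod_grp (\<Pi>\<^sub>m X')\<^esub>, h)) = q \<one>\<^bsub>ker_grp X'\<^esub>"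
    by (simp add: q_def fun_eq_iff)
  then have "lower_star_arrow (\<phi>0, \<phi>) X (\<Pi>\<^sub>m X') = bfly_class X L (strict_bfly X L (q \<one>\<^bsub>ker_grp X'\<^esub>) (\<lambda>x. x))"
    by (simp add: lower_star_arrow_def Let_def)
  then show "base_change_map X X' (\<phi>0, \<phi>) (bfly_class L U A) = bfly_class X X' (restrict_bfly A)"
    by (simp add: base_change_map_def upper_star_arrow_def Let_def
      bext_comp_bfly_class[OF post] bext_comp_bfly_class[OF pre])
qed

lemma gamma_in_upper_star:
  assumes "is_butterfly L U A" "bfly_over L U A (\<lambda>c. c) (\<lambda>b. b)" "e \<in> carrier (wgrp A)"
  shows "snd (gamma A e) = coker_map X (delta A e)"
    and "coker_map X' (fst (gamma A e)) = \<phi>0 (coker_map X (delta A e))"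
proof -
  interpret A: is_butterfly L U A by fact
  show *: "snd (gamma A e) = coker_map X (delta A e)"
    using assms by (simp add: bfly_over_def)
  show "coker_map X' (fst (gamma A e)) = \<phi>0 (coker_map X (delta A e))"
    using A.gamma.hom_closed[OF assms(3)] unfolding *[symmetric] by (cases "gamma A e") simp
qed

lemma bfly_over_restrict_bfly:
  assumes A: "is_butterfly L U A" "bfly_over L U A (\<lambda>c. c) (\<lambda>b. b)"
  shows "bfly_over X X' (restrict_bfly A) \<phi>0 \<phi>"
proof -
  \<comment> \<open>By the pushout relation the argument of \<open>kappa A\<close> is
    \<open>ker_map L (\<phi> b)\<close>, so the claim is the identity condition on \<open>A\<close>
    at \<open>\<phi> b\<close>.\<close>
  have "kappa A (q \<one>\<^bsub>ker_grp X'\<^esub> (ker_map X b)) \<otimes>\<^bsub>wgrp A\<^esub> iota A (ker_map X' (\<phi> b)) = \<one>\<^bsub>wgrp A\<^esub>"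
    if "b \<in> carrier (ker_grp X)" for b
    using A(2) that by (simp add: bfly_over_def q_ker_map)
  then show ?thesis
    using gamma_in_upper_star[OF A] by (auto simp: bfly_over_def)
qed

text \<open>A 2-cell between the restrictions is already one between \<open>A\<close> and
  \<open>A'\<close>: the forgotten data are expressed through \<open>delta\<close> and
  \<open>iota\<close>, which it preserves.\<close>

lemma bfly_iso_of_restrict_bfly:
  assumes A: "is_butterfly L U A" "bfly_over L U A (\<lambda>c. c) (\<lambda>b. b)"
    and A': "is_butterfly L U A'" "bfly_over L U A' (\<lambda>c. c) (\<lambda>b. b)"
    and iso: "bfly_iso X X' (restrict_bfly A) (restrict_bfly A')"
  shows "bfly_iso L U A A'"
proof -
  interpret A: is_butterfly L U A by fact
  interpret A': is_butterfly L U A' by fact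
  obtain f where f: "two_cell X X' (restrict_bfly A) (restrict_bfly A') f"
    using iso by (auto simp: bfly_iso_def)
  then interpret f: group_hom "wgrp A" "wgrp A'" f
    by (simp add: group_hom_def group_hom_axioms_def A.W.group_axioms A'.W.group_axioms two_cell_def)
  \<comment> \<open>Factor \<open>q b h\<close> as \<open>q b 1\<close> times \<open>q 1 h\<close>;
    on the first factor the identity condition prescribes \<open>kappa\<close>.\<close>
  have kappa_q: "kappa C (q b h) = inv\<^bsub>wgrp C\<^esub> iota C (ker_map X' b) \<otimes>\<^bsub>wgrp C\<^esub> kappa C (q \<one>\<^bsub>ker_grp X'\<^esub> h)"
    if C: "is_butterfly L U C" "bfly_over L U C (\<lambda>c. c) (\<lambda>b. b)"
      and b: "b \<in> carrier (ker_grp X')" and h: "h \<in> carrier (grp2 X)"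
    for C :: "('x, ('d \<times> 'h2) set, 'h1, 'g2, 'g1 \<times> 'c) butterfly" and b h
  proof -
    interpret C: is_butterfly L U C by fact
    have "kappa C (q b \<one>\<^bsub>grp2 X\<^esub>) \<otimes>\<^bsub>wgrp C\<^esub> iota C (ker_map X' b) = \<one>\<^bsub>wgrp C\<^esub>"
      using C(2) b by (simp add: bfly_over_def)
    then have "kappa C (q b \<one>\<^bsub>grp2 X\<^esub>) = inv\<^bsub>wgrp C\<^esub> iota C (ker_map X' b)"
      using b by (intro C.W.inv_eq_of_mult_eq_one(1)) auto
    with C.kappa.hom_mult[of "q b \<one>\<^bsub>grp2 X\<^esub>" "q \<one>\<^bsub>ker_grp X'\<^esub> h"] b h show ?thesis by simp
  qed
  have "two_cell L U A A' f"
    unfolding two_cell_def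
  proof (intro conjI ballI)
    show "f \<in> hom (wgrp A) (wgrp A')" by (rule f.homh)
    fix e assume e: "e \<in> carrier (wgrp A)"
    then show "delta A' (f e) = delta A e" using f by (simp add: two_cell_def)
    with e f show "gamma A' (f e) = gamma A e"
      using gamma_in_upper_star(1)[OF A] gamma_in_upper_star(1)[OF A', of "f e"]
      by (intro prod_eqI) (auto simp: two_cell_def)
  next
    fix g assume "g \<in> carrier (grp2 U)"
    with f show "f (iota A g) = iota A' g" by (simp add: two_cell_def)
  next
    fix u assume "u \<in> carrier (grp2 L)"
    then obtain b h where bh: "b \<in> carrier (ker_grp X')" "h \<in> carrier (grp2 X)" "u = q b h" by (rule q_surjE)
    then have "f (iota A (ker_map X' b)) = iota A' (ker_map X' b)"
        "f (kappa A (q \<one>\<^bsub>ker_grp X'\<^esub> h)) = kappa A' (q \<one>\<^bsub>ker_grp X'\<^esub> h)"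
      using f by (simp_all add: two_cell_def)
    with bh show "f (kappa A u) = kappa A' u"
      by (simp add: kappa_q[OF A bh(1,2)] kappa_q[OF A' bh(1,2)])
  qed
  then show ?thesis by (rule two_cell_imp_bfly_iso[OF A(1) A'(1)])
qed

text \<open>
  On \<open>lower_star\<close>, \<open>kappa\<close> has to be \<open>[b', h] \<mapsto> iota (j' b')\<inverse> kappa h\<close> in order to lie over the
  identity; it is constant on cosets because \<open>kappa (j b) iota (j' (\<phi> b)) = 1\<close>.
\<close>

definition extend_bfly ::
  "('e, 'h2, 'h1, 'g2, 'g1) butterfly \<Rightarrow> ('e, ('d \<times> 'h2) set, 'h1, 'g2, 'g1 \<times> 'c) butterfly" where
  "extend_bfly E = \<lparr>wgrp = wgrp E,
     kappa = \<lambda>u. the_elem ((\<lambda>(b, h). inv\<^bsub>wgrp E\<^esub> iota E (ker_map X' b) \<otimes>\<^bsub>wgrp E\<^esub> kappa E h) ` u),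
     iota = iota E, delta = delta E, gamma = \<lambda>e. (gamma E e, coker_map X (delta E e))\<rparr>"

lemma extend_bfly_simps [simp]:
  "wgrp (extend_bfly E) = wgrp E" "iota (extend_bfly E) = iota E" "delta (extend_bfly E) = delta E"
  "gamma (extend_bfly E) e = (gamma E e, coker_map X (delta E e))"
  by (simp_all add: extend_bfly_def)

text \<open>Each axiom for \<open>kappa\<close> splits into a part for \<open>ker_map X' b\<close>
  and a part for \<open>h\<close>. The two parts commute, which makes \<open>kappa\<close>
  multiplicative, and each is equivariant by an axiom of \<open>E\<close>, that of
  \<open>iota\<close> for the first and that of \<open>kappa\<close> for the second.\<close>

lemma
  assumes E: "is_butterfly X X' E" and over: "bfly_over X X' E \<phi>0 \<phi>"
  shows is_butterfly_extend_bfly: "is_butterfly L U (extend_bfly E)"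
    and bfly_over_extend_bfly: "bfly_over L U (extend_bfly E) (\<lambda>c. c) (\<lambda>b. b)"
    and bfly_iso_restrict_extend: "bfly_iso X X' (restrict_bfly (extend_bfly E)) E"
proof -
  interpret E: is_butterfly X X' E by fact
  let ?A = "extend_bfly E"
  have comm: "iota E g \<otimes>\<^bsub>wgrp E\<^esub> iota E (ker_map X' b) = iota E (ker_map X' b) \<otimes>\<^bsub>wgrp E\<^esub> iota E g"
    if "g \<in> carrier (grp2 X')" "b \<in> carrier (ker_grp X')" for g b
    using that X'.ker_map_central[of b g] by (simp flip: E.iota.hom_mult)
  have kappa_q: "kappa ?A (q b h) = iota E (ker_map X' (inv\<^bsub>ker_grp X'\<^esub> b)) \<otimes>\<^bsub>wgrp E\<^esub> kappa E h"
    if bh: "b \<in> carrier (ker_grp X')" "h \<in> carrier (grp2 X)" for b h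
  proof -
    let ?F = "\<lambda>b h. inv\<^bsub>wgrp E\<^esub> iota E (ker_map X' b) \<otimes>\<^bsub>wgrp E\<^esub> kappa E h"
    have "?F (\<phi> a \<otimes>\<^bsub>ker_grp X'\<^esub> b) (inv\<^bsub>grp2 X\<^esub> ker_map X a \<otimes>\<^bsub>grp2 X\<^esub> h) = ?F b h"
      if a: "a \<in> carrier (ker_grp X)" for a
    proof -
      have "kappa E (ker_map X a) \<otimes>\<^bsub>wgrp E\<^esub> iota E (ker_map X' (\<phi> a)) = \<one>\<^bsub>wgrp E\<^esub>"
        using over a by (simp add: bfly_over_def)
      then have "inv\<^bsub>wgrp E\<^esub> (kappa E (ker_map X a)) = iota E (ker_map X' (\<phi> a))"
        using a by (intro E.W.inv_eq_of_mult_eq_one(2)[symmetric]) auto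
      with a bh show ?thesis by (simp add: E.W.inv_mult_group E.W.m_assoc)
    qed
    then show ?thesis
      using the_elem_image_q[OF bh, of ?F] bh by (simp add: extend_bfly_def)
  qed
  have over0: "\<phi>0 (coker_map X (delta E e)) = coker_map X' (gamma E e)" if "e \<in> carrier (wgrp E)" for e
    using over that by (simp add: bfly_over_def)
  have kappa_closed: "kappa ?A u \<in> carrier (wgrp E)" if "u \<in> carrier (grp2 L)" for u
    using that by (auto simp: kappa_q elim!: q_surjE)
  show "is_butterfly L U ?A"
  proof (rule is_butterflyI)
    show "crossed_module L" "crossed_module U" "group (wgrp ?A)"
      using L.crossed_module_axioms U.crossed_module_axioms E.W.group_axioms by simp_all
    show "kappa ?A \<in> hom (grp2 L) (wgrp ?A)"
    proof (rule homI)
      fix u v assume uv: "u \<in> carrier (grp2 L)" "v \<in> carrier (grp2 L)"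
      obtain b h where u: "b \<in> carrier (ker_grp X')" "h \<in> carrier (grp2 X)" "u = q b h"
        using uv(1) by (rule q_surjE)
      obtain b' h' where v: "b' \<in> carrier (ker_grp X')" "h' \<in> carrier (grp2 X)" "v = q b' h'"
        using uv(2) by (rule q_surjE)
      note * = u v
      let ?i = "\<lambda>b. iota E (ker_map X' (inv\<^bsub>ker_grp X'\<^esub> b))"
      \<comment> \<open>Only the factor of \<open>b'\<close> has to be moved past
        \<open>kappa E h\<close>.\<close>
      have "?i b \<otimes>\<^bsub>wgrp E\<^esub> kappa E h \<otimes>\<^bsub>wgrp E\<^esub> (?i b' \<otimes>\<^bsub>wgrp E\<^esub> kappa E h') =
          ?i b \<otimes>\<^bsub>wgrp E\<^esub> (kappa E h \<otimes>\<^bsub>wgrp E\<^esub> ?i b') \<otimes>\<^bsub>wgrp E\<^esub> kappa E h'"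
        using * by (simp add: E.W.m_assoc del: X'.ker.hom_inv)
      also have "\<dots> = (?i b \<otimes>\<^bsub>wgrp E\<^esub> ?i b') \<otimes>\<^bsub>wgrp E\<^esub> (kappa E h \<otimes>\<^bsub>wgrp E\<^esub> kappa E h')"
        using * by (subst E.kappa_iota_commute) (simp_all add: E.W.m_assoc del: X'.ker.hom_inv)
      finally show "kappa ?A (u \<otimes>\<^bsub>grp2 L\<^esub> v) = kappa ?A u \<otimes>\<^bsub>wgrp ?A\<^esub> kappa ?A v"
        using * by (simp add: kappa_q B'.inv_mult del: X'.ker.hom_inv)
    qed (simp add: kappa_closed)
    \<comment> \<open>\<open>over0\<close> is membership of the pair in the pullback.\<close>
    show "gamma ?A \<in> hom (wgrp ?A) (grp1 U)" by (auto simp: hom_def over0)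
    show "delta ?A (kappa ?A u) = bdry L u" "gamma ?A (kappa ?A u) = \<one>\<^bsub>grp1 U\<^esub>"
      if "u \<in> carrier (grp2 L)" for u
      using that by (auto simp: kappa_q elim!: q_surjE)
    show "kappa ?A (act L (delta ?A e) u) \<otimes>\<^bsub>wgrp ?A\<^esub> e = e \<otimes>\<^bsub>wgrp ?A\<^esub> kappa ?A u"
      if eu: "e \<in> carrier (wgrp ?A)" "u \<in> carrier (grp2 L)" for e u
    proof -
      obtain b h where bh: "b \<in> carrier (ker_grp X')" "h \<in> carrier (grp2 X)" "u = q b h"
        using eu(2) by (rule q_surjE)
      have e: "e \<in> carrier (wgrp E)" using eu by simp
      let ?b = "inv\<^bsub>ker_grp X'\<^esub> b"
      \<comment> \<open>\<open>L\<close> acts on this coordinate through \<open>delta E e\<close>,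
        conjugation by \<open>e\<close> through \<open>gamma E e\<close>; \<open>over0\<close>
        identifies the two.\<close>
      have s: "ker_map X' (smul (\<Pi>\<^sub>m X') (\<phi>0 (coker_map X (delta E e))) b) = act X' (gamma E e) (ker_map X' b)"
        using e bh by (simp add: over0 X'.ker_map_smul)
      have "e \<otimes>\<^bsub>wgrp E\<^esub> (iota E (ker_map X' ?b) \<otimes>\<^bsub>wgrp E\<^esub> kappa E h) =
          e \<otimes>\<^bsub>wgrp E\<^esub> iota E (ker_map X' ?b) \<otimes>\<^bsub>wgrp E\<^esub> kappa E h"
        using e bh by (simp add: E.W.m_assoc)
      also have "\<dots> = iota E (act X' (gamma E e) (ker_map X' ?b)) \<otimes>\<^bsub>wgrp E\<^esub> (e \<otimes>\<^bsub>wgrp E\<^esub> kappa E h)"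
        using e bh by (simp add: E.conj_iota E.W.m_assoc X'.act_inv del: E.iota.hom_inv)
      also have "\<dots> = iota E (act X' (gamma E e) (ker_map X' ?b)) \<otimes>\<^bsub>wgrp E\<^esub> kappa E (act X (delta E e) h) \<otimes>\<^bsub>wgrp E\<^esub> e"
        using e bh by (simp add: E.conj_kappa[OF e bh(2)] E.W.m_assoc)
      finally show ?thesis
        using e bh s by (simp add: kappa_q X'.act_inv)
    qed
    show "iota ?A (act U (gamma ?A e) g) \<otimes>\<^bsub>wgrp ?A\<^esub> e = e \<otimes>\<^bsub>wgrp ?A\<^esub> iota ?A g"
      if "e \<in> carrier (wgrp ?A)" "g \<in> carrier (grp2 U)" for e g
      using that by (simp add: E.conj_iota)
    show "\<exists>g\<in>carrier (grp2 U). e = iota ?A g" if "e \<in> carrier (wgrp ?A)" "delta ?A e = \<one>\<^bsub>grp1 L\<^esub>" for e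
      using that E.ker_deltaE[of e] by auto
    show "\<exists>e\<in>carrier (wgrp ?A). delta ?A e = x" if "x \<in> carrier (grp1 L)" for x
      using that E.delta_surjE[of x] by auto
  qed (use E.iota_hom E.delta_hom in auto)
  then interpret A: is_butterfly L U ?A .
  show A_over: "bfly_over L U ?A (\<lambda>c. c) (\<lambda>b. b)"
    by (auto simp: bfly_over_def kappa_q)
  \<comment> \<open>At \<open>q 1 h\<close> the factor from \<open>iota\<close> is trivial, so the
    identity map of the common group is a 2-cell.\<close>
  have "two_cell X X' (restrict_bfly ?A) E (\<lambda>e. e)"
    by (auto simp: two_cell_def hom_def kappa_q)
  then show "bfly_iso X X' (restrict_bfly ?A) E"
    using two_cell_imp_bfly_iso[OF is_butterfly_restrict_bfly[OF A.is_butterfly_axioms] E] by metis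
qed

text \<open>Both sets may be empty here, so the bijection settles the existence question of (i)
  along with transporting the action of (ii).\<close>

lemma bij_betw_base_change_map:
  "bij_betw (base_change_map X X' (\<phi>0, \<phi>)) (fibre_hom (\<Pi>\<^sub>m U) L U) (bext_hom_over X X' (\<phi>0, \<phi>))"
proof -
  note X_ext = X.crossed_extension_axioms X'.crossed_extension_axioms
  note LU = L.crossed_extension_axioms U.crossed_extension_axioms
  note over_iff = bfly_class_in_bext_hom_over_iff[OF X_ext _ \<phi>_extensional]
  note fibre_iff = bfly_class_in_fibre_hom_iff[OF LU ext_module_lower_star refl]
  show ?thesis
  proof (rule bij_betwI')
    fix \<A> \<A>' assume \<A>: "\<A> \<in> fibre_hom (\<Pi>\<^sub>m U) L U" and \<A>': "\<A>' \<in> fibre_hom (\<Pi>\<^sub>m U) L U"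
    obtain A where "A \<in> \<A>" and A: "is_butterfly L U A" "bfly_over L U A (\<lambda>c. c) (\<lambda>b. b)" "\<A> = bfly_class L U A"
      using fibre_homE[OF LU \<A>] .
    obtain A' where "A' \<in> \<A>'" and A': "is_butterfly L U A'" "bfly_over L U A' (\<lambda>c. c) (\<lambda>b. b)" "\<A>' = bfly_class L U A'"
      using fibre_homE[OF LU \<A>'] .
    show "base_change_map X X' (\<phi>0, \<phi>) \<A> = base_change_map X X' (\<phi>0, \<phi>) \<A>' \<longleftrightarrow> \<A> = \<A>'"
    proof
      assume "base_change_map X X' (\<phi>0, \<phi>) \<A> = base_change_map X X' (\<phi>0, \<phi>) \<A>'"
      then have "bfly_iso X X' (restrict_bfly A) (restrict_bfly A')"
        unfolding A(3) A'(3) base_change_map_bfly_class[OF A(1)] base_change_map_bfly_class[OF A'(1)]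
        using bfly_class_eq_iff[OF is_butterfly_restrict_bfly[OF A(1)] is_butterfly_restrict_bfly[OF A'(1)]] by simp
      then have "bfly_iso L U A A'" by (rule bfly_iso_of_restrict_bfly[OF A(1,2) A'(1,2)])
      then show "\<A> = \<A>'" unfolding A(3) A'(3) using bfly_class_eq_iff[OF A(1) A'(1)] by simp
    qed simp
  next
    fix \<A> assume \<A>: "\<A> \<in> fibre_hom (\<Pi>\<^sub>m U) L U"
    obtain A where "A \<in> \<A>" and A: "is_butterfly L U A" "bfly_over L U A (\<lambda>c. c) (\<lambda>b. b)" "\<A> = bfly_class L U A"
      using fibre_homE[OF LU \<A>] .
    show "base_change_map X X' (\<phi>0, \<phi>) \<A> \<in> bext_hom_over X X' (\<phi>0, \<phi>)"
      unfolding A(3) base_change_map_bfly_class[OF A(1)] over_iff[OF is_butterfly_restrict_bfly[OF A(1)]]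
      by (rule bfly_over_restrict_bfly[OF A(1,2)])
  next
    fix \<E> assume \<E>: "\<E> \<in> bext_hom_over X X' (\<phi>0, \<phi>)"
    then have "\<E> \<in> bext_hom X X'" by (simp add: bext_hom_over_def)
    then obtain E where "E \<in> \<E>" and E: "is_butterfly X X' E" "\<E> = bfly_class X X' E" by (rule bext_homE)
    then have over: "bfly_over X X' E \<phi>0 \<phi>" using \<E> over_iff[OF E(1)] by simp
    note A = is_butterfly_extend_bfly[OF E(1) over] bfly_over_extend_bfly[OF E(1) over]
    have "\<E> = base_change_map X X' (\<phi>0, \<phi>) (bfly_class L U (extend_bfly E))"
      unfolding E(2) base_change_map_bfly_class[OF A(1)]
      using bfly_class_eq_iff[OF is_butterfly_restrict_bfly[OF A(1)] E(1)] bfly_iso_restrict_extend[OF E(1) over] by simp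
    moreover have "bfly_class L U (extend_bfly E) \<in> fibre_hom (\<Pi>\<^sub>m U) L U"
      unfolding fibre_iff[OF A(1)] by (rule A(2))
    ultimately show "\<exists>\<A>\<in>fibre_hom (\<Pi>\<^sub>m U) L U. \<E> = base_change_map X X' (\<phi>0, \<phi>) \<A>" by blast
  qed
qed

end

section \<open>The simply transitive action\<close>

text \<open>Every arrow over an identity is invertible, so all endomorphisms in the fibre are
  automorphisms.\<close>

lemma group_fibre_aut:
  assumes "crossed_extension X"
  shows "group (fibre_aut X)"
proof (rule groupI)
  fix \<F> assume "\<F> \<in> carrier (fibre_aut X)"
  then show "\<exists>\<G>\<in>carrier (fibre_aut X). \<G> \<otimes>\<^bsub>fibre_aut X\<^esub> \<F> = \<one>\<^bsub>fibre_aut X\<^esub>"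
    using fibre_hom_inverse[OF assms assms] by (simp add: fibre_aut_def) metis
qed (use assms in \<open>auto simp: fibre_aut_def bext_id_in_fibre_hom fibre_comp_closed bext_comp_assoc
    fibre_hom_subset bext_comp_id_left bext_comp_id_right\<close>)

text \<open>Isolates the argument in the fibre groupoid: \<open>S\<close> is any set in bijection
  with the arrows from \<open>L\<close> to \<open>U\<close>, and \<open>\<alpha>\<close> is
  postcomposition transported along \<open>\<beta>\<close>. Base change enters only as an instance
  of \<open>\<beta>\<close>.\<close>

locale simply_transitive_fibre =
  L: crossed_extension L + U: crossed_extension U
  for L :: "('h2, 'h1, 'b, 'c) crossed_ext" and U :: "('g2, 'g1, 'b, 'c) crossed_ext" +
  fixes S :: "'s set" and \<beta> :: "('h2, 'h1, 'g2, 'g1) std_butterfly set \<Rightarrow> 's"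
  assumes \<beta>: "bij_betw \<beta> (fibre_hom (\<Pi>\<^sub>m U) L U) S"
begin

abbreviation "H \<equiv> fibre_hom (\<Pi>\<^sub>m U) L U"
abbreviation "\<Gamma> \<equiv> fibre_aut U"
definition "\<alpha> \<F> = (\<lambda>\<E>\<in>S. \<beta> (bext_comp L U U (inv_into H \<beta> \<E>) \<F>))"

lemma \<Gamma>_simps [simp]:
  "carrier \<Gamma> = fibre_hom (\<Pi>\<^sub>m U) U U" "\<F> \<otimes>\<^bsub>\<Gamma>\<^esub> \<G> = bext_comp U U U \<G> \<F>" "\<one>\<^bsub>\<Gamma>\<^esub> = bext_id U"
  by (simp_all add: fibre_aut_def)

lemma comp_closed: "\<lbrakk>\<A> \<in> H; \<F> \<in> fibre_hom (\<Pi>\<^sub>m U) U U\<rbrakk> \<Longrightarrow> bext_comp L U U \<A> \<F> \<in> H"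
  by (rule fibre_comp_closed[OF L.crossed_extension_axioms U.crossed_extension_axioms U.crossed_extension_axioms])

lemma \<beta>_closed: "\<A> \<in> H \<Longrightarrow> \<beta> \<A> \<in> S"
  using \<beta> by (rule bij_betw_apply)

lemma \<beta>_eq_iff: "\<lbrakk>\<A> \<in> H; \<A>' \<in> H\<rbrakk> \<Longrightarrow> \<beta> \<A> = \<beta> \<A>' \<longleftrightarrow> \<A> = \<A>'"
  using \<beta> by (auto simp: bij_betw_def inj_on_def)

lemma \<beta>_surjE:
  assumes "\<E> \<in> S"
  obtains \<A> where "\<A> \<in> H" "\<E> = \<beta> \<A>"
  using \<beta> assms by (auto simp: bij_betw_def)

lemma \<alpha>_\<beta>: "\<A> \<in> H \<Longrightarrow> \<alpha> \<F> (\<beta> \<A>) = \<beta> (bext_comp L U U \<A> \<F>)"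
  using \<beta> by (simp add: \<alpha>_def \<beta>_closed bij_betw_inv_into_left)

lemma simply_transitive_action_\<alpha>: "simply_transitive_action \<Gamma> S \<alpha>"
proof -
  have "\<alpha> \<in> hom \<Gamma> (BijGroup S)"
  proof (rule hom_into_BijGroupI)
    show "group \<Gamma>" by (rule group_fibre_aut) (rule U.crossed_extension_axioms)
    fix \<F> assume \<F>: "\<F> \<in> carrier \<Gamma>"
    show "\<alpha> \<F> \<in> extensional S" by (simp add: \<alpha>_def)
    fix \<E> assume "\<E> \<in> S"
    then obtain \<A> where \<A>: "\<A> \<in> H" "\<E> = \<beta> \<A>" by (rule \<beta>_surjE)
    with \<F> show "\<alpha> \<F> \<E> \<in> S" by (simp add: \<alpha>_\<beta> \<beta>_closed comp_closed)
    \<comment> \<open>\<open>bext_comp\<close> is diagrammatic and the product of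
      \<open>\<Gamma>\<close> is not; the reversal makes postcomposition a left action.\<close>
    fix \<G> assume "\<G> \<in> carrier \<Gamma>"
    with \<A> \<F> show "\<alpha> (\<F> \<otimes>\<^bsub>\<Gamma>\<^esub> \<G>) \<E> = \<alpha> \<F> (\<alpha> \<G> \<E>)"
      by (simp add: \<alpha>_\<beta> comp_closed bext_comp_assoc[OF fibre_hom_subset fibre_hom_subset fibre_hom_subset])
  next
    fix \<E> assume "\<E> \<in> S"
    then obtain \<A> where "\<A> \<in> H" "\<E> = \<beta> \<A>" by (rule \<beta>_surjE)
    then show "\<alpha> \<one>\<^bsub>\<Gamma>\<^esub> \<E> = \<E>" by (simp add: \<alpha>_\<beta> bext_comp_id_right fibre_hom_subset)
  qed
  then have "group_hom \<Gamma> (BijGroup S) \<alpha>"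
    using group_fibre_aut[OF U.crossed_extension_axioms]
    by (simp add: group_hom_def group_hom_axioms_def group_BijGroup)
  moreover have "\<exists>!\<F>. \<F> \<in> carrier \<Gamma> \<and> \<alpha> \<F> \<E> = \<E>'" if \<E>: "\<E> \<in> S" and \<E>': "\<E>' \<in> S" for \<E> \<E>'
  proof -
    obtain \<A> where \<A>: "\<A> \<in> H" "\<E> = \<beta> \<A>" using \<E> by (rule \<beta>_surjE)
    obtain \<A>' where \<A>': "\<A>' \<in> H" "\<E>' = \<beta> \<A>'" using \<E>' by (rule \<beta>_surjE)
    \<comment> \<open>With this inverse of \<open>\<A>\<close>, the only candidate for the element
      carrying \<open>\<A>\<close> to \<open>\<A>'\<close> is \<open>\<B>\<close> followed by
      \<open>\<A>'\<close>.\<close>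
    obtain \<B> where \<B>: "\<B> \<in> fibre_hom (\<Pi>\<^sub>m U) U L" "bext_comp L U L \<A> \<B> = bext_id L"
      "bext_comp U L U \<B> \<A> = bext_id U"
      using fibre_hom_inverse[OF L.crossed_extension_axioms U.crossed_extension_axioms \<A>(1)] .
    note hom = \<A>(1)[THEN fibre_hom_subset] \<A>'(1)[THEN fibre_hom_subset] \<B>(1)[THEN fibre_hom_subset]
    show ?thesis
    proof (rule ex1I)
      have "bext_comp U L U \<B> \<A>' \<in> fibre_hom (\<Pi>\<^sub>m U) U U"
        by (rule fibre_comp_closed[OF U.crossed_extension_axioms L.crossed_extension_axioms
          U.crossed_extension_axioms \<B>(1) \<A>'(1)])
      moreover have "bext_comp L U U \<A> (bext_comp U L U \<B> \<A>') = \<A>'"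
        using bext_comp_assoc[OF hom(1,3,2)] \<B>(2) bext_comp_id_left[OF hom(2)] by simp
      ultimately show "bext_comp U L U \<B> \<A>' \<in> carrier \<Gamma> \<and> \<alpha> (bext_comp U L U \<B> \<A>') \<E> = \<E>'"
        using \<A> \<A>' by (simp add: \<alpha>_\<beta>)
    next
      fix \<F> assume *: "\<F> \<in> carrier \<Gamma> \<and> \<alpha> \<F> \<E> = \<E>'"
      then have "\<F> \<in> fibre_hom (\<Pi>\<^sub>m U) U U" by simp
      moreover from this have "bext_comp L U U \<A> \<F> = \<A>'"
        using * \<A> \<A>' \<beta>_eq_iff[OF comp_closed] by (simp add: \<alpha>_\<beta>)
      ultimately have \<F>: "\<F> \<in> fibre_hom (\<Pi>\<^sub>m U) U U" "bext_comp L U U \<A> \<F> = \<A>'" .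
      \<comment> \<open>Composing with \<open>\<B>\<close> in front cancels
        \<open>\<A>\<close>.\<close>
      show "\<F> = bext_comp U L U \<B> \<A>'"
        using bext_comp_assoc[OF hom(3,1) \<F>(1)[THEN fibre_hom_subset]] \<B>(3) \<F>(2)
          bext_comp_id_left[OF \<F>(1)[THEN fibre_hom_subset]] by simp
    qed
  qed
  ultimately show ?thesis
    by (simp add: simply_transitive_action_def simply_transitive_action_axioms_def group_action_def)
qed

text \<open>Arrows of a fibre have inverses in it. So one from \<open>L\<close> to \<open>U\<close>
  exists exactly when one exists in the opposite direction, and the latter is an isomorphism by
  itself.\<close>

lemma fibre_iso_iff: "S \<noteq> {} \<longleftrightarrow> (\<exists>\<F>\<in>fibre_hom (\<Pi>\<^sub>m U) U L. bext_is_iso U L \<F>)"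
proof
  assume "S \<noteq> {}"
  then obtain \<A> where \<A>: "\<A> \<in> H" using \<beta> by (auto simp: bij_betw_def)
  obtain \<B> where \<B>: "\<B> \<in> fibre_hom (\<Pi>\<^sub>m U) U L" "bext_comp L U L \<A> \<B> = bext_id L"
    "bext_comp U L U \<B> \<A> = bext_id U"
    using fibre_hom_inverse[OF L.crossed_extension_axioms U.crossed_extension_axioms \<A>] .
  have "bext_is_iso U L \<B>"
    unfolding bext_is_iso_def
    using \<B>(2,3) fibre_hom_subset[OF \<A>] fibre_hom_subset[OF \<B>(1)] by (intro conjI bexI[of _ \<A>])
  with \<B>(1) show "\<exists>\<F>\<in>fibre_hom (\<Pi>\<^sub>m U) U L. bext_is_iso U L \<F>" ..
next
  assume "\<exists>\<F>\<in>fibre_hom (\<Pi>\<^sub>m U) U L. bext_is_iso U L \<F>"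
  then obtain \<F> where \<F>: "\<F> \<in> fibre_hom (\<Pi>\<^sub>m U) U L" by blast
  obtain \<A> where "\<A> \<in> H" "bext_comp U L U \<F> \<A> = bext_id U" "bext_comp L U L \<A> \<F> = bext_id L"
    using fibre_hom_inverse[OF U.crossed_extension_axioms L.crossed_extension_axioms \<F>] .
  then show "S \<noteq> {}" using \<beta>_closed by auto
qed

end

theorem theorem6p7:
  fixes X :: "('h2, 'h1, 'b, 'c) crossed_ext"
    and X' :: "('g2, 'g1, 'd, 'k) crossed_ext"
    and \<phi>0 :: "'c \<Rightarrow> 'k" and \<phi> :: "'b \<Rightarrow> 'd"
  assumes "crossed_extension X" and "crossed_extension X'"
    and "(\<phi>0, \<phi>) \<in> mod_hom (\<Pi>\<^sub>m X) (\<Pi>\<^sub>m X')"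
  shows "let S = bext_hom_over X X' (\<phi>0, \<phi>);
             U = upper_star (coker_grp X) \<phi>0 X';
             L = lower_star (\<phi>0, \<phi>) X (\<Pi>\<^sub>m X')
         in (S \<noteq> {} \<longleftrightarrow> (\<exists>\<F>\<in>fibre_hom (\<Pi>\<^sub>m U) U L. bext_is_iso U L \<F>)) \<and>
            (S \<noteq> {} \<longrightarrow>
               bij_betw (base_change_map X X' (\<phi>0, \<phi>)) (fibre_hom (\<Pi>\<^sub>m U) L U) S \<and>
               simply_transitive_action (fibre_aut U) S (base_change_action X X' (\<phi>0, \<phi>)))"
proof -
  interpret extension_module_morphism X X' \<phi>0 \<phi>
    using assms by (simp add: extension_module_morphism_def extension_module_morphism_axioms_def)
  interpret T: simply_transitive_fibre L U "bext_hom_over X X' (\<phi>0, \<phi>)" "base_change_map X X' (\<phi>0, \<phi>)"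
    by unfold_locales (rule bij_betw_base_change_map)
  \<comment> \<open>True by definition: \<open>inv_into\<close> is taken on the same set of arrows
    on both sides.\<close>
  have "base_change_action X X' (\<phi>0, \<phi>) = T.\<alpha>"
    by (simp add: fun_eq_iff base_change_action_def T.\<alpha>_def Let_def)
  then show ?thesis
    unfolding Let_def using T.fibre_iso_iff bij_betw_base_change_map T.simply_transitive_action_\<alpha> by simp
qed

end
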